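(* For any integer $k\geq 2$, the standard metric $g_s$ of $\mathbb S^2$, normalized to volume one, does not maximize $\lambda_k$; that is, there exists a Riemannian metric $g_k$ of volume one on $\mathbb S^2$ such that $$\lambda_k(g_k)>\lambda_k(g_s).$$
   Context: For a (smooth) Riemannian metric $g$ on a closed connected manifold, $0=\lambda_0(g)<\lambda_1(g)\leq\lambda_2(g)\leq\cdots$ denote the eigenvalues, repeated according to multiplicity, of the (nonnegative) Laplace-Beltrami operator $\Delta_g$ acting on functions. Here volume means area, and $g_s$ is the round metric on $\mathbb S^2$ rescaled to have area one. *)

theory Defs
  imports "HOL-Analysis.Analysis" "HOL-Library.Extended_Nat" "HOL-Library.Extended_Real"
begin

text \<open>
  The two-sphere is \<open>sphere 0 1\<close> in \<open>real^3\<close>.  Functions and tensors on it are represented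
  by total functions on the ambient space, of which only the restriction to the sphere (and,
  for tensors, to tangent vectors) is ever inspected.
\<close>

definition partial :: "'n \<Rightarrow> (real^'n \<Rightarrow> 'b) \<Rightarrow> real^'n \<Rightarrow> 'b::real_normed_vector" where
  "partial i h y = frechet_derivative h (at y) (axis i 1)"

text \<open>\<open>C\<^sup>\<infinity>\<close> on the whole space: all iterated partial derivatives exist and are differentiable.\<close>

definition smooth :: "(real^'n \<Rightarrow> 'b::real_normed_vector) \<Rightarrow> bool" where
  "smooth h \<longleftrightarrow> (\<forall>is y. (foldr partial is h) differentiable (at y))"

text \<open>
  The inverse of stereographic projection from the pole \<open>(0, 0, e)\<close>, where \<open>e = 1\<close> or
  \<open>e = -1\<close>: a parametrization of the sphere without that pole.  The two parametrizations
  together form an atlas.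
\<close>

definition stereo :: "real \<Rightarrow> real^2 \<Rightarrow> real^3" where
  "stereo e y = (1 / ((norm y)\<^sup>2 + 1)) *\<^sub>R vector [2 * y$1, 2 * y$2, e * ((norm y)\<^sup>2 - 1)]"

definition smooth_on_sphere :: "(real^3 \<Rightarrow> real) \<Rightarrow> bool" where
  "smooth_on_sphere f \<longleftrightarrow> (\<forall>e\<in>{1, -1}. smooth (\<lambda>y. f (stereo e y)))"

type_synonym tensor2 = "real^3 \<Rightarrow> real^3 \<Rightarrow> real^3 \<Rightarrow> real"

definition tangent_space :: "real^3 \<Rightarrow> (real^3) set" where
  "tangent_space p = {v. p \<bullet> v = 0}"

definition coord_metric :: "tensor2 \<Rightarrow> (real^2 \<Rightarrow> real^3) \<Rightarrow> real^2 \<Rightarrow> real^2^2" where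
  "coord_metric g \<phi> y = (\<chi> i j. g (\<phi> y) (partial i \<phi> y) (partial j \<phi> y))"

definition riemannian_metric :: "tensor2 \<Rightarrow> bool" where
  "riemannian_metric g \<longleftrightarrow>
     (\<forall>p\<in>sphere 0 1. \<forall>u\<in>tangent_space p. \<forall>v\<in>tangent_space p. \<forall>w\<in>tangent_space p. \<forall>a b.
        g p u v = g p v u \<and> g p (a *\<^sub>R u + b *\<^sub>R v) w = a * g p u w + b * g p v w) \<and>
     (\<forall>p\<in>sphere 0 1. \<forall>v\<in>tangent_space p. v \<noteq> 0 \<longrightarrow> g p v v > 0) \<and>
     (\<forall>e\<in>{1, -1}. \<forall>i j. smooth (\<lambda>y. coord_metric g (stereo e) y $ i $ j))"

text \<open>Total area; the pole missed by the parametrization is a null set.\<close>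

definition area :: "tensor2 \<Rightarrow> real" where
  "area g = (\<integral>y. sqrt (det (coord_metric g (stereo 1) y)) \<partial>lborel)"

text \<open>The nonnegative Laplacian in coordinates: minus the divergence of the gradient.\<close>

definition coord_laplacian ::
  "tensor2 \<Rightarrow> (real^2 \<Rightarrow> real^3) \<Rightarrow> (real^3 \<Rightarrow> real) \<Rightarrow> real^2 \<Rightarrow> real" where
  "coord_laplacian g \<phi> f y =
     - (1 / sqrt (det (coord_metric g \<phi> y))) *
       (\<Sum>i\<in>UNIV. \<Sum>j\<in>UNIV.
          partial i (\<lambda>z. sqrt (det (coord_metric g \<phi> z)) * matrix_inv (coord_metric g \<phi> z) $ i $ j
                         * partial j (\<lambda>x. f (\<phi> x)) z) y)"

text \<open>
  The coordinate expression does not depend on the parametrization, so one around each point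
  suffices.
\<close>

definition laplace_beltrami :: "tensor2 \<Rightarrow> (real^3 \<Rightarrow> real) \<Rightarrow> real^3 \<Rightarrow> real" where
  "laplace_beltrami g f p =
     (let \<phi> = stereo (if p = axis 3 1 then -1 else 1) in coord_laplacian g \<phi> f (inv \<phi> p))"

definition eigenspace :: "tensor2 \<Rightarrow> real \<Rightarrow> (real^3 \<Rightarrow> real) set" where
  "eigenspace g \<mu> =
     {f. smooth_on_sphere f \<and> (\<forall>p\<in>sphere 0 1. laplace_beltrami g f p = \<mu> * f p)}"

text \<open>
  Linear independence of the restrictions to the sphere; distinct elements of \<open>B\<close> with the
  same restriction count as dependent.
\<close>

definition independent_on_sphere :: "(real^3 \<Rightarrow> real) set \<Rightarrow> bool" where
  "independent_on_sphere B \<longleftrightarrow>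
     (\<forall>c. (\<forall>p\<in>sphere 0 1. (\<Sum>f\<in>B. c f * f p) = 0) \<longrightarrow> (\<forall>f\<in>B. c f = 0))"

text \<open>
  The dimension of the space of restrictions to the sphere of functions in the eigenspace;
  it is \<open>0\<close> unless \<open>\<mu>\<close> is an eigenvalue.
\<close>

definition multiplicity :: "tensor2 \<Rightarrow> real \<Rightarrow> enat" where
  "multiplicity g \<mu> =
     (SUP B\<in>{B. finite B \<and> B \<subseteq> eigenspace g \<mu> \<and> independent_on_sphere B}. enat (card B))"

text \<open>The number of eigenvalues in \<open>{..x}\<close>, counted with multiplicity.\<close>

definition eigenvalue_count :: "tensor2 \<Rightarrow> real \<Rightarrow> enat" where
  "eigenvalue_count g x = (SUP A\<in>{A. finite A \<and> A \<subseteq> {..x}}. \<Sum>\<mu>\<in>A. multiplicity g \<mu>)"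

text \<open>
  The entry with index \<open>k\<close>, counting from \<open>0\<close>, of the nondecreasing list of eigenvalues repeated
  according to multiplicity.  The spectrum of a Riemannian metric on the sphere is discrete and
  unbounded above, so for such a metric the infimum is a minimum and in particular a real number;
  the value \<open>\<infinity>\<close> would mean that there are at most \<open>k\<close> eigenvalues.
\<close>

definition eigenvalue :: "nat \<Rightarrow> tensor2 \<Rightarrow> ereal" where
  "eigenvalue k g = Inf {ereal x | x. enat (Suc k) \<le> eigenvalue_count g x}"

text \<open>The metric induced from the ambient space has area \<open>4\<pi>\<close>, and area is linear in the metric.\<close>

definition round_metric :: tensor2 where
  "round_metric p v w = (v \<bullet> w) / (4 * pi)"

end

theory Submission
  imports Defs
begin

text \<open>
  Let \<open>l\<close> be the integer part of \<open>\<surd>k\<close>.  The harmonics of degree at most \<open>l\<close> number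
  \<open>(l + 1)\<^sup>2 > k\<close>, so the \<open>k\<close>-th eigenvalue of the round metric of area one is at most
  \<open>4 \<pi> l (l + 1) \<le> 6 \<pi> k\<close>.  On the other hand \<open>k\<close> round spheres of area \<open>1 / k\<close>, joined in a
  chain by very thin necks, form a sphere whose \<open>k\<close>-th eigenvalue is nearly \<open>8 \<pi> k\<close>: every
  single sphere has first positive eigenvalue \<open>8 \<pi> k\<close>, and the constants on the \<open>k\<close> pieces
  account for only \<open>k\<close> smaller eigenvalues.  There is room to spare between \<open>6 \<pi> k\<close> and
  \<open>8 \<pi> k\<close>, so it suffices to show that at most \<open>k\<close> eigenvalues lie below \<open>6.8 \<pi> k\<close>.

  The chain is realized inside the conformal class of the round metric, as the average of \<open>k\<close>
  pullbacks of the round metric under dilations \<open>y \<mapsto> e\<^sup>-\<^sup>\<tau> y\<close> of the stereographic plane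
  (\<open>bubble_factor\<close>).  Every summand has area one, hence so has the average.  In the
  coordinates \<open>y = e\<^sup>t (cos \<theta>, sin \<theta>)\<close> an eigenfunction of eigenvalue \<open>4 \<pi> k \<nu>\<close>
  satisfies \<open>F\<^sub>t\<^sub>t + F\<^sub>\<theta>\<^sub>\<theta> = - \<nu> P(t) F\<close> with \<open>P(t) = \<Sum>\<^sub>j sech\<^sup>2(t - \<tau>\<^sub>j)\<close>, and the
  centres \<open>\<tau>\<^sub>j\<close> are taken far apart.

  If there were \<open>k + 1\<close> independent eigenfunctions with \<open>\<nu> < 17/10\<close>, some nontrivial
  combination \<open>u\<close> would have vanishing mean over each of the \<open>k\<close> circles \<open>t = \<tau>\<^sub>j\<close>
  (\<open>underdetermined_system\<close>).  The energy of such a \<open>u\<close> is bounded below by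
  \<open>17/10 \<integral> P u\<^sup>2\<close>.  This is Barta's principle, in Riccati form: a function \<open>q = w' / w\<close> with
  \<open>- q' - q\<^sup>2 \<ge> L P\<close> gives \<open>f'\<^sup>2 \<ge> (q f\<^sup>2)' + L P f\<^sup>2\<close> by completing a square.  It is applied twice.
  For the mean of \<open>u\<close> over the circles, \<open>q\<close> may jump upwards at the \<open>\<tau>\<^sub>j\<close>, where the mean
  vanishes (\<open>mean_multiplier\<close>).  For the part of \<open>u\<close> with mean zero, Wirtinger's inequality on
  the circle contributes almost one to the left-hand side (\<open>fluctuation_multiplier\<close>).

  The lower bound and the eigenvalue equation are combined pointwise in \<open>t\<close>.  All terms except
  a nonnegative one are derivatives of quantities that tend to zero at both ends of the
  cylinder; this includes the products of eigenfunctions of distinct eigenvalues, whose overlap is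
  the derivative of a Wronskian.  So a nondecreasing function has limit zero at both ends, and
  is zero, which forces every component of \<open>u\<close> to vanish
  (\<open>eigenfunctions_vanish\<close>).
\<close>

section \<open>Iterated partial derivatives\<close>

text \<open>
  Smoothness up to a finite order, by recursion on the order.  Unlike the condition on all iterated
  partial derivatives at once, it can be carried through products by induction.
\<close>

primrec Ck :: "nat \<Rightarrow> (real^'n \<Rightarrow> 'b::real_normed_vector) \<Rightarrow> bool" where
  "Ck 0 h = (\<forall>y. h differentiable (at y))"
| "Ck (Suc n) h = ((\<forall>y. h differentiable (at y)) \<and> (\<forall>i. Ck n (partial i h)))"

lemma Ck_differentiable: "Ck n h \<Longrightarrow> h differentiable (at y)"
  by (cases n) auto

lemma Ck_lower: "Ck (Suc n) h \<Longrightarrow> Ck n h"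
  by (induction n arbitrary: h) auto

lemma Ck_partial: "Ck (Suc n) h \<Longrightarrow> Ck n (partial i h)"
  by simp

lemma Ck_iff_foldr:
  "Ck n h \<longleftrightarrow> (\<forall>is y. length is \<le> n \<longrightarrow> foldr partial is h differentiable (at y))"
proof (induction n arbitrary: h)
  case 0
  then show ?case by auto
next
  case (Suc n)
  show ?case
  proof
    assume a: "Ck (Suc n) h"
    show "\<forall>is y. length is \<le> Suc n \<longrightarrow> foldr partial is h differentiable (at y)"
    proof (intro allI impI)
      fix "is" :: "'a list" and y
      assume "length is \<le> Suc n"
      then show "foldr partial is h differentiable (at y)"
        using a Suc.IH by (cases "is" rule: rev_cases) auto
    qed
  next
    assume a: "\<forall>is y. length is \<le> Suc n \<longrightarrow> foldr partial is h differentiable (at y)"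
    have "Ck n (partial i h)" for i
      unfolding Suc.IH
    proof (intro allI impI)
      fix "is" :: "'a list" and y
      assume "length is \<le> n"
      then show "foldr partial is (partial i h) differentiable (at y)"
        using a[rule_format, of "is @ [i]" y] by auto
    qed
    moreover have "h differentiable (at y)" for y
      using a[rule_format, of "[]" y] by simp
    ultimately show "Ck (Suc n) h" by simp
  qed
qed

lemma smooth_iff_Ck: "smooth h \<longleftrightarrow> (\<forall>n. Ck n h)"
  unfolding smooth_def Ck_iff_foldr by auto

lemma smooth_differentiable: "smooth h \<Longrightarrow> h differentiable (at y)"
  using Ck_differentiable smooth_iff_Ck by blast

lemma smooth_partial: "smooth h \<Longrightarrow> smooth (partial i h)"
  unfolding smooth_iff_Ck by (metis Ck_partial)

lemma partial_eq: "(h has_derivative h') (at y) \<Longrightarrow> partial i h y = h' (axis i 1)"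
  unfolding partial_def using frechet_derivative_at by metis

lemma has_derivative_frechet:
  "h differentiable (at y) \<Longrightarrow> (h has_derivative frechet_derivative h (at y)) (at y)"
  using frechet_derivative_works by blast

lemma partial_const: "partial i (\<lambda>y. c) = (\<lambda>y. 0)"
  by (rule ext, subst partial_eq[OF has_derivative_const]) simp

lemma partial_bounded_linear:
  assumes "bounded_linear L" "h differentiable (at y)"
  shows "partial i (\<lambda>z. L (h z)) y = L (partial i h y)"
  by (subst partial_eq[OF bounded_linear.has_derivative[OF assms(1) has_derivative_frechet[OF assms(2)]]])
     (simp add: partial_def)

lemma partial_add:
  assumes "f differentiable (at y)" "g differentiable (at y)"
  shows "partial i (\<lambda>z. f z + g z) y = partial i f y + partial i g y"
  by (subst partial_eq[OF has_derivative_add[OF has_derivative_frechet[OF assms(1)] has_derivative_frechet[OF assms(2)]]])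
     (simp add: partial_def)

lemma partial_mult:
  fixes f g :: "real^'n \<Rightarrow> 'b::real_normed_field"
  assumes "f differentiable (at y)" "g differentiable (at y)"
  shows "partial i (\<lambda>z. f z * g z) y = partial i f y * g y + f y * partial i g y"
  by (subst partial_eq[OF has_derivative_mult[OF has_derivative_frechet[OF assms(1)] has_derivative_frechet[OF assms(2)]]])
     (simp add: partial_def)

lemma partial_inverse:
  fixes f :: "real^'n \<Rightarrow> 'b::real_normed_field"
  assumes "f differentiable (at y)" "f y \<noteq> 0"
  shows "partial i (\<lambda>z. inverse (f z)) y = - (partial i f y * (inverse (f y) * inverse (f y)))"
  by (subst partial_eq[OF Deriv.has_derivative_inverse[OF assms(2) has_derivative_frechet[OF assms(1)]]])
     (simp add: partial_def mult_ac)

lemma Ck_const: "Ck n (\<lambda>y. c)"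
  by (induction n arbitrary: c) (auto simp: partial_const)

lemma Ck_bounded_linear: "bounded_linear L \<Longrightarrow> Ck n h \<Longrightarrow> Ck n (\<lambda>y. L (h y))"
proof (induction n arbitrary: h)
  case 0
  then show ?case
    by (auto simp: differentiable_def intro: bounded_linear.has_derivative)
next
  case (Suc n)
  have d: "h differentiable (at y)" for y using Suc.prems by simp
  have "partial i (\<lambda>y. L (h y)) = (\<lambda>y. L (partial i h y))" for i
    using partial_bounded_linear[OF Suc.prems(1) d] by blast
  moreover have "(\<lambda>y. L (h y)) differentiable (at y)" for y
    using d Suc.prems(1) by (auto simp: differentiable_def intro: bounded_linear.has_derivative)
  ultimately show ?case using Suc by simp
qed

lemma Ck_add: "Ck n f \<Longrightarrow> Ck n g \<Longrightarrow> Ck n (\<lambda>y. f y + g y)"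
proof (induction n arbitrary: f g)
  case (Suc n)
  have "partial i (\<lambda>y. f y + g y) = (\<lambda>y. partial i f y + partial i g y)" for i
    using Suc.prems by (intro ext partial_add) auto
  then show ?case using Suc by simp
qed auto

lemma Ck_mult:
  fixes f g :: "real^'n \<Rightarrow> 'b::real_normed_field"
  shows "Ck n f \<Longrightarrow> Ck n g \<Longrightarrow> Ck n (\<lambda>y. f y * g y)"
proof (induction n arbitrary: f g)
  case (Suc n)
  have "partial i (\<lambda>y. f y * g y) = (\<lambda>y. partial i f y * g y + f y * partial i g y)" for i
    using Suc.prems by (intro ext partial_mult) auto
  moreover have "Ck n f" "Ck n g" using Suc.prems Ck_lower by blast+
  ultimately show ?case using Suc by (auto intro!: Ck_add differentiable_mult)
qed auto

lemma Ck_inverse: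
  fixes f :: "real^'n \<Rightarrow> 'b::real_normed_field"
  assumes nz: "\<And>y. f y \<noteq> 0"
  shows "Ck n f \<Longrightarrow> Ck n (\<lambda>y. inverse (f y))"
proof (induction n)
  case 0
  then show ?case using nz by (auto intro!: differentiable_inverse)
next
  case (Suc n)
  have "partial i (\<lambda>y. inverse (f y)) = (\<lambda>y. - (partial i f y * (inverse (f y) * inverse (f y))))" for i
    using Suc.prems nz by (intro ext partial_inverse) auto
  moreover have "Ck n f" using Suc.prems Ck_lower by blast
  moreover have "(\<lambda>y. inverse (f y)) differentiable (at y)" for y
    using Suc.prems nz by (auto intro!: differentiable_inverse)
  ultimately show ?case
    using Suc by (auto intro!: Ck_mult Ck_bounded_linear[OF bounded_linear_minus[OF bounded_linear_ident]])
qed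

lemma smooth_const: "smooth (\<lambda>y. c)"
  by (simp add: smooth_iff_Ck Ck_const)

lemma smooth_bounded_linear: "bounded_linear L \<Longrightarrow> smooth h \<Longrightarrow> smooth (\<lambda>y. L (h y))"
  by (simp add: smooth_iff_Ck Ck_bounded_linear)

lemma smooth_add: "smooth f \<Longrightarrow> smooth g \<Longrightarrow> smooth (\<lambda>y. f y + g y)"
  by (simp add: smooth_iff_Ck Ck_add)

lemma smooth_mult:
  fixes f g :: "real^'n \<Rightarrow> 'b::real_normed_field"
  shows "smooth f \<Longrightarrow> smooth g \<Longrightarrow> smooth (\<lambda>y. f y * g y)"
  by (simp add: smooth_iff_Ck Ck_mult)

lemma smooth_inverse:
  fixes f :: "real^'n \<Rightarrow> 'b::real_normed_field"
  shows "(\<And>y. f y \<noteq> 0) \<Longrightarrow> smooth f \<Longrightarrow> smooth (\<lambda>y. inverse (f y))"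
  by (simp add: smooth_iff_Ck Ck_inverse)

lemma smooth_divide:
  fixes f g :: "real^'n \<Rightarrow> 'b::real_normed_field"
  shows "(\<And>y. g y \<noteq> 0) \<Longrightarrow> smooth f \<Longrightarrow> smooth g \<Longrightarrow> smooth (\<lambda>y. f y / g y)"
  unfolding divide_inverse by (intro smooth_mult smooth_inverse)

lemma smooth_power:
  fixes f :: "real^'n \<Rightarrow> 'b::real_normed_field"
  shows "smooth f \<Longrightarrow> smooth (\<lambda>y. f y ^ j)"
  by (induction j) (auto intro: smooth_const smooth_mult)

lemma smooth_sum: "(\<And>j. j \<in> J \<Longrightarrow> smooth (f j)) \<Longrightarrow> smooth (\<lambda>y. \<Sum>j\<in>J. f j y)"
  by (induction J rule: infinite_finite_induct) (auto intro: smooth_const smooth_add)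

lemma smooth_id: "smooth (\<lambda>y::real^'n. y)"
  unfolding smooth_iff_Ck
proof
  fix n show "Ck n (\<lambda>y::real^'n. y)"
  proof (cases n)
    case (Suc m)
    have "partial i (\<lambda>y::real^'n. y) = (\<lambda>y. axis i 1)" for i :: 'n
      by (rule ext, subst partial_eq[OF has_derivative_ident]) simp
    then show ?thesis by (simp add: Suc Ck_const)
  qed simp
qed

lemma smooth_coord: "smooth (\<lambda>y::real^'n. y $ i)"
  by (rule smooth_bounded_linear[OF bounded_linear_vec_nth smooth_id])

lemma smooth_minus: "smooth f \<Longrightarrow> smooth g \<Longrightarrow> smooth (\<lambda>y. f y - g y)"
  using smooth_add[of f "\<lambda>y. - g y"] smooth_bounded_linear[OF bounded_linear_minus[OF bounded_linear_ident], of g]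
  by simp

lemmas smooth_intros = smooth_const smooth_add smooth_minus smooth_mult smooth_divide smooth_power smooth_sum smooth_coord

section \<open>Stereographic charts and conformal metrics\<close>

lemma norm_sq_2: "(norm (y::real^2))\<^sup>2 = (y$1)\<^sup>2 + (y$2)\<^sup>2"
  by (simp add: norm_eq_sqrt_inner inner_vec_def sum_2 power2_eq_square)

lemma norm_sq_1_pos: "(norm (y::real^2))\<^sup>2 + 1 > 0"
  by (simp add: add_nonneg_pos)

lemma stereo_nth:
  "stereo e y $ 1 = 2 * y$1 / ((norm y)\<^sup>2 + 1)"
  "stereo e y $ 2 = 2 * y$2 / ((norm y)\<^sup>2 + 1)"
  "stereo e y $ 3 = e * ((norm y)\<^sup>2 - 1) / ((norm y)\<^sup>2 + 1)"
  by (simp_all add: stereo_def)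

lemma norm_sq_3: "(norm (y::real^3))\<^sup>2 = (y$1)\<^sup>2 + (y$2)\<^sup>2 + (y$3)\<^sup>2"
  by (simp add: norm_eq_sqrt_inner inner_vec_def sum_3 power2_eq_square)

lemma e_sq: "e \<in> {1, -1} \<Longrightarrow> e * e = (1::real)" by auto

lemma stereo_in_sphere:
  assumes "e \<in> {1, -1}"
  shows "stereo e y \<in> sphere 0 1"
proof -
  define R where "R = (y$1)\<^sup>2 + (y$2)\<^sup>2 + 1"
  have R: "R > 0" using norm_sq_1_pos[of y] by (simp add: R_def norm_sq_2)
  have r: "(norm y)\<^sup>2 + 1 = R" "(norm y)\<^sup>2 - 1 = R - 2" by (auto simp: R_def norm_sq_2)
  have "(norm (stereo e y))\<^sup>2 = (4 * ((y$1)\<^sup>2 + (y$2)\<^sup>2) + e * e * (R - 2)\<^sup>2) / R\<^sup>2"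
    unfolding norm_sq_3 stereo_nth r using R by (simp add: power_divide power_mult_distrib add_divide_distrib) (simp add: power2_eq_square)
  also have "4 * ((y$1)\<^sup>2 + (y$2)\<^sup>2) = 4 * (R - 1)" by (simp add: R_def)
  finally have "(norm (stereo e y))\<^sup>2 = 1"
    using R e_sq[OF assms] by (simp add: field_simps power2_eq_square)
  then show ?thesis by (simp add: power2_eq_1_iff) (metis norm_ge_zero not_one_le_zero neg_0_le_iff_le)
qed

definition stereo_coord :: "real \<Rightarrow> real^3 \<Rightarrow> real^2" where
  "stereo_coord e p = (1 / (1 - e * p$3)) *\<^sub>R vector [p$1, p$2]"

lemma stereo_coord_stereo:
  assumes "e \<in> {1, -1}"
  shows "stereo_coord e (stereo e y) = y"
proof -
  have R: "(norm y)\<^sup>2 + 1 > 0" by (rule norm_sq_1_pos)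
  have "1 - e * (stereo e y $ 3) = 2 / ((norm y)\<^sup>2 + 1)"
    using R unfolding stereo_nth using e_sq[OF assms] by (simp add: field_simps flip: mult.assoc)
  then have "stereo_coord e (stereo e y) $ i = y $ i" if "i = 1 \<or> i = 2" for i
    using that R by (auto simp: stereo_coord_def stereo_nth)
  then show ?thesis by (simp add: vec_eq_iff forall_2)
qed

text \<open>
  Each chart reaches every point but its own pole, so the two together cover the sphere; this is
  what makes it enough to check identities in the charts.
\<close>

lemma stereo_stereo_coord:
  assumes e: "e \<in> {1, -1}" and p: "p \<in> sphere 0 1" "p $ 3 \<noteq> e"
  shows "stereo e (stereo_coord e p) = p"
proof -
  let ?z = "e * p$3"
  have n: "(p$1)\<^sup>2 + (p$2)\<^sup>2 = 1 - (p$3)\<^sup>2"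
    using p(1) norm_sq_3[of p] by simp
  have z: "1 - ?z \<noteq> 0" using e p(2) by auto
  have zz: "?z\<^sup>2 = (p$3)\<^sup>2" using e by auto
  have "(norm (stereo_coord e p))\<^sup>2 = ((p$1)\<^sup>2 + (p$2)\<^sup>2) / (1 - ?z)\<^sup>2"
    by (simp add: stereo_coord_def norm_sq_2 power_mult_distrib power_divide add_divide_distrib)
  also have "\<dots> = (1 + ?z) / (1 - ?z)"
  proof -
    have "1 - (p$3)\<^sup>2 = (1 + ?z) * (1 - ?z)" unfolding zz[symmetric] by (simp add: algebra_simps power2_eq_square)
    then show ?thesis unfolding n using z by (simp add: power2_eq_square)
  qed
  finally have r: "(norm (stereo_coord e p))\<^sup>2 = (1 + ?z) / (1 - ?z)" .
  have r1: "(norm (stereo_coord e p))\<^sup>2 + 1 = 2 / (1 - ?z)"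
    "(norm (stereo_coord e p))\<^sup>2 - 1 = 2 * ?z / (1 - ?z)"
    unfolding r using z by (simp_all add: field_simps)
  have "stereo e (stereo_coord e p) $ 1 = p $ 1" "stereo e (stereo_coord e p) $ 2 = p $ 2"
    unfolding stereo_nth r1 using z by (simp_all add: stereo_coord_def)
  moreover have "stereo e (stereo_coord e p) $ 3 = p $ 3"
    unfolding stereo_nth r1 using z e by auto
  ultimately show ?thesis by (simp add: vec_eq_iff forall_3)
qed

lemma inv_stereo: "e \<in> {1, -1} \<Longrightarrow> inv (stereo e) (stereo e y) = y"
  by (metis inv_f_f injI stereo_coord_stereo)

lemma stereo_ne_pole: "e \<in> {1, -1} \<Longrightarrow> stereo e y $ 3 \<noteq> e"
  using norm_sq_1_pos[of y] by (auto simp: stereo_nth field_simps)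

lemma sphere_third_1:
  assumes "p \<in> sphere 0 1" "p $ 3 = 1" shows "p = (axis 3 1 :: real^3)"
proof -
  have "(p$1)\<^sup>2 + (p$2)\<^sup>2 = 0" using norm_sq_3[of p] assms by simp
  then have "p$1 = 0" "p$2 = 0" by (simp_all add: sum_power2_eq_zero_iff)
  then show ?thesis using assms by (simp add: vec_eq_iff forall_3 axis_def)
qed

lemma has_derivative_normsq:
  "((\<lambda>y::real^2. (norm y)\<^sup>2) has_derivative (\<lambda>v. 2 * (y$1 * v$1 + y$2 * v$2))) (at y)"
  unfolding norm_sq_2
  by (auto intro!: derivative_eq_intros bounded_linear.has_derivative[OF bounded_linear_vec_nth] simp: algebra_simps)

lemma has_derivative_quot:
  fixes N :: "real^2 \<Rightarrow> 'b::real_normed_field"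
  assumes N: "(N has_derivative N') (at y)"
  shows "((\<lambda>y. N y / of_real ((norm y)\<^sup>2 + 1)) has_derivative
     (\<lambda>v. N' v / of_real ((norm y)\<^sup>2 + 1) - N y * of_real (2 * (y$1 * v$1 + y$2 * v$2)) / of_real ((norm y)\<^sup>2 + 1)^2)) (at y)"
proof -
  have nz: "of_real ((norm y)\<^sup>2 + 1) \<noteq> (0::'b)"
    using norm_sq_1_pos[of y] by (metis less_irrefl of_real_eq_0_iff)
  have d: "((\<lambda>y::real^2. of_real ((norm y)\<^sup>2 + 1) :: 'b) has_derivative (\<lambda>v. of_real (2 * (y$1 * v$1 + y$2 * v$2)))) (at y)"
    by (rule has_derivative_of_real) (auto intro!: derivative_eq_intros has_derivative_normsq simp: inner_vec_def sum_2)
  have alg: "(a * c - b * d) / (c * c) = a / c - b * d / c\<^sup>2" if "c \<noteq> 0" for a b c d :: 'b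
    using that by (simp add: diff_divide_distrib power2_eq_square)
  show ?thesis
    by (rule has_derivative_eq_rhs[OF has_derivative_divide'[OF N d nz]]) (simp only: alg[OF nz])
qed

lemma has_derivative_stereo_nth:
  defines "R \<equiv> \<lambda>y::real^2. (norm y)\<^sup>2 + 1"
  shows "((\<lambda>y. stereo e y $ 1) has_derivative (\<lambda>v. 2 * v$1 / R y - 2 * y$1 * (2 * (y$1 * v$1 + y$2 * v$2)) / (R y)\<^sup>2)) (at y)" (is ?A1)
    "((\<lambda>y. stereo e y $ 2) has_derivative (\<lambda>v. 2 * v$2 / R y - 2 * y$2 * (2 * (y$1 * v$1 + y$2 * v$2)) / (R y)\<^sup>2)) (at y)" (is ?A2)
    "((\<lambda>y. stereo e y $ 3) has_derivative (\<lambda>v. e * (2 * (y$1 * v$1 + y$2 * v$2)) / R y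
         - e * ((norm y)\<^sup>2 - 1) * (2 * (y$1 * v$1 + y$2 * v$2)) / (R y)\<^sup>2)) (at y)" (is ?A3)
proof -
  have c: "((\<lambda>y::real^2. 2 * y$i) has_derivative (\<lambda>v. 2 * v$i)) (at y)" for i
    by (auto intro!: derivative_eq_intros bounded_linear.has_derivative[OF bounded_linear_vec_nth])
  have c3: "((\<lambda>y::real^2. e * ((norm y)\<^sup>2 - 1)) has_derivative (\<lambda>v. e * (2 * (y$1 * v$1 + y$2 * v$2)))) (at y)"
    by (auto intro!: derivative_eq_intros has_derivative_normsq simp: inner_vec_def sum_2)
  show ?A1
   ?A2
   ?A3
    using has_derivative_quot[OF c] has_derivative_quot[OF c3]
    unfolding stereo_nth R_def by simp_all
qed

lemma differentiable_stereo: "stereo e differentiable (at y)"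
proof -
  have "(\<lambda>y. stereo e y \<bullet> b) differentiable (at y)" if b: "b \<in> Basis" for b
  proof -
    obtain i where "b = axis i 1" using b by (auto simp: Basis_vec_def)
    then have "(\<lambda>y. stereo e y \<bullet> b) = (\<lambda>y. stereo e y $ i)" by (simp add: inner_axis)
    moreover have "i = 1 \<or> i = 2 \<or> i = 3" using exhaust_3 by blast
    ultimately show ?thesis using has_derivative_stereo_nth[of e y] by (auto simp: differentiable_def)
  qed
  then show ?thesis using differentiable_componentwise_within[of "stereo e" y UNIV] by simp
qed

lemma partial_stereo_nth: "partial i (stereo e) y $ a = partial i (\<lambda>y. stereo e y $ a) y"
  using partial_bounded_linear[OF bounded_linear_vec_nth differentiable_stereo] by metis

text \<open>
  Stereographic projection is conformal, with factor \<open>4 / (|y|\<^sup>2 + 1)\<^sup>2\<close>.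
\<close>

lemma partial_stereo_inner:
  assumes e: "e \<in> {1, -1}"
  shows "partial i (stereo e) y \<bullet> partial j (stereo e) y = (if i = j then 4 / ((norm y)\<^sup>2 + 1)\<^sup>2 else 0)"
proof -
  define R where "R = (y$1)\<^sup>2 + (y$2)\<^sup>2 + 1"
  have R: "R \<noteq> 0" using norm_sq_1_pos[of y] by (simp add: R_def norm_sq_2)
  have r: "(norm y)\<^sup>2 + 1 = R" "(norm y)\<^sup>2 - 1 = R - 2" by (auto simp: R_def norm_sq_2)
  have y2: "(y$2)\<^sup>2 = R - 1 - (y$1)\<^sup>2" by (simp add: R_def)
  have e2: "e\<^sup>2 = 1" using e by auto
  have ij: "i = 1 \<or> i = 2" "j = 1 \<or> j = 2" using exhaust_2 by blast+
  define p where "p = (\<lambda>i a. (if a = i then 2 else 0) / R - 2 * y$a * (2 * y$i) / R\<^sup>2)"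
  define q where "q = (\<lambda>i. e * (2 * y$i) / R - e * (R - 2) * (2 * y$i) / R\<^sup>2)"
  have p: "partial i (\<lambda>y. stereo e y $ 1) y = p i 1" "partial i (\<lambda>y. stereo e y $ 2) y = p i 2" for i
    unfolding partial_eq[OF has_derivative_stereo_nth(1)] partial_eq[OF has_derivative_stereo_nth(2)] p_def r
    using exhaust_2[of i] by (elim disjE; simp add: axis_def)+
  have q: "partial i (\<lambda>y. stereo e y $ 3) y = q i" for i
    unfolding partial_eq[OF has_derivative_stereo_nth(3)] q_def r
    using exhaust_2[of i] by (elim disjE; simp add: axis_def)
  have q': "q i = e * (4 * y$i) / R\<^sup>2" for i
    unfolding q_def using R by (simp add: field_simps power2_eq_square)
  have *: "partial i (stereo e) y \<bullet> partial j (stereo e) y = p i 1 * p j 1 + p i 2 * p j 2 + e\<^sup>2 * (4 * y$i) * (4 * y$j) / (R\<^sup>2)\<^sup>2"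
    unfolding inner_vec_def sum_3 inner_real_def partial_stereo_nth
    by (simp add: p q q' power2_eq_square)
  have p11: "p i i = (2 * R - 4 * (y$i)\<^sup>2) / R\<^sup>2" for i
    unfolding p_def using R by (simp add: field_simps power2_eq_square)
  have p12: "p i a = - 4 * y$i * y$a / R\<^sup>2" if "i \<noteq> a" for i a
    unfolding p_def using R that by (simp add: field_simps power2_eq_square)
  consider "i = 1" "j = 1" | "i = 2" "j = 2" | "i = 1" "j = 2" | "i = 2" "j = 1" using ij by blast
  then show ?thesis
  proof cases
    case 1
    have "p 1 1 * p 1 1 + p 1 2 * p 1 2 + 16 * (y$1)\<^sup>2 / (R\<^sup>2)\<^sup>2 = ((2 * R - 4 * (y$1)\<^sup>2)\<^sup>2 + 16 * (y$1)\<^sup>2 * (y$2)\<^sup>2 + 16 * (y$1)\<^sup>2) / (R\<^sup>2)\<^sup>2"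
      by (simp add: p11 p12 power2_eq_square add_divide_distrib)
    also have "\<dots> = 4 / R\<^sup>2"
      unfolding y2 using R by (simp add: field_simps power2_eq_square)
    finally show ?thesis unfolding * e2 using 1 by (simp add: r) (simp add: power2_eq_square)
  next
    case 2
    have "p 2 1 * p 2 1 + p 2 2 * p 2 2 + 16 * (y$2)\<^sup>2 / (R\<^sup>2)\<^sup>2 = ((2 * R - 4 * (y$2)\<^sup>2)\<^sup>2 + 16 * (y$1)\<^sup>2 * (y$2)\<^sup>2 + 16 * (y$2)\<^sup>2) / (R\<^sup>2)\<^sup>2"
      by (simp add: p11 p12 power2_eq_square add_divide_distrib)
    also have "\<dots> = 4 / R\<^sup>2"
      unfolding y2 using R by (simp add: field_simps power2_eq_square)
    finally show ?thesis unfolding * e2 using 2 by (simp add: r) (simp add: power2_eq_square)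
  next
    case 3
    have "p 1 1 * p 2 1 + p 1 2 * p 2 2 + 16 * (y$1) * (y$2) / (R\<^sup>2)\<^sup>2 = - 4 * y$1 * y$2 * (4 * R - 4 * (y$1)\<^sup>2 - 4 * (y$2)\<^sup>2 - 4) / (R\<^sup>2)\<^sup>2"
      using R by (simp add: p11 p12 field_simps)
    also have "\<dots> = 0" unfolding y2 by simp
    finally show ?thesis unfolding * e2 using 3 by simp
  next
    case 4
    have "p 1 1 * p 2 1 + p 1 2 * p 2 2 + 16 * (y$1) * (y$2) / (R\<^sup>2)\<^sup>2 = - 4 * y$1 * y$2 * (4 * R - 4 * (y$1)\<^sup>2 - 4 * (y$2)\<^sup>2 - 4) / (R\<^sup>2)\<^sup>2"
      using R by (simp add: p11 p12 field_simps)
    also have "\<dots> = 0" unfolding y2 by simp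
    finally show ?thesis unfolding * e2 using 4 by (simp add: mult_ac)
  qed
qed

definition conformal :: "(real^3 \<Rightarrow> real) \<Rightarrow> tensor2" where
  "conformal G p v w = G p * (v \<bullet> w)"

definition area_density :: "(real^3 \<Rightarrow> real) \<Rightarrow> real \<Rightarrow> real^2 \<Rightarrow> real" where
  "area_density G e y = G (stereo e y) * 4 / ((norm y)\<^sup>2 + 1)\<^sup>2"

lemma coord_metric_conformal:
  "e \<in> {1, -1} \<Longrightarrow> coord_metric (conformal G) (stereo e) y = mat (area_density G e y)"
  by (simp add: coord_metric_def conformal_def vec_eq_iff mat_def partial_stereo_inner area_density_def)

lemma det_mat_2: "det (mat s :: real^2^2) = s\<^sup>2"
  by (simp add: det_2 mat_def power2_eq_square)

lemma matrix_inv_mat: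
  assumes "s \<noteq> 0"
  shows "matrix_inv (mat s :: real^2^2) = mat (1/s)"
proof -
  let ?A = "mat s :: real^2^2" and ?B = "mat (1 / s) :: real^2^2"
  have AB: "?A ** ?B = mat 1" "?B ** ?A = mat 1"
    using assms by (auto simp: matrix_matrix_mult_def mat_def vec_eq_iff sum_2 forall_2)
  then have "?A ** matrix_inv ?A = mat 1 \<and> matrix_inv ?A ** ?A = mat 1"
    unfolding matrix_inv_def by (rule_tac someI[where x = ?B]) simp
  then show ?thesis using AB by (metis matrix_mul_assoc matrix_mul_lid matrix_mul_rid)
qed

lemma area_density_pos:
  assumes "e \<in> {1, -1}" "\<And>p. p \<in> sphere 0 1 \<Longrightarrow> G p > 0"
  shows "area_density G e y > 0"
  unfolding area_density_def using assms stereo_in_sphere norm_sq_1_pos[of y]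
  by (simp only: divide_pos_pos mult_pos_pos zero_less_power zero_less_numeral)

text \<open>
  In dimension two the factor \<open>\<surd>(det g)\<close> cancels against \<open>g\<^sup>-\<^sup>1\<close> for a conformally flat metric,
  which leaves the flat Laplacian divided by the area density.
\<close>

lemma coord_laplacian_conformal:
  fixes f :: "real^3 \<Rightarrow> real"
  assumes e: "e \<in> {1, -1}" and G: "\<And>p. p \<in> sphere 0 1 \<Longrightarrow> G p > 0"
  defines "h \<equiv> \<lambda>y. f (stereo e y)"
  shows "coord_laplacian (conformal G) (stereo e) f y =
     - (partial 1 (partial 1 h) y + partial 2 (partial 2 h) y) / area_density G e y"
proof -
  have s: "area_density G e y > 0" for y by (rule area_density_pos[OF e G])
  have "sqrt (det (coord_metric (conformal G) (stereo e) z)) * matrix_inv (coord_metric (conformal G) (stereo e) z) $ i $ j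
                         * partial j h z = (if i = j then partial j h z else 0)" for i j z
    using s[of z] unfolding coord_metric_conformal[OF e] det_mat_2
    by (subst matrix_inv_mat) (auto simp: mat_def)
  then have "coord_laplacian (conformal G) (stereo e) f y =
     - (1 / area_density G e y) * (\<Sum>i\<in>UNIV. \<Sum>j\<in>UNIV. partial i (\<lambda>z. if i = j then partial j h z else 0) y)"
    unfolding coord_laplacian_def h_def[symmetric]
    using s[of y] by (simp add: coord_metric_conformal[OF e] det_mat_2)
  also have "\<dots> = - (partial 1 (partial 1 h) y + partial 2 (partial 2 h) y) / area_density G e y"
    unfolding sum_2 by (simp add: partial_const) argo
  finally show ?thesis .
qed

lemma eigenspace_conformalD:
  assumes G: "\<And>p. p \<in> sphere 0 1 \<Longrightarrow> G p > 0" and f: "f \<in> eigenspace (conformal G) \<mu>"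
  defines "h \<equiv> \<lambda>y. f (stereo 1 y)"
  shows "partial 1 (partial 1 h) y + partial 2 (partial 2 h) y = - \<mu> * area_density G 1 y * h y"
proof -
  have "stereo 1 y \<noteq> axis 3 1" using stereo_ne_pole[of 1 y] by (auto simp: axis_def)
  then have "laplace_beltrami (conformal G) f (stereo 1 y) = coord_laplacian (conformal G) (stereo 1) f y"
    unfolding laplace_beltrami_def by (simp add: inv_stereo)
  then have "- (partial 1 (partial 1 h) y + partial 2 (partial 2 h) y) / area_density G 1 y = \<mu> * h y"
    using f stereo_in_sphere[of 1 y] coord_laplacian_conformal[of 1 G f y, OF _ G]
    by (simp add: eigenspace_def h_def)
  then show ?thesis using area_density_pos[of 1 G y, OF _ G] by (simp add: field_simps)
qed

lemma eigenspace_conformalI: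
  assumes G: "\<And>p. p \<in> sphere 0 1 \<Longrightarrow> G p > 0" and f: "smooth_on_sphere f"
    and eq: "\<And>e y. e \<in> {1, -1} \<Longrightarrow> partial 1 (partial 1 (\<lambda>y. f (stereo e y))) y
       + partial 2 (partial 2 (\<lambda>y. f (stereo e y))) y = - \<mu> * area_density G e y * f (stereo e y)"
  shows "f \<in> eigenspace (conformal G) \<mu>"
  unfolding eigenspace_def
proof (intro CollectI conjI f ballI)
  fix p :: "real^3" assume p: "p \<in> sphere 0 1"
  define e :: real where "e = (if p = axis 3 1 then -1 else 1)"
  have e: "e \<in> {1, -1}" by (simp add: e_def)
  have "p $ 3 \<noteq> e"
  proof (cases "p = axis 3 1")
    case True
    then show ?thesis by (simp add: e_def axis_def)
  next
    case False
    then show ?thesis using sphere_third_1[OF p] by (auto simp add: e_def)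
  qed
  then obtain y where y: "p = stereo e y" using stereo_stereo_coord[OF e p] by metis
  have "laplace_beltrami (conformal G) f (stereo e y) = coord_laplacian (conformal G) (stereo e) f y"
    unfolding laplace_beltrami_def Let_def y[symmetric] e_def[symmetric]
    by (simp add: y inv_stereo[OF e])
  then have "laplace_beltrami (conformal G) f p = coord_laplacian (conformal G) (stereo e) f y"
    by (simp add: y)
  also have "\<dots> = \<mu> * f p"
    using coord_laplacian_conformal[OF e, where G=G and f=f and y=y] G eq[OF e, of y] area_density_pos[OF e, where G=G and y=y]
    by (simp add: y)
  finally show "laplace_beltrami (conformal G) f p = \<mu> * f p" .
qed

section \<open>Spherical harmonics and the round spectrum\<close>

text \<open>
  The linear form \<open>x + s y + i \<surd>(1 + s\<^sup>2) z\<close>.  Its coefficient vector is isotropic for the complex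
  bilinear product, so every power of it is a harmonic polynomial on three-space.
\<close>

definition null_form :: "real \<Rightarrow> real^3 \<Rightarrow> complex" where
  "null_form s p = Complex (p$1 + s * p$2) (sqrt (1 + s\<^sup>2) * p$3)"

text \<open>
  For the restriction \<open>a\<close> of the form to the unit sphere, the last two identities are
  \<open>\<Delta> a = - 2 a\<close> and \<open>\<langle>\<nabla>a, \<nabla>a\<rangle> = - a\<^sup>2\<close>, transported to the
  plane.  The second one says that the coefficient vector is isotropic: for a general linear
  form \<open>a\<close> with coefficient vector \<open>v\<close> the right-hand side is \<open>v \<bullet> v - a\<^sup>2\<close>.
\<close>

lemma null_form_stereo_derivatives:
  fixes s :: real
  assumes e: "e \<in> {1, -1}"
  defines "M \<equiv> \<lambda>y. null_form s (stereo e y)"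
  defines "u \<equiv> \<lambda>y::real^2. complex_of_real (1 / ((norm y)\<^sup>2 + 1))"
  shows "smooth M"
    "partial 1 (partial 1 M) y + partial 2 (partial 2 M) y = - 8 * (u y)\<^sup>2 * M y"
    "(partial 1 M y)\<^sup>2 + (partial 2 M y)\<^sup>2 = - 4 * (u y)\<^sup>2 * (M y)\<^sup>2" (is ?A1)
proof -
  define w where "w = complex_of_real (sqrt (1 + s\<^sup>2) * e) * \<i>"
  define S where "S = complex_of_real s"
  define X where "X = (\<lambda>y::real^2. complex_of_real (y$1))"
  define Y where "Y = (\<lambda>y::real^2. complex_of_real (y$2))"
  define N where "N = (\<lambda>y. 2 * X y + 2 * S * Y y + w * (X y * X y + Y y * Y y - 1))"
  have w2: "w * w = - (1 + S * S)"
  proof -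
    have "w * w = complex_of_real (sqrt (1 + s\<^sup>2) * sqrt (1 + s\<^sup>2) * (e * e)) * (\<i> * \<i>)"
      unfolding w_def of_real_mult by (simp only: mult_ac)
    also have "sqrt (1 + s\<^sup>2) * sqrt (1 + s\<^sup>2) * (e * e) = 1 + s * s" using e_sq[OF e] by (simp add: power2_eq_square)
    finally show ?thesis by (simp add: S_def)
  qed
  have uR: "u y * (X y * X y + Y y * Y y + 1) = 1" for y
  proof -
    have "X y * X y + Y y * Y y + 1 = complex_of_real ((norm y)\<^sup>2 + 1)"
      by (simp only: X_def Y_def norm_sq_2) (simp only: power2_eq_square of_real_add of_real_mult of_real_1)
    then have "u y * (X y * X y + Y y * Y y + 1) = complex_of_real (1 / ((norm y)\<^sup>2 + 1) * ((norm y)\<^sup>2 + 1))"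
      unfolding u_def by (simp only: of_real_mult)
    then show ?thesis using norm_sq_1_pos[of y] by (simp only: nonzero_divide_eq_eq) simp
  qed
  have M: "M = (\<lambda>y. N y * u y)"
  proof
    fix y show "M y = N y * u y"
      using norm_sq_2[of y] by (simp add: M_def null_form_def stereo_nth complex_eq_iff N_def u_def X_def Y_def S_def w_def
         norm_sq_2 add_divide_distrib power2_eq_square diff_divide_distrib)
  qed
  have dX: "(X has_derivative (\<lambda>v. X v)) (at y)" and dY: "(Y has_derivative (\<lambda>v. Y v)) (at y)" for y
    unfolding X_def Y_def
    by (auto intro!: has_derivative_of_real bounded_linear.has_derivative[OF bounded_linear_vec_nth] has_derivative_ident)
  have du: "(u has_derivative (\<lambda>v. - 2 * (X y * X v + Y y * Y v) * (u y * u y))) (at y)" for y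
  proof -
    have R: "(norm y)\<^sup>2 + 1 \<noteq> 0" using norm_sq_1_pos[of y] by simp
    have "((\<lambda>y::real^2. inverse ((norm y)\<^sup>2 + 1)) has_derivative
       (\<lambda>v. - (inverse ((norm y)\<^sup>2 + 1) * (2 * (y$1 * v$1 + y$2 * v$2)) * inverse ((norm y)\<^sup>2 + 1)))) (at y)"
      by (rule Deriv.has_derivative_inverse[where f = "\<lambda>y. (norm y)\<^sup>2 + 1" and x = y, OF R])
         (rule has_derivative_eq_rhs[OF has_derivative_add[OF has_derivative_normsq has_derivative_const]], simp)
    then have "(u has_derivative (\<lambda>v. complex_of_real
       (- (inverse ((norm y)\<^sup>2 + 1) * (2 * (y$1 * v$1 + y$2 * v$2)) * inverse ((norm y)\<^sup>2 + 1))))) (at y)"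
      unfolding u_def divide_inverse mult_1_left by (rule has_derivative_of_real)
    then show ?thesis
    proof (rule has_derivative_eq_rhs, intro ext)
      fix v :: "real^2"
      have u: "u y = complex_of_real (inverse ((norm y)\<^sup>2 + 1))" by (simp only: u_def divide_inverse mult_1_left)
      have "- (a * (2 * (b * c + d * f)) * a) = - 2 * (b * c + d * f) * (a * a)" for a b c d f :: complex
        by (simp add: algebra_simps)
      then show "complex_of_real (- (inverse ((norm y)\<^sup>2 + 1) * (2 * (y$1 * v$1 + y$2 * v$2)) * inverse ((norm y)\<^sup>2 + 1)))
        = - 2 * (X y * X v + Y y * Y v) * (u y * u y)"
        unfolding u X_def Y_def by (simp only: of_real_minus of_real_mult of_real_add of_real_numeral)
    qed
  qed
  have ax: "X (axis 1 1) = 1" "X (axis 2 1) = 0" "Y (axis 1 1) = 0" "Y (axis 2 1) = 1"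
    by (auto simp: X_def Y_def axis_def)
  have dN: "(N has_derivative (\<lambda>v. 2 * X v + 2 * S * Y v + 2 * w * (X y * X v + Y y * Y v))) (at y)" for y
    unfolding N_def by (auto intro!: derivative_eq_intros dX dY simp: algebra_simps)
  have p1: "partial 1 M = (\<lambda>y. (2 + 2 * w * X y) * u y - 2 * X y * N y * (u y * u y))"
  proof
    fix y show "partial 1 M y = (2 + 2 * w * X y) * u y - 2 * X y * N y * (u y * u y)"
      unfolding M by (subst partial_eq[OF has_derivative_mult[OF dN du]]) (simp add: ax algebra_simps)
  qed
  have p2: "partial 2 M = (\<lambda>y. (2 * S + 2 * w * Y y) * u y - 2 * Y y * N y * (u y * u y))"
  proof
    fix y show "partial 2 M y = (2 * S + 2 * w * Y y) * u y - 2 * Y y * N y * (u y * u y)"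
      unfolding M by (subst partial_eq[OF has_derivative_mult[OF dN du]]) (simp add: ax algebra_simps)
  qed
  have p11: "partial 1 (partial 1 M) y = 2 * w * u y - 4 * X y * (2 + 2 * w * X y) * (u y * u y)
      - 2 * N y * (u y * u y) + 8 * X y * X y * N y * (u y * u y * u y)"
  proof -
    have "(partial 1 M has_derivative (\<lambda>v. (2 * w * X v) * u y + (2 + 2 * w * X y) * (- 2 * (X y * X v + Y y * Y v) * (u y * u y))
        - 2 * X v * N y * (u y * u y) - 2 * X y * (2 * X v + 2 * S * Y v + 2 * w * (X y * X v + Y y * Y v)) * (u y * u y)
        - 4 * X y * N y * u y * (- 2 * (X y * X v + Y y * Y v) * (u y * u y)))) (at y)"
      unfolding p1 by (auto intro!: derivative_eq_intros dX dY dN du simp: fun_eq_iff algebra_simps)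
    from partial_eq[OF this, of 1] show ?thesis by (simp add: ax algebra_simps)
  qed
  have p22: "partial 2 (partial 2 M) y = 2 * w * u y - 4 * Y y * (2 * S + 2 * w * Y y) * (u y * u y)
      - 2 * N y * (u y * u y) + 8 * Y y * Y y * N y * (u y * u y * u y)"
  proof -
    have "(partial 2 M has_derivative (\<lambda>v. (2 * w * Y v) * u y + (2 * S + 2 * w * Y y) * (- 2 * (X y * X v + Y y * Y v) * (u y * u y))
        - 2 * Y v * N y * (u y * u y) - 2 * Y y * (2 * X v + 2 * S * Y v + 2 * w * (X y * X v + Y y * Y v)) * (u y * u y)
        - 4 * Y y * N y * u y * (- 2 * (X y * X v + Y y * Y v) * (u y * u y)))) (at y)"
      unfolding p2 by (auto intro!: derivative_eq_intros dX dY dN du simp: fun_eq_iff algebra_simps)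
    from partial_eq[OF this, of 2] show ?thesis by (simp add: ax algebra_simps)
  qed
  have My: "M y = N y * u y" by (simp add: M)
  have Ny: "N y = 2 * X y + 2 * S * Y y + w * (X y * X y + Y y * Y y - 1)" by (simp add: N_def)
  define r where "r = X y * X y + Y y * Y y"
  have r: "u y * r = 1 - u y" using uR[of y] by (simp add: r_def algebra_simps)
  have c2: "X y * (2 + 2 * w * X y) + Y y * (2 * S + 2 * w * Y y) = N y + w * (r + 1)"
    by (simp add: Ny r_def algebra_simps)
  have "partial 1 (partial 1 M) y + partial 2 (partial 2 M) y = 4 * w * u y
      - 4 * (u y)\<^sup>2 * (X y * (2 + 2 * w * X y) + Y y * (2 * S + 2 * w * Y y))
      - 4 * N y * (u y)\<^sup>2 + 8 * N y * (u y)^3 * r"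
    unfolding p11 p22 r_def by (simp add: algebra_simps power2_eq_square power3_eq_cube)
  also have "\<dots> = 4 * w * u y - 4 * (u y)\<^sup>2 * N y - 4 * u y * w * (u y * r + u y)
      - 4 * N y * (u y)\<^sup>2 + 8 * N y * (u y)\<^sup>2 * (u y * r)"
    unfolding c2 by (simp add: algebra_simps power2_eq_square power3_eq_cube)
  also have "\<dots> = - 8 * (u y)\<^sup>2 * M y"
    unfolding r My by (simp add: algebra_simps power2_eq_square)
  finally show "partial 1 (partial 1 M) y + partial 2 (partial 2 M) y = - 8 * (u y)\<^sup>2 * M y" .
  show ?A1
  proof -
    have c1: "(2 + 2 * w * X y)\<^sup>2 + (2 * S + 2 * w * Y y)\<^sup>2 = 4 * w * N y"
    proof -
      have "(2 + 2 * w * X y)\<^sup>2 + (2 * S + 2 * w * Y y)\<^sup>2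
        = 4 * (1 + S * S) + 8 * w * (X y + S * Y y) + 4 * (w * w) * r"
        by (simp add: r_def algebra_simps power2_eq_square)
      also have "1 + S * S = - (w * w)" using w2 by simp
      finally show ?thesis by (simp add: Ny r_def algebra_simps)
    qed
    have "(partial 1 M y)\<^sup>2 + (partial 2 M y)\<^sup>2 = (u y)\<^sup>2 * ((2 + 2 * w * X y)\<^sup>2 + (2 * S + 2 * w * Y y)\<^sup>2)
       - 4 * N y * (u y)^3 * (X y * (2 + 2 * w * X y) + Y y * (2 * S + 2 * w * Y y)) + 4 * (u y)^4 * (N y)\<^sup>2 * r"
    proof -
      have "(a * v - 2 * x * n * (v * v))\<^sup>2 + (b * v - 2 * z * n * (v * v))\<^sup>2
        = v\<^sup>2 * (a\<^sup>2 + b\<^sup>2) - 4 * n * v^3 * (x * a + z * b) + 4 * v^4 * n\<^sup>2 * (x * x + z * z)" for a b v x z n :: complex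
        by algebra
      then show ?thesis unfolding p1 p2 r_def .
    qed
    also have "\<dots> = 4 * w * N y * (u y)\<^sup>2 - 4 * (N y)\<^sup>2 * (u y)^3 - 4 * N y * w * (u y)\<^sup>2 * (u y * r + u y)
       + 4 * (u y)^3 * (N y)\<^sup>2 * (u y * r)"
      unfolding c1 c2 by algebra
    also have "\<dots> = - 4 * (u y)\<^sup>2 * (M y)\<^sup>2"
      unfolding r My by algebra
    finally show ?thesis .
  qed
  have X: "smooth X" "smooth Y"
    unfolding X_def Y_def by (auto intro!: smooth_bounded_linear[OF bounded_linear_of_real] smooth_coord)
  have "smooth u"
  proof -
    have nz: "X y * X y + Y y * Y y + 1 \<noteq> 0" for y using uR[of y] by auto
    moreover have "u = (\<lambda>y. 1 / (X y * X y + Y y * Y y + 1))"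
    proof
      fix y show "u y = 1 / (X y * X y + Y y * Y y + 1)"
        using uR[of y] nonzero_eq_divide_eq[OF nz[of y]] by blast
    qed
    ultimately show ?thesis using X by (auto intro!: smooth_intros)
  qed
  then show "smooth M" unfolding M N_def using X by (auto intro!: smooth_intros)
qed

text \<open>
  By the chain rule \<open>\<Delta>(a\<^sup>j) = j a\<^sup>j\<^sup>-\<^sup>1 \<Delta>a + j (j - 1) a\<^sup>j\<^sup>-\<^sup>2 \<langle>\<nabla>a, \<nabla>a\<rangle>\<close>, which is
  \<open>- (2 j + j (j - 1)) a\<^sup>j\<close>.
\<close>

lemma null_form_power_laplacian:
  fixes s :: real and j :: nat
  assumes e: "e \<in> {1, -1}"
  defines "H \<equiv> \<lambda>y. null_form s (stereo e y) ^ j"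
  shows "smooth H"
    "partial 1 (partial 1 H) y + partial 2 (partial 2 H) y
       = of_real (- 4 * (real j * (real j + 1)) / ((norm y)\<^sup>2 + 1)\<^sup>2) * H y"
proof -
  define M where "M = (\<lambda>y. null_form s (stereo e y))"
  define u where "u = complex_of_real (1 / ((norm y)\<^sup>2 + 1))"
  have M: "smooth M" "partial 1 (partial 1 M) y + partial 2 (partial 2 M) y = - 8 * u\<^sup>2 * M y"
    "(partial 1 M y)\<^sup>2 + (partial 2 M y)\<^sup>2 = - 4 * u\<^sup>2 * (M y)\<^sup>2"
    unfolding M_def u_def using null_form_stereo_derivatives[OF e] by auto
  have H: "H = (\<lambda>y. M y ^ j)" unfolding H_def M_def ..
  show "smooth H" unfolding H using M(1) by (rule smooth_power)
  have pow: "partial i (\<lambda>y. M y ^ n) y = of_nat n * partial i M y * M y ^ (n - 1)" for n i y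
    using partial_eq[OF has_derivative_power[OF has_derivative_frechet[OF smooth_differentiable[OF M(1)]]]]
    by (simp add: partial_def)
  have pH: "partial i H = (\<lambda>y. of_nat j * (partial i M y * M y ^ (j - 1)))" for i
    unfolding H using pow by (intro ext) (simp add: mult.assoc)
  have d: "partial i M differentiable (at y)" "(\<lambda>y. M y ^ n) differentiable (at y)" for i n y
    using M(1) smooth_partial smooth_power smooth_differentiable by blast+
  have ppH: "partial i (partial i H) y = of_nat j * (partial i (partial i M) y * M y ^ (j - 1))
     + of_nat j * of_nat (j - 1) * ((partial i M y)\<^sup>2 * M y ^ (j - 1 - 1))" for i
  proof -
    have "partial i (partial i H) y = of_nat j * partial i (\<lambda>y. partial i M y * M y ^ (j - 1)) y"
      unfolding pH using d
      by (intro partial_bounded_linear[OF bounded_linear_mult_right]) (auto intro: differentiable_mult)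
    also have "\<dots> = of_nat j * (partial i (partial i M) y * M y ^ (j - 1)
       + partial i M y * (of_nat (j - 1) * partial i M y * M y ^ (j - 1 - 1)))"
      using d by (subst partial_mult) (auto simp: pow)
    finally show ?thesis by (simp add: algebra_simps power2_eq_square)
  qed
  have "partial 1 (partial 1 H) y + partial 2 (partial 2 H) y =
     of_nat j * ((partial 1 (partial 1 M) y + partial 2 (partial 2 M) y) * M y ^ (j - 1))
      + of_nat j * of_nat (j - 1) * (((partial 1 M y)\<^sup>2 + (partial 2 M y)\<^sup>2) * M y ^ (j - 1 - 1))"
    unfolding ppH by (simp add: algebra_simps)
  also have "\<dots> = - 4 * u\<^sup>2 * (of_nat j * 2 * (M y * M y ^ (j - 1))
      + of_nat j * of_nat (j - 1) * ((M y)\<^sup>2 * M y ^ (j - 1 - 1)))"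
    unfolding M by (simp add: algebra_simps)
  also have "\<dots> = - 4 * u\<^sup>2 * ((of_real (real j * (real j + 1))) * M y ^ j)"
  proof -
    consider "j = 0" | "j = 1" | n where "j = Suc (Suc n)" by (metis One_nat_def not0_implies_Suc)
    then show ?thesis by cases (auto simp: algebra_simps power2_eq_square)
  qed
  also have "\<dots> = of_real (- 4 * (real j * (real j + 1)) / ((norm y)\<^sup>2 + 1)\<^sup>2) * H y"
  proof -
    have u2: "u\<^sup>2 = of_real (1 / ((norm y)\<^sup>2 + 1)\<^sup>2)" unfolding u_def by (simp add: power_divide)
    have "- 4 * of_real a * (of_real c * h) = of_real (- 4 * c * a) * h" for a c :: real and h :: complex by simp
    from this[of "1 / ((norm y)\<^sup>2 + 1)\<^sup>2" "real j * (real j + 1)" "H y"] show ?thesis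
      unfolding u2 by (simp only: H times_divide_eq_right mult_1_right)
  qed
  finally show "partial 1 (partial 1 H) y + partial 2 (partial 2 H) y
       = of_real (- 4 * (real j * (real j + 1)) / ((norm y)\<^sup>2 + 1)\<^sup>2) * H y" .
qed

lemma round_metric_conformal: "round_metric = conformal (\<lambda>p. 1 / (4 * pi))"
  by (simp add: round_metric_def conformal_def fun_eq_iff)

lemma null_form_power_eigenspace:
  assumes L: "bounded_linear (L :: complex \<Rightarrow> real)"
  shows "(\<lambda>p. L (null_form s p ^ j)) \<in> eigenspace round_metric (4 * pi * (real j * (real j + 1)))"
  unfolding round_metric_conformal
proof (rule eigenspace_conformalI)
  show "smooth_on_sphere (\<lambda>p. L (null_form s p ^ j))"
    unfolding smooth_on_sphere_def using null_form_power_laplacian(1) smooth_bounded_linear[OF L] by blast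
next
  fix e :: real and y assume e: "e \<in> {1, -1}"
  define H where "H = (\<lambda>y. null_form s (stereo e y) ^ j)"
  have H: "smooth H" "partial 1 (partial 1 H) y + partial 2 (partial 2 H) y
       = of_real (- 4 * (real j * (real j + 1)) / ((norm y)\<^sup>2 + 1)\<^sup>2) * H y"
    unfolding H_def using null_form_power_laplacian[OF e] by auto
  have "partial i (\<lambda>y. L (H y)) = (\<lambda>y. L (partial i H y))" for i
    using H(1) partial_bounded_linear[OF L] smooth_differentiable by blast
  moreover have "partial i (\<lambda>y. L (partial i H y)) y = L (partial i (partial i H) y)" for i
    using H(1) partial_bounded_linear[OF L] smooth_differentiable smooth_partial by blast
  ultimately have "partial 1 (partial 1 (\<lambda>y. L (H y))) y + partial 2 (partial 2 (\<lambda>y. L (H y))) y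
    = L (partial 1 (partial 1 H) y + partial 2 (partial 2 H) y)"
    by (simp add: linear_simps[OF L])
  also have "\<dots> = L ((- 4 * (real j * (real j + 1)) / ((norm y)\<^sup>2 + 1)\<^sup>2) *\<^sub>R H y)"
    unfolding H scaleR_conv_of_real ..
  also have "\<dots> = - (4 * pi * (real j * (real j + 1))) * area_density (\<lambda>p. 1 / (4 * pi)) e y * L (H y)"
  proof -
    have "- 4 * c / R = - (4 * pi * c) * (1 / (4 * pi) * 4 / R)" for c R :: real by simp
    then show ?thesis unfolding linear_simps[OF L] area_density_def real_scaleR_def by simp
  qed
  finally show "partial 1 (partial 1 (\<lambda>y. L (null_form s (stereo e y) ^ j))) y
      + partial 2 (partial 2 (\<lambda>y. L (null_form s (stereo e y) ^ j))) y
      = - (4 * pi * (real j * (real j + 1))) * area_density (\<lambda>p. 1 / (4 * pi)) e y * L (null_form s (stereo e y) ^ j)"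
    unfolding H_def .
qed simp

text \<open>
  Differentiating the relation repeatedly and evaluating at zero shows that all moments of \<open>a\<close> of
  order at most \<open>N\<close> vanish; then pair \<open>a\<close> with a Lagrange polynomial.
\<close>

lemma shifted_powers_independent:
  fixes a :: "nat \<Rightarrow> real"
  assumes zero: "\<And>x::real. (\<Sum>m\<le>N. a m * (x + m) ^ N) = 0" and "m \<le> N"
  shows "a m = 0"
proof -
  have deriv: "(\<Sum>m\<le>N. a m * (x + m) ^ (N - i)) = 0" if "i \<le> N" for i and x :: real
    using that
  proof (induction i arbitrary: x)
    case 0
    then show ?case using zero by simp
  next
    case (Suc i)
    have "((\<lambda>x. \<Sum>m\<le>N. a m * (x + m) ^ (N - i)) has_real_derivative
      (\<Sum>m\<le>N. a m * (real (N - i) * (x + m) ^ (N - Suc i)))) (at x)"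
      by (rule DERIV_sum) (auto intro!: derivative_eq_intros)
    moreover have "(\<lambda>x::real. \<Sum>m\<le>N. a m * (x + m) ^ (N - i)) = (\<lambda>x. 0)" using Suc by auto
    ultimately have "((\<lambda>x::real. 0) has_real_derivative (\<Sum>m\<le>N. a m * (real (N - i) * (x + m) ^ (N - Suc i)))) (at x)"
      by (simp only:)
    then have "(\<Sum>m\<le>N. a m * (real (N - i) * (x + m) ^ (N - Suc i))) = 0"
      by (rule DERIV_unique[OF _ DERIV_const])
    then have "real (N - i) * (\<Sum>m\<le>N. a m * (x + m) ^ (N - Suc i)) = 0"
      by (simp add: sum_distrib_left mult_ac)
    then show ?case using Suc.prems by simp
  qed
  have moment: "(\<Sum>m\<le>N. a m * m ^ i) = 0" if "i \<le> N" for i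
    using deriv[of "N - i" 0] that by simp
  have poly0: "(\<Sum>m\<le>N. a m * poly p m) = 0" if "degree p \<le> N" for p :: "real poly"
  proof -
    have "(\<Sum>m\<le>N. a m * poly p m) = (\<Sum>m\<le>N. \<Sum>i\<le>degree p. coeff p i * (a m * m ^ i))"
      by (simp add: poly_altdef sum_distrib_left mult_ac)
    also have "\<dots> = (\<Sum>i\<le>degree p. coeff p i * (\<Sum>m\<le>N. a m * m ^ i))"
      by (subst sum.swap) (simp add: sum_distrib_left)
    also have "\<dots> = 0" using moment that by (intro sum.neutral) auto
    finally show ?thesis .
  qed
  \<comment> \<open>the Lagrange polynomial that vanishes at all nodes but \<open>m\<close>\<close>
  define p where "p = (\<Prod>n\<in>{..N} - {m}. [:- real n, 1:])"
  have "degree p \<le> N"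
  proof -
    have "degree p \<le> sum (degree \<circ> (\<lambda>n. [:- real n, 1:])) ({..N} - {m})"
      unfolding p_def by (rule degree_prod_sum_le) simp
    also have "\<dots> = N" using assms(2) by simp
    finally show ?thesis .
  qed
  moreover have val: "poly p n = 0" if "n \<le> N" "n \<noteq> m" for n :: nat
    using that unfolding p_def poly_prod by (intro prod_zero) auto
  moreover have nz: "poly p m \<noteq> 0" unfolding p_def poly_prod by auto
  ultimately have "a m * poly p m = 0"
  proof -
    have "(\<Sum>n\<le>N. a n * poly p n) = a m * poly p m + (\<Sum>n\<in>{..N} - {m}. a n * poly p n)"
      using assms(2) by (subst sum.remove[of _ m]) auto
    also have "(\<Sum>n\<in>{..N} - {m}. a n * poly p n) = 0" using val by (intro sum.neutral) auto
    finally show ?thesis using poly0[OF \<open>degree p \<le> N\<close>] by simp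
  qed
  then show ?thesis using nz by simp
qed

text \<open>
  The relation extends from the sphere to all of space by homogeneity.  On the plane \<open>z = 0\<close>
  the imaginary parts vanish and the real parts are powers of \<open>x + m y\<close>, which are independent.
  The derivative in \<open>z\<close> at \<open>z = 0\<close> gives the same for the imaginary parts, with one power
  less; hence there are \<open>j + 1\<close> real parts but \<open>j\<close> imaginary parts.
\<close>

lemma null_form_powers_independent:
  fixes a b :: "nat \<Rightarrow> real"
  assumes zero: "\<And>p. p \<in> sphere 0 1 \<Longrightarrow>
     (\<Sum>m\<le>j. a m * Re (null_form m p ^ j)) + (\<Sum>m<j. b m * Im (null_form m p ^ j)) = 0"
  shows "m \<le> j \<Longrightarrow> a m = 0" "m < j \<Longrightarrow> b m = 0"
proof -
  define w where "w = (\<lambda>m::nat. sqrt (1 + (real m)\<^sup>2))"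
  have all: "(\<Sum>m\<le>j. a m * Re (null_form m p ^ j)) + (\<Sum>m<j. b m * Im (null_form m p ^ j)) = 0"
    if "p \<noteq> 0" for p
  proof -
    define q where "q = p /\<^sub>R norm p"
    have q: "q \<in> sphere 0 1" and p: "p = norm p *\<^sub>R q" using that by (auto simp: q_def)
    have "null_form m p = of_real (norm p) * null_form m q" for m
      by (subst p) (auto simp: null_form_def complex_eq_iff algebra_simps)
    then have "null_form m p ^ j = (norm p ^ j) *\<^sub>R null_form m q ^ j" for m
      by (simp add: power_mult_distrib scaleR_conv_of_real)
    then have "(\<Sum>m\<le>j. a m * Re (null_form m p ^ j)) + (\<Sum>m<j. b m * Im (null_form m p ^ j))
      = norm p ^ j * ((\<Sum>m\<le>j. a m * Re (null_form m q ^ j)) + (\<Sum>m<j. b m * Im (null_form m q ^ j)))"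
      by (simp add: sum_distrib_left distrib_left mult_ac)
    then show ?thesis using zero[OF q] by simp
  qed
  have eq: "(\<Sum>m\<le>j. a m * Re (Complex (x + m) (w m * z) ^ j)) + (\<Sum>m<j. b m * Im (Complex (x + m) (w m * z) ^ j)) = 0" for x z :: real
  proof -
    define p :: "real^3" where "p = vector [x, 1, z]"
    have "p \<noteq> 0" by (metis p_def vector_3(2) zero_index zero_neq_one)
    from all[OF this] show ?thesis by (simp add: p_def null_form_def w_def)
  qed
  have real: "Complex c 0 ^ n = of_real (c ^ n)" for c n by (simp add: complex_of_real_def[symmetric])
  have a0: "a m = 0" if "m \<le> j" for m
  proof (rule shifted_powers_independent[OF _ that])
    fix x :: real show "(\<Sum>m\<le>j. a m * (x + m) ^ j) = 0" using eq[of x 0] by (simp add: real)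
  qed
  then show "m \<le> j \<Longrightarrow> a m = 0" by blast
  show "b m = 0" if "m < j"
  proof -
    have "(b m * w m * j) = 0"
    proof (rule shifted_powers_independent[where a = "\<lambda>m. b m * w m * j" and N = "j - 1"])
      show "m \<le> j - 1" using that by simp
      fix x :: real
      have im: "(\<Sum>m<j. b m * Im (Complex (x + m) (w m * z) ^ j)) = 0" for z
        using eq[of x z] a0 by simp
      have d: "((\<lambda>z. Im (Complex (x + m) (w m * z) ^ j)) has_real_derivative w m * j * (x + m) ^ (j - 1)) (at 0)" for m
      proof -
        have c: "Complex (x + m) (w m * z) = of_real (x + m) + \<i> * of_real (w m * z)" for z
          by (simp add: complex_eq_iff)
        have "((\<lambda>z. (of_real (x + m) + \<i> * of_real (w m * z)) ^ j) has_vector_derivative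
           (\<i> * of_real (w m * j * (x + m) ^ (j - 1)))) (at (0::real))"
          unfolding has_vector_derivative_def
          by (auto intro!: derivative_eq_intros simp: fun_eq_iff scaleR_conv_of_real)
        from bounded_linear.has_vector_derivative[OF bounded_linear_Im this]
        show ?thesis unfolding c has_real_derivative_iff_has_vector_derivative by simp
      qed
      have "((\<lambda>z. \<Sum>m<j. b m * Im (Complex (x + m) (w m * z) ^ j)) has_real_derivative
         (\<Sum>m<j. b m * (w m * j * (x + m) ^ (j - 1)))) (at 0)"
        by (intro DERIV_sum DERIV_cmult d)
      then have "(\<Sum>m<j. b m * (w m * j * (x + m) ^ (j - 1))) = 0"
        unfolding im by (rule DERIV_unique[OF _ DERIV_const])
      moreover have "{..<j} = {..j - 1}" using that by auto
      ultimately show "(\<Sum>m\<le>j - 1. b m * w m * j * (x + m) ^ (j - 1)) = 0" by (simp add: mult_ac)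
    qed
    moreover have "w m > 0" by (simp add: w_def add_pos_nonneg)
    ultimately show ?thesis using that by simp
  qed
qed

lemma independent_family:
  assumes fin: "finite I"
    and indep: "\<And>c i. \<forall>p\<in>sphere 0 1. (\<Sum>i\<in>I. c i * \<phi> i p) = 0 \<Longrightarrow> i \<in> I \<Longrightarrow> c i = (0::real)"
  shows "inj_on \<phi> I" "independent_on_sphere (\<phi> ` I)"
proof -
  show inj: "inj_on \<phi> I"
  proof (rule inj_onI, rule ccontr)
    fix a b assume ab: "a \<in> I" "b \<in> I" "\<phi> a = \<phi> b" "a \<noteq> b"
    define c where "c = (\<lambda>i. (if i = a then 1 else 0) - (if i = b then 1 else (0::real)))"
    have "(\<Sum>i\<in>I. c i * \<phi> i p) = 0" for p
      using ab fin by (simp add: c_def left_diff_distrib sum_subtractf if_distrib[of "\<lambda>x. x * _"] cong: if_cong)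
    with indep[of c a] ab show False by (simp add: c_def)
  qed
  show "independent_on_sphere (\<phi> ` I)"
    unfolding independent_on_sphere_def
  proof (intro allI impI ballI)
    fix c f assume "\<forall>p\<in>sphere 0 1. (\<Sum>f\<in>\<phi> ` I. c f * f p) = 0" "f \<in> \<phi> ` I"
    then show "c f = 0" using indep[of "\<lambda>i. c (\<phi> i)"] by (auto simp: sum.reindex[OF inj])
  qed
qed

lemma multiplicity_round:
  "enat (2 * j + 1) \<le> multiplicity round_metric (4 * pi * (real j * (real j + 1)))"
proof -
  define \<phi> where "\<phi> = (\<lambda>m p. if m \<le> j then Re (null_form m p ^ j) else Im (null_form (m - Suc j) p ^ j))"
  have split: "(\<Sum>m\<le>2 * j. c m * \<phi> m p) = (\<Sum>m\<le>j. c m * Re (null_form m p ^ j))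
     + (\<Sum>m<j. c (m + Suc j) * Im (null_form m p ^ j))" for c :: "nat \<Rightarrow> real" and p
  proof -
    have "{..2 * j} = {..j} \<union> {Suc j..<j + Suc j}" by auto
    then have "(\<Sum>m\<le>2 * j. c m * \<phi> m p) = (\<Sum>m\<le>j. c m * \<phi> m p) + (\<Sum>m\<in>{0 + Suc j..<j + Suc j}. c m * \<phi> m p)"
      by (simp, subst sum.union_disjoint) auto
    then show ?thesis unfolding sum.shift_bounds_nat_ivl by (simp add: \<phi>_def lessThan_atLeast0)
  qed
  have ind: "c i = 0" if z: "\<forall>p\<in>sphere 0 1. (\<Sum>i\<in>{..2 * j}. c i * \<phi> i p) = 0" and i: "i \<in> {..2 * j}" for c i
  proof (cases "i \<le> j")
    case True
    then show ?thesis using null_form_powers_independent(1)[where j = j and a = c and b = "\<lambda>m. c (m + Suc j)" and m = i, OF _ True] z split by simp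
  next
    case False
    then show ?thesis using null_form_powers_independent(2)[where j = j and a = c and b = "\<lambda>m. c (m + Suc j)" and m = "i - Suc j"] z i split by simp
  qed
  have *: "inj_on \<phi> {..2 * j}" "independent_on_sphere (\<phi> ` {..2 * j})"
    using independent_family[of "{..2*j}" \<phi>] ind by auto
  have "\<phi> m \<in> eigenspace round_metric (4 * pi * (real j * (real j + 1)))" for m
    unfolding \<phi>_def using null_form_power_eigenspace[OF bounded_linear_Re] null_form_power_eigenspace[OF bounded_linear_Im]
    by (cases "m \<le> j") auto
  then have "\<phi> ` {..2 * j} \<in> {B. finite B \<and> B \<subseteq> eigenspace round_metric (4 * pi * (real j * (real j + 1))) \<and> independent_on_sphere B}"
    using * by auto
  then have "enat (card (\<phi> ` {..2 * j})) \<le> multiplicity round_metric (4 * pi * (real j * (real j + 1)))"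
    unfolding multiplicity_def by (rule SUP_upper)
  then show ?thesis using card_image[OF *(1)] by simp
qed

lemma eigenvalue_round_le:
  assumes "k < (l + 1)\<^sup>2"
  shows "eigenvalue k round_metric \<le> ereal (4 * pi * (real l * (real l + 1)))"
proof -
  define \<mu> where "\<mu> = (\<lambda>j::nat. 4 * pi * (real j * (real j + 1)))"
  have mono: "\<mu> i \<le> \<mu> j" if "i \<le> j" for i j
    unfolding \<mu>_def using that by (intro mult_left_mono mult_mono) auto
  have smono: "\<mu> i < \<mu> j" if "i < j" for i j
    unfolding \<mu>_def using that by (intro mult_strict_left_mono mult_strict_mono) auto
  have inj: "inj_on \<mu> {..l}"
    by (rule inj_onI) (metis smono less_irrefl linorder_neqE_nat)
  have "enat (Suc k) \<le> (\<Sum>j\<le>l. enat (2 * j + 1))"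
  proof -
    have "(\<Sum>j\<le>l. 2 * j + 1) = (l + 1)\<^sup>2" by (induction l) (auto simp: power2_eq_square)
    moreover have "(\<Sum>j\<le>n. enat (2 * j + 1)) = enat (\<Sum>j\<le>n. 2 * j + 1)" for n
      by (induction n) auto
    ultimately show ?thesis using assms by simp
  qed
  also have "\<dots> \<le> (\<Sum>j\<le>l. multiplicity round_metric (\<mu> j))"
    unfolding \<mu>_def by (intro sum_mono multiplicity_round)
  also have "\<dots> = (\<Sum>\<mu>\<in>\<mu> ` {..l}. multiplicity round_metric \<mu>)"
    by (simp add: sum.reindex[OF inj])
  also have "\<dots> \<le> eigenvalue_count round_metric (\<mu> l)"
    unfolding eigenvalue_count_def by (rule SUP_upper) (auto intro: mono)
  finally show ?thesis
    unfolding eigenvalue_def \<mu>_def by (intro Inf_lower) blast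
qed

section \<open>Integral inequalities on the circle and a monotonicity principle\<close>

text \<open>
  With \<open>q x = - \<beta> tan (\<beta> (x - m))\<close> one has \<open>q' = - \<beta>\<^sup>2 - q\<^sup>2\<close>, so that
  \<open>h'\<^sup>2 - \<beta>\<^sup>2 h\<^sup>2 = (q h\<^sup>2)' + (q h - h')\<^sup>2\<close>.  For \<open>\<beta> < 1\<close> the tangent has no pole within distance
  \<open>\<pi>/2\<close> of \<open>m\<close>.
\<close>

lemma tan_multiplier_bound:
  fixes h h' :: "real \<Rightarrow> real"
  assumes ab: "a \<le> b" and \<beta>: "0 < \<beta>" "\<beta> < 1"
    and m: "b - pi / 2 \<le> m" "m \<le> a + pi / 2"
    and h: "\<And>x. x \<in> {a..b} \<Longrightarrow> (h has_real_derivative h' x) (at x within {a..b})"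
    and h': "continuous_on {a..b} h'"
  shows "- \<beta> * tan (\<beta> * (b - m)) * (h b)\<^sup>2 + \<beta> * tan (\<beta> * (a - m)) * (h a)\<^sup>2
     \<le> integral {a..b} (\<lambda>x. (h' x)\<^sup>2) - \<beta>\<^sup>2 * integral {a..b} (\<lambda>x. (h x)\<^sup>2)"
proof -
  define q where "q = (\<lambda>x. - \<beta> * tan (\<beta> * (x - m)))"
  have hc: "continuous_on {a..b} h" using h by (meson DERIV_continuous_on)
  have cos: "cos (\<beta> * (x - m)) > 0" if "x \<in> {a..b}" for x
  proof -
    have "\<bar>x - m\<bar> \<le> pi / 2" unfolding abs_le_iff using that m by auto
    then have "\<bar>\<beta> * (x - m)\<bar> \<le> \<beta> * (pi / 2)" using \<beta> by (simp add: abs_mult)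
    also have "\<dots> < pi / 2" using \<beta> by simp
    finally show ?thesis by (intro cos_gt_zero_pi) auto
  qed
  define D where "D = (\<lambda>x. (h' x)\<^sup>2 - \<beta>\<^sup>2 * (h x)\<^sup>2 - (q x * h x - h' x)\<^sup>2)"
  have der: "((\<lambda>x. q x * (h x)\<^sup>2) has_real_derivative D x) (at x within {a..b})" if x: "x \<in> {a..b}" for x
  proof -
    have c: "cos (\<beta> * (x - m)) \<noteq> 0" using cos[OF x] by simp
    have "(q has_real_derivative - \<beta>\<^sup>2 * inverse ((cos (\<beta> * (x - m)))\<^sup>2)) (at x within {a..b})"
      unfolding q_def using c by (auto intro!: derivative_eq_intros simp: power2_eq_square)
    moreover have "inverse ((cos (\<beta> * (x - m)))\<^sup>2) = 1 + (tan (\<beta> * (x - m)))\<^sup>2"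
      using tan_sec[OF c] by (simp add: power_inverse)
    ultimately have "(q has_real_derivative - \<beta>\<^sup>2 - (q x)\<^sup>2) (at x within {a..b})"
      by (simp add: q_def algebra_simps power2_eq_square)
    from DERIV_mult[OF this DERIV_power[OF h[OF x], of 2]] show ?thesis
      by (rule DERIV_cong) (simp add: D_def algebra_simps power2_eq_square)
  qed
  have int: "(D has_integral (q b * (h b)\<^sup>2 - q a * (h a)\<^sup>2)) {a..b}"
    using ab der by (intro fundamental_theorem_of_calculus) (auto simp: has_real_derivative_iff_has_vector_derivative[symmetric])
  have i1: "(\<lambda>x. (h' x)\<^sup>2) integrable_on {a..b}" and i2: "(\<lambda>x. (h x)\<^sup>2) integrable_on {a..b}"
    using h' hc by (auto intro!: integrable_continuous_real continuous_intros)
  have "((\<lambda>x. (h' x)\<^sup>2 - \<beta>\<^sup>2 * (h x)\<^sup>2) has_integral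
     (integral {a..b} (\<lambda>x. (h' x)\<^sup>2) - \<beta>\<^sup>2 * integral {a..b} (\<lambda>x. (h x)\<^sup>2))) {a..b}"
    using i1 i2 by (intro has_integral_diff has_integral_mult_right) (auto simp: has_integral_integral)
  from has_integral_le[OF int this] show ?thesis by (auto simp: D_def q_def)
qed

lemma variance_nonneg:
  fixes f :: "real \<Rightarrow> real"
  assumes "continuous_on {0..2*pi} f"
  shows "(integral {0..2*pi} f)\<^sup>2 / (2 * pi) \<le> integral {0..2*pi} (\<lambda>x. (f x)\<^sup>2)" (is ?A1)
    "integral {0..2*pi} (\<lambda>x. (f x)\<^sup>2) - (integral {0..2*pi} f)\<^sup>2 / (2 * pi) \<le> integral {0..2*pi} (\<lambda>x. (f x - c)\<^sup>2)" (is ?A2)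
proof -
  define m where "m = integral {0..2*pi} f"
  define s where "s = integral {0..2*pi} (\<lambda>x. (f x)\<^sup>2)"
  have i: "(f has_integral m) {0..2*pi}" "((\<lambda>x. (f x)\<^sup>2) has_integral s) {0..2*pi}"
    unfolding m_def s_def using assms by (auto intro!: integrable_integral integrable_continuous_real continuous_intros)
  have sq: "integral {0..2*pi} (\<lambda>x. (f x - c)\<^sup>2) = s - 2 * c * m + 2 * pi * c\<^sup>2" for c
  proof -
    have k: "((\<lambda>x::real. c\<^sup>2) has_integral (2 * pi) * c\<^sup>2) {0..2*pi}"
      using has_integral_const_real[of "c\<^sup>2" 0 "2*pi"] by simp
    have "((\<lambda>x. (f x)\<^sup>2 - (2 * c) * f x + c\<^sup>2) has_integral s - (2 * c) * m + (2 * pi) * c\<^sup>2) {0..2*pi}"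
      by (intro has_integral_add has_integral_diff has_integral_mult_right i k)
    moreover have "(\<lambda>x. (f x)\<^sup>2 - (2 * c) * f x + c\<^sup>2) = (\<lambda>x. (f x - c)\<^sup>2)"
      by (auto simp: power2_eq_square algebra_simps)
    ultimately show ?thesis by (simp add: integral_unique)
  qed
  have "0 \<le> integral {0..2*pi} (\<lambda>x. (f x - m / (2 * pi))\<^sup>2)"
    using assms by (intro integral_nonneg) (auto intro!: integrable_continuous_real continuous_intros)
  then have "m\<^sup>2 / (2 * pi) \<le> s" unfolding sq by (simp add: field_simps power2_eq_square)
  then show ?A1
    unfolding m_def s_def .
  have "0 \<le> (m - 2 * pi * c)\<^sup>2 / (2 * pi)" by simp
  also have "\<dots> = m\<^sup>2 / (2 * pi) - 2 * c * m + 2 * pi * c\<^sup>2" by (simp add: field_simps power2_eq_square)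
  finally show ?A2
    unfolding sq m_def[symmetric] s_def[symmetric] by simp
qed

text \<open>
  Wirtinger's inequality with a constant slightly below the optimal value one, which avoids a
  singular multiplier.  There are antipodal points \<open>c\<close> and \<open>c + \<pi>\<close> where \<open>f\<close> has the same
  value; subtract it and use the tangent multiplier on the half circles between them.
\<close>

lemma wirtinger_nonsharp:
  fixes f f' :: "real \<Rightarrow> real"
  assumes \<beta>: "0 < \<beta>" "\<beta> < 1"
    and f: "\<And>x. (f has_real_derivative f' x) (at x)"
    and f': "continuous_on {0..2*pi} f'" and per: "f (2 * pi) = f 0"
  shows "\<beta>\<^sup>2 * (integral {0..2*pi} (\<lambda>x. (f x)\<^sup>2) - (integral {0..2*pi} f)\<^sup>2 / (2 * pi))
     \<le> integral {0..2*pi} (\<lambda>x. (f' x)\<^sup>2)"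
proof -
  have fc: "continuous_on S f" for S using f by (meson DERIV_continuous_on has_field_derivative_at_within)
  have "\<exists>c. 0 \<le> c \<and> c \<le> pi \<and> f (c + pi) - f c = 0"
  proof -
    have cont: "continuous_on {0..pi} (\<lambda>c. f (c + pi) - f c)"
      by (intro continuous_intros continuous_on_compose2[OF fc[of UNIV]]) auto
    have ends: "f (0 + pi) - f 0 = f pi - f 0" "f (pi + pi) - f pi = - (f pi - f 0)"
    proof -
      have pp: "pi + pi = 2 * pi" by simp
      show "f (0 + pi) - f 0 = f pi - f 0" "f (pi + pi) - f pi = - (f pi - f 0)" unfolding pp per by simp_all
    qed
    have "\<exists>c\<ge>0. c \<le> pi \<and> f (c + pi) - f c = 0"
    proof (cases "f pi - f 0 \<le> 0")
      case True
      show ?thesis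
        by (rule IVT'[of "\<lambda>c. f (c + pi) - f c" 0 0 pi, OF _ _ _ cont]) (use True ends in auto)
    next
      case False
      show ?thesis
        by (rule IVT2'[of "\<lambda>c. f (c + pi) - f c" pi 0 0, OF _ _ _ cont]) (use False ends in auto)
    qed
    then show ?thesis by blast
  qed
  then obtain c where c: "0 \<le> c" "c \<le> pi" "f (c + pi) = f c" by auto
  define h where "h = (\<lambda>x. f x - f c)"
  have hd: "(h has_real_derivative f' x) (at x within S)" for x S
    unfolding h_def using f by (auto intro!: derivative_eq_intros intro: has_field_derivative_at_within)
  have h0: "h c = 0" "h (c + pi) = 0" "h (2 * pi) = h 0" by (auto simp: h_def c per)
  have f's: "continuous_on S f'" if "S \<subseteq> {0..2*pi}" for S using f' that continuous_on_subset by blast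
  let ?G = "\<lambda>a b. integral {a..b} (\<lambda>x. (f' x)\<^sup>2) - \<beta>\<^sup>2 * integral {a..b} (\<lambda>x. (h x)\<^sup>2)"
  \<comment> \<open>The half circle through the base point is cut into two pieces; their boundary terms at \<open>0\<close> and \<open>2 \<pi>\<close> cancel.\<close>
  have 1: "\<beta> * tan (\<beta> * (0 - (c - pi / 2))) * (h 0)\<^sup>2 \<le> ?G 0 c"
    using tan_multiplier_bound[of 0 c \<beta> "c - pi/2" h f'] c \<beta> hd f's[of "{0..c}"] h0 by auto
  have 2: "0 \<le> ?G c (c + pi)"
    using tan_multiplier_bound[of c "c + pi" \<beta> "c + pi/2" h f'] c \<beta> hd f's[of "{c..c+pi}"] h0 by auto
  have 3: "- \<beta> * tan (\<beta> * (2 * pi - (c + 3 * pi / 2))) * (h 0)\<^sup>2 \<le> ?G (c + pi) (2 * pi)"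
    using tan_multiplier_bound[of "c + pi" "2 * pi" \<beta> "c + 3 * pi/2" h f'] c \<beta> hd f's[of "{c+pi..2*pi}"] h0 by auto
  have "2 * pi - (c + 3 * pi / 2) = 0 - (c - pi / 2)" by simp
  with 1 2 3 have "0 \<le> ?G 0 c + ?G c (c + pi) + ?G (c + pi) (2 * pi)" by simp
  also have "\<dots> = ?G 0 (2 * pi)"
  proof -
    have comb: "integral {0..c} g + integral {c..c+pi} g + integral {c+pi..2*pi} g = integral {0..2*pi} g"
      if "continuous_on {0..2*pi} g" for g :: "real \<Rightarrow> real"
    proof -
      have i: "g integrable_on {0..2*pi}" using that by (rule integrable_continuous_real)
      then have "g integrable_on {0..c+pi}" by (rule integrable_on_subinterval) (use c in auto)
      then have "integral {0..c} g + integral {c..c+pi} g = integral {0..c+pi} g"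
        by (intro Henstock_Kurzweil_Integration.integral_combine) (use c in auto)
      moreover have "integral {0..c+pi} g + integral {c+pi..2*pi} g = integral {0..2*pi} g"
        by (intro Henstock_Kurzweil_Integration.integral_combine i) (use c in auto)
      ultimately show ?thesis by simp
    qed
    have "continuous_on {0..2*pi} (\<lambda>x. (f' x)\<^sup>2)" "continuous_on {0..2*pi} (\<lambda>x. (h x)\<^sup>2)"
      using f' fc by (auto intro!: continuous_intros simp: h_def)
    note comb[OF this(1)] comb[OF this(2)]
    moreover have "(a1 - k * b1) + (a2 - k * b2) + (a3 - k * b3) = (a1 + a2 + a3) - k * (b1 + b2 + b3)" for a1 a2 a3 b1 b2 b3 k :: real
      by (simp add: algebra_simps)
    ultimately show ?thesis by (simp only:)
  qed
  finally have "\<beta>\<^sup>2 * integral {0..2*pi} (\<lambda>x. (f x - f c)\<^sup>2) \<le> integral {0..2*pi} (\<lambda>x. (f' x)\<^sup>2)"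
    by (simp add: h_def)
  moreover have "\<beta>\<^sup>2 * (integral {0..2*pi} (\<lambda>x. (f x)\<^sup>2) - (integral {0..2*pi} f)\<^sup>2 / (2 * pi))
      \<le> \<beta>\<^sup>2 * integral {0..2*pi} (\<lambda>x. (f x - f c)\<^sup>2)"
    using variance_nonneg(2)[OF fc] by (intro mult_left_mono) auto
  ultimately show ?thesis by simp
qed

lemma circle_integral_derivative:
  fixes K K' :: "real \<Rightarrow> real \<Rightarrow> real"
  assumes der: "\<And>t \<theta>. ((\<lambda>t. K t \<theta>) has_real_derivative K' t \<theta>) (at t)"
    and cont: "\<And>t. continuous_on {0..2*pi} (K t)"
    and cont': "continuous_on UNIV (\<lambda>z. K' (fst z) (snd z))"
  shows "((\<lambda>t. integral {0..2*pi} (K t)) has_real_derivative integral {0..2*pi} (K' t)) (at t)"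
proof -
  have "((\<lambda>t. integral (cbox 0 (2*pi)) (K t)) has_field_derivative integral (cbox 0 (2*pi)) (K' t)) (at t within UNIV)"
  proof (rule leibniz_rule_field_derivative)
    show "continuous_on (UNIV \<times> cbox 0 (2 * pi)) (\<lambda>(x, t). K' x t)"
      using cont' by (auto simp: case_prod_beta intro: continuous_on_subset)
    show "K x integrable_on cbox 0 (2 * pi)" for x
      using cont[of x] by (auto intro: integrable_continuous_real)
  qed (use der in auto)
  then show ?thesis by simp
qed

text \<open>
  The exceptional set is needed for multipliers that jump.
\<close>

lemma nondecreasing_between_zero_limits:
  fixes Z D :: "real \<Rightarrow> real"
  assumes fin: "finite S" and cont: "continuous_on UNIV Z"
    and der: "\<And>t. t \<notin> S \<Longrightarrow> (Z has_real_derivative D t) (at t)"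
    and nonneg: "\<And>t. t \<notin> S \<Longrightarrow> D t \<ge> 0"
    and lim: "(Z \<longlongrightarrow> 0) at_top" "(Z \<longlongrightarrow> 0) at_bot"
    and t: "t \<notin> S"
  shows "D t = 0"
proof -
  have mono: "Z a \<le> Z b" if "a \<le> b" for a b
  proof -
    define E where "E = (\<lambda>t. if t \<in> S then 0 else D t)"
    have "(E has_integral (Z b - Z a)) {a..b}"
      by (rule fundamental_theorem_of_calculus_strong[OF fin that])
         (auto simp: E_def has_real_derivative_iff_has_vector_derivative[symmetric] der
            intro: has_field_derivative_at_within continuous_on_subset[OF cont])
    then have "0 \<le> Z b - Z a" by (rule has_integral_nonneg) (auto simp: E_def nonneg)
    then show ?thesis by simp
  qed
  have "Z s = 0" for s
  proof (rule antisym)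
    have "eventually (\<lambda>x. Z s \<le> Z x) at_top" using eventually_ge_at_top[of s] by eventually_elim (rule mono)
    then show "Z s \<le> 0" using lim(1) by (intro tendsto_lowerbound[of Z 0 at_top]) auto
    have "eventually (\<lambda>x. Z x \<le> Z s) at_bot" using eventually_le_at_bot[of s] by eventually_elim (rule mono)
    then show "0 \<le> Z s" using lim(2) by (intro tendsto_upperbound[of Z 0 at_bot]) auto
  qed
  then have "Z = (\<lambda>s. 0)" by auto
  then show ?thesis using der[OF t] DERIV_unique[OF _ DERIV_const] by auto
qed

section \<open>Families of eigenfunctions on a cylinder\<close>

definition circ :: "(real \<Rightarrow> real) \<Rightarrow> real" where
  "circ f = integral {0..2*pi} f"

lemma has_integral_circ: "continuous_on {0..2*pi} f \<Longrightarrow> (f has_integral circ f) {0..2*pi}"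
  unfolding circ_def by (intro integrable_integral integrable_continuous_real)

lemma circ_add: "continuous_on {0..2*pi} f \<Longrightarrow> continuous_on {0..2*pi} g \<Longrightarrow> circ (\<lambda>x. f x + g x) = circ f + circ g"
  unfolding circ_def by (intro integral_unique has_integral_add has_integral_circ[unfolded circ_def])

lemma circ_diff: "continuous_on {0..2*pi} f \<Longrightarrow> continuous_on {0..2*pi} g \<Longrightarrow> circ (\<lambda>x. f x - g x) = circ f - circ g"
  unfolding circ_def by (intro integral_unique has_integral_diff has_integral_circ[unfolded circ_def])

lemma circ_cmult: "circ (\<lambda>x. c * f x) = c * circ f"
  unfolding circ_def by simp

lemma circ_sum: "finite I \<Longrightarrow> (\<And>i. i \<in> I \<Longrightarrow> continuous_on {0..2*pi} (f i)) \<Longrightarrow> circ (\<lambda>x. \<Sum>i\<in>I. f i x) = (\<Sum>i\<in>I. circ (f i))"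
  unfolding circ_def by (intro integral_unique has_integral_sum has_integral_circ[unfolded circ_def]) auto

lemma circ_abs_le:
  assumes "continuous_on {0..2*pi} f" "\<And>x. \<bar>f x\<bar> \<le> M"
  shows "\<bar>circ f\<bar> \<le> M * (2 * pi)"
  using integral_bound[of 0 "2*pi" f M] assms unfolding circ_def by auto

lemma circ_nonneg: "continuous_on {0..2*pi} f \<Longrightarrow> (\<And>x. 0 \<le> f x) \<Longrightarrow> 0 \<le> circ f"
  unfolding circ_def by (intro integral_nonneg integrable_continuous_real) auto

lemma circ_derivative_zero:
  assumes "\<And>x. (Q has_real_derivative q x) (at x)" "Q (2 * pi) = Q 0"
  shows "circ q = 0"
proof -
  have "(q has_integral Q (2*pi) - Q 0) {0..2*pi}"
    by (rule fundamental_theorem_of_calculus)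
       (auto simp: has_real_derivative_iff_has_vector_derivative[symmetric] intro: has_field_derivative_at_within assms)
  then show ?thesis unfolding circ_def using assms(2) by (simp add: integral_unique)
qed

lemma circ_square_zero:
  assumes "continuous_on {0..2*pi} f" "circ (\<lambda>x. (f x)\<^sup>2) = 0" "x \<in> {0..2*pi}"
  shows "f x = 0"
proof -
  have "(f x)\<^sup>2 = 0"
  proof (rule has_integral_0_cbox_imp_0[of 0 "2*pi" "\<lambda>x. (f x)\<^sup>2"])
    show "((\<lambda>x. (f x)\<^sup>2) has_integral 0) (cbox 0 (2 * pi))"
      using has_integral_circ[of "\<lambda>x. (f x)\<^sup>2"] assms by (auto intro: continuous_intros)
  qed (use assms pi_gt_zero in \<open>auto intro: continuous_intros simp: not_le\<close>)
  then show ?thesis by simp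
qed

lemma exp_minus_abs_tendsto:
  "((\<lambda>t::real. c * exp (- \<bar>t\<bar>)) \<longlongrightarrow> 0) at_top" (is ?A1) "((\<lambda>t::real. c * exp (- \<bar>t\<bar>)) \<longlongrightarrow> 0) at_bot" (is ?A2)
proof -
  have e: "((\<lambda>t::real. exp (- t)) \<longlongrightarrow> 0) at_top"
    by (intro filterlim_compose[OF exp_at_bot] filterlim_uminus_at_bot_at_top)
  have "((\<lambda>t::real. exp (- \<bar>t\<bar>)) \<longlongrightarrow> 0) at_top"
    by (rule Lim_transform_eventually[OF e]) (use eventually_ge_at_top[of 0] in \<open>eventually_elim, simp\<close>)
  then show ?A1 by (rule tendsto_mult_right_zero)
  have "((\<lambda>t::real. exp (- \<bar>t\<bar>)) \<longlongrightarrow> 0) at_bot"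
    by (rule Lim_transform_eventually[OF exp_at_bot]) (use eventually_le_at_bot[of 0] in \<open>eventually_elim, simp\<close>)
  then show ?A2 by (rule tendsto_mult_right_zero)
qed

lemma exp_decay_tendsto:
  fixes f :: "real \<Rightarrow> real"
  assumes "\<And>t. \<bar>f t\<bar> \<le> c * exp (- \<bar>t\<bar>)" "F \<in> {at_top, at_bot}"
  shows "(f \<longlongrightarrow> 0) F"
proof (rule Lim_null_comparison[where g = "\<lambda>t. c * exp (- \<bar>t\<bar>)"])
  show "\<forall>\<^sub>F x in F. norm (f x) \<le> c * exp (- \<bar>x\<bar>)" using assms(1) by (intro always_eventually) auto
  show "((\<lambda>t. c * exp (- \<bar>t\<bar>)) \<longlongrightarrow> 0) F" using assms(2) exp_minus_abs_tendsto by auto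
qed

text \<open>
  A finite family of bounded solutions on the cylinder \<open>\<real> \<times> S\<^sup>1\<close>, one for each of several
  eigenvalues.  The subscripts \<open>1\<close> and \<open>2\<close> denote derivatives along the axis and along
  the circle.  The exponential decay of first derivatives expresses that the functions
  come from smooth functions on the sphere, whose poles are the two ends.
\<close>

locale cylinder_eigenfunctions =
  fixes I :: "'i set" and \<nu> :: "'i \<Rightarrow> real" and P :: "real \<Rightarrow> real"
    and F F1 F2 F11 F22 :: "'i \<Rightarrow> real \<Rightarrow> real \<Rightarrow> real" and C :: real
  assumes fin: "finite I"
    and F_t: "\<And>i t x. i \<in> I \<Longrightarrow> ((\<lambda>t. F i t x) has_real_derivative F1 i t x) (at t)"
    and F_tt: "\<And>i t x. i \<in> I \<Longrightarrow> ((\<lambda>t. F1 i t x) has_real_derivative F11 i t x) (at t)"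
    and F_x: "\<And>i t x. i \<in> I \<Longrightarrow> (F i t has_real_derivative F2 i t x) (at x)"
    and F_xx: "\<And>i t x. i \<in> I \<Longrightarrow> (F2 i t has_real_derivative F22 i t x) (at x)"
    and contF: "\<And>i. i \<in> I \<Longrightarrow> continuous_on UNIV (\<lambda>z. F i (fst z) (snd z))"
    and contF1: "\<And>i. i \<in> I \<Longrightarrow> continuous_on UNIV (\<lambda>z. F1 i (fst z) (snd z))"
    and contF2: "\<And>i. i \<in> I \<Longrightarrow> continuous_on UNIV (\<lambda>z. F2 i (fst z) (snd z))"
    and contF11: "\<And>i. i \<in> I \<Longrightarrow> continuous_on UNIV (\<lambda>z. F11 i (fst z) (snd z))"
    and contF22: "\<And>i. i \<in> I \<Longrightarrow> continuous_on UNIV (\<lambda>z. F22 i (fst z) (snd z))"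
    and periodic: "\<And>i t. i \<in> I \<Longrightarrow> F i t (2 * pi) = F i t 0" "\<And>i t. i \<in> I \<Longrightarrow> F2 i t (2 * pi) = F2 i t 0"
    and pde: "\<And>i t x. i \<in> I \<Longrightarrow> F11 i t x + F22 i t x = - \<nu> i * P t * F i t x"
    and bound: "\<And>i t x. i \<in> I \<Longrightarrow> \<bar>F i t x\<bar> \<le> C"
      "\<And>i t x. i \<in> I \<Longrightarrow> \<bar>F1 i t x\<bar> \<le> C * exp (- \<bar>t\<bar>)"
      "\<And>i t x. i \<in> I \<Longrightarrow> \<bar>F2 i t x\<bar> \<le> C * exp (- \<bar>t\<bar>)"
begin

lemma cont_compose:
  assumes i: "i \<in> I" and "continuous_on A f" "continuous_on A g"
  shows "continuous_on A (\<lambda>x. F i (f x) (g x))" "continuous_on A (\<lambda>x. F1 i (f x) (g x))"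
    "continuous_on A (\<lambda>x. F2 i (f x) (g x))" "continuous_on A (\<lambda>x. F11 i (f x) (g x))"
    "continuous_on A (\<lambda>x. F22 i (f x) (g x))"
proof -
  have p: "continuous_on A (\<lambda>x. (f x, g x))" using assms by (intro continuous_intros)
  show "continuous_on A (\<lambda>x. F i (f x) (g x))" "continuous_on A (\<lambda>x. F1 i (f x) (g x))"
    "continuous_on A (\<lambda>x. F2 i (f x) (g x))" "continuous_on A (\<lambda>x. F11 i (f x) (g x))"
    "continuous_on A (\<lambda>x. F22 i (f x) (g x))"
    using continuous_on_compose2[OF contF[OF i] p] continuous_on_compose2[OF contF1[OF i] p]
      continuous_on_compose2[OF contF2[OF i] p] continuous_on_compose2[OF contF11[OF i] p]
      continuous_on_compose2[OF contF22[OF i] p] by auto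
qed

lemmas cont_slice = cont_compose[OF _ continuous_on_const continuous_on_id]

definition overlap :: "'i \<Rightarrow> 'i \<Rightarrow> real \<Rightarrow> real" where
  "overlap i j t = circ (\<lambda>x. F i t x * F j t x)"

lemma overlap_nonneg: "i \<in> I \<Longrightarrow> 0 \<le> overlap i i t"
  unfolding overlap_def by (rule circ_nonneg) (intro continuous_on_mult cont_slice, auto)

text \<open>
  The Wronskian of two members of the family, integrated over a circle.
\<close>

definition flux :: "'i \<Rightarrow> 'i \<Rightarrow> real \<Rightarrow> real" where
  "flux i j t = circ (\<lambda>x. F1 i t x * F j t x - F i t x * F1 j t x)"

text \<open>
  This replaces the orthogonality of eigenfunctions: for distinct eigenvalues the weighted overlap
  is an exact derivative, and the function differentiated tends to zero at the ends.
\<close>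

lemma flux_derivative:
  assumes ij: "i \<in> I" "j \<in> I"
  shows "(flux i j has_real_derivative (\<nu> j - \<nu> i) * P t * overlap i j t) (at t)"
proof -
  have "(flux i j has_real_derivative circ (\<lambda>x. F11 i t x * F j t x - F i t x * F11 j t x)) (at t)"
    unfolding flux_def circ_def
    by (rule circle_integral_derivative)
       (auto intro!: derivative_eq_intros F_t F_tt continuous_intros cont_compose ij simp: algebra_simps)
  moreover have "circ (\<lambda>x. F11 i t x * F j t x - F i t x * F11 j t x) = (\<nu> j - \<nu> i) * P t * overlap i j t"
  proof -
    have z: "circ (\<lambda>x. F i t x * F22 j t x - F22 i t x * F j t x) = 0"
    proof (rule circ_derivative_zero[of "\<lambda>x. F i t x * F2 j t x - F2 i t x * F j t x"])
      show "((\<lambda>x. F i t x * F2 j t x - F2 i t x * F j t x) has_real_derivative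
        F i t x * F22 j t x - F22 i t x * F j t x) (at x)" for x
        by (auto intro!: derivative_eq_intros F_x F_xx ij simp: algebra_simps)
    qed (simp add: periodic ij)
    have "F11 i t x * F j t x - F i t x * F11 j t x =
       ((\<nu> j - \<nu> i) * P t) * (F i t x * F j t x) + (F i t x * F22 j t x - F22 i t x * F j t x)" for x
      using pde[OF ij(1), of t x] pde[OF ij(2), of t x] by algebra
    then have "circ (\<lambda>x. F11 i t x * F j t x - F i t x * F11 j t x) =
       circ (\<lambda>x. ((\<nu> j - \<nu> i) * P t) * (F i t x * F j t x) + (F i t x * F22 j t x - F22 i t x * F j t x))" by simp
    also have "\<dots> = circ (\<lambda>x. ((\<nu> j - \<nu> i) * P t) * (F i t x * F j t x))
       + circ (\<lambda>x. F i t x * F22 j t x - F22 i t x * F j t x)"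
      by (rule circ_add; intro continuous_on_add continuous_on_diff continuous_on_mult continuous_on_const cont_slice ij)
    finally show ?thesis unfolding circ_cmult z overlap_def by simp
  qed
  ultimately show ?thesis by simp
qed

lemma flux_decay:
  assumes ij: "i \<in> I" "j \<in> I"
  shows "\<bar>flux i j t\<bar> \<le> (4 * pi * C * C) * exp (- \<bar>t\<bar>)"
proof -
  have "\<bar>flux i j t\<bar> \<le> (2 * C * C * exp (- \<bar>t\<bar>)) * (2 * pi)"
    unfolding flux_def
  proof (rule circ_abs_le)
    show "continuous_on {0..2 * pi} (\<lambda>x. F1 i t x * F j t x - F i t x * F1 j t x)"
      by (auto intro!: continuous_intros cont_slice ij)
    fix x
    have "\<bar>F1 i t x * F j t x\<bar> \<le> C * exp (- \<bar>t\<bar>) * C" "\<bar>F i t x * F1 j t x\<bar> \<le> C * (C * exp (- \<bar>t\<bar>))"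
      unfolding abs_mult using bound[OF ij(1), of t x] bound[OF ij(2), of t x]
      by (auto intro!: mult_mono intro: order_trans[OF abs_ge_zero])
    then show "\<bar>F1 i t x * F j t x - F i t x * F1 j t x\<bar> \<le> 2 * C * C * exp (- \<bar>t\<bar>)" by (simp add: abs_le_iff mult_ac)
  qed
  then show ?thesis by (simp add: mult_ac)
qed

text \<open>
  The sum of the family and its derivatives.  Coefficients are absorbed into the members, which may
  be zero.
\<close>

definition "U t x = (\<Sum>i\<in>I. F i t x)"
definition "U1 t x = (\<Sum>i\<in>I. F1 i t x)"
definition "U2 t x = (\<Sum>i\<in>I. F2 i t x)"
definition "U11 t x = (\<Sum>i\<in>I. F11 i t x)"
definition "U22 t x = (\<Sum>i\<in>I. F22 i t x)"

lemma U_derivatives: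
  "((\<lambda>t. U t x) has_real_derivative U1 t x) (at t)"
  "((\<lambda>t. U1 t x) has_real_derivative U11 t x) (at t)"
  "(U t has_real_derivative U2 t x) (at x)"
  "(U2 t has_real_derivative U22 t x) (at x)"
  unfolding U_def[abs_def] U1_def[abs_def] U2_def[abs_def] U11_def[abs_def] U22_def[abs_def]
  by (auto intro!: DERIV_sum F_t F_tt F_x F_xx)

lemma U_cont:
  assumes "continuous_on A f" "continuous_on A g"
  shows "continuous_on A (\<lambda>x. U (f x) (g x))" "continuous_on A (\<lambda>x. U1 (f x) (g x))"
    "continuous_on A (\<lambda>x. U2 (f x) (g x))" "continuous_on A (\<lambda>x. U11 (f x) (g x))"
    "continuous_on A (\<lambda>x. U22 (f x) (g x))"
  unfolding U_def U1_def U2_def U11_def U22_def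
  by (intro continuous_on_sum cont_compose assms; assumption)+

lemmas U_slice = U_cont[OF continuous_on_const continuous_on_id]

lemma U_periodic: "U t (2 * pi) = U t 0" "U2 t (2 * pi) = U2 t 0"
  by (simp_all add: U_def U2_def periodic)

lemma U_pde: "U11 t x + U22 t x = - P t * (\<Sum>i\<in>I. \<nu> i * F i t x)"
  unfolding U11_def U22_def sum.distrib[symmetric] sum_distrib_left
  by (intro sum.cong refl) (simp add: pde)

definition "U_sup = card I * C"

lemma U_bound: "\<bar>U t x\<bar> \<le> U_sup" "\<bar>U1 t x\<bar> \<le> U_sup * exp (- \<bar>t\<bar>)" "\<bar>U2 t x\<bar> \<le> U_sup * exp (- \<bar>t\<bar>)"
proof -
  have s: "\<bar>\<Sum>i\<in>I. f i\<bar> \<le> card I * c" if "\<And>i. i \<in> I \<Longrightarrow> \<bar>f i\<bar> \<le> c" for f :: "'i \<Rightarrow> real" and c :: real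
    by (rule order_trans[OF sum_abs sum_bounded_above]) (use that in auto)
  show "\<bar>U t x\<bar> \<le> U_sup" "\<bar>U1 t x\<bar> \<le> U_sup * exp (- \<bar>t\<bar>)" "\<bar>U2 t x\<bar> \<le> U_sup * exp (- \<bar>t\<bar>)"
    unfolding U_def U1_def U2_def U_sup_def mult.assoc by (intro s bound; assumption)+
qed

lemma U_sup_nonneg: "0 \<le> U_sup" using U_bound(1)[of 0 0] by linarith

text \<open>
  Up to the factor \<open>2 \<pi>\<close>, \<open>zero_mode\<close> is the mean of the sum over a circle, and \<open>zero_mode'\<close> its
  derivative.
\<close>

definition "zero_mode t = circ (U t)"
definition "zero_mode' t = circ (U1 t)"
definition "mass t = circ (\<lambda>x. (U t x)\<^sup>2)"
definition "mass_flux t = circ (\<lambda>x. U1 t x * U t x)"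
definition "axial_energy t = circ (\<lambda>x. (U1 t x)\<^sup>2)"
definition "angular_energy t = circ (\<lambda>x. (U2 t x)\<^sup>2)"

lemma zero_mode_derivative: "(zero_mode has_real_derivative zero_mode' t) (at t)"
  unfolding zero_mode_def[abs_def] zero_mode'_def circ_def
  by (rule circle_integral_derivative) (auto intro!: U_derivatives U_cont continuous_intros U_slice)

lemma mass_derivative: "(mass has_real_derivative 2 * mass_flux t) (at t)"
proof -
  have "(mass has_real_derivative circ (\<lambda>x. 2 * (U1 t x * U t x))) (at t)"
    unfolding mass_def[abs_def] circ_def
    by (rule circle_integral_derivative) (auto intro!: derivative_eq_intros U_derivatives U_cont continuous_intros U_slice)
  then show ?thesis by (simp only: circ_cmult mass_flux_def)
qed

lemma overlap_sum: "circ (\<lambda>x. F i t x * U t x) = (\<Sum>j\<in>I. overlap i j t)" if "i \<in> I"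
  unfolding U_def sum_distrib_left overlap_def
  by (rule circ_sum) (auto intro!: fin continuous_intros cont_slice that)

lemma mass_overlap: "mass t = (\<Sum>i\<in>I. \<Sum>j\<in>I. overlap i j t)"
proof -
  have "mass t = circ (\<lambda>x. \<Sum>i\<in>I. F i t x * U t x)"
    unfolding mass_def by (simp add: U_def power2_eq_square sum_distrib_right)
  also have "\<dots> = (\<Sum>i\<in>I. circ (\<lambda>x. F i t x * U t x))"
    by (rule circ_sum) (auto intro!: fin continuous_intros cont_slice U_slice)
  finally show ?thesis by (simp add: overlap_sum)
qed

text \<open>
  Green's formula, one circle at a time.
\<close>

lemma mass_flux_derivative:
  "(mass_flux has_real_derivative axial_energy t + angular_energy t - P t * (\<Sum>i\<in>I. \<nu> i * (\<Sum>j\<in>I. overlap i j t))) (at t)"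
proof -
  have "(mass_flux has_real_derivative circ (\<lambda>x. U11 t x * U t x + U1 t x * U1 t x)) (at t)"
    unfolding mass_flux_def[abs_def] circ_def
    by (rule circle_integral_derivative)
      (auto intro!: derivative_eq_intros U_derivatives U_cont continuous_intros U_slice simp: algebra_simps)
  moreover have "circ (\<lambda>x. U11 t x * U t x + U1 t x * U1 t x) =
     axial_energy t + angular_energy t - P t * (\<Sum>i\<in>I. \<nu> i * (\<Sum>j\<in>I. overlap i j t))"
  proof -
    have z: "circ (\<lambda>x. U22 t x * U t x + U2 t x * U2 t x) = 0"
    proof (rule circ_derivative_zero[of "\<lambda>x. U2 t x * U t x"])
      show "((\<lambda>x. U2 t x * U t x) has_real_derivative U22 t x * U t x + U2 t x * U2 t x) (at x)" for x
        by (auto intro!: derivative_eq_intros U_derivatives simp: algebra_simps)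
    qed (simp add: U_periodic)
    have s: "circ (\<lambda>x. \<Sum>i\<in>I. \<nu> i * (F i t x * U t x)) = (\<Sum>i\<in>I. \<nu> i * (\<Sum>j\<in>I. overlap i j t))"
      by (subst circ_sum) (auto intro!: fin continuous_intros cont_slice U_slice sum.cong simp: circ_cmult overlap_sum)
    have "U11 t x * U t x + U1 t x * U1 t x = (((U1 t x)\<^sup>2 + (U2 t x)\<^sup>2) - P t * (\<Sum>i\<in>I. \<nu> i * (F i t x * U t x)))
        - (U22 t x * U t x + U2 t x * U2 t x)" for x
    proof -
      have "(\<Sum>i\<in>I. \<nu> i * (F i t x * U t x)) = (\<Sum>i\<in>I. \<nu> i * F i t x) * U t x"
        by (simp add: sum_distrib_right mult.assoc)
      then show ?thesis using U_pde[of t x] by algebra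
    qed
    then have "circ (\<lambda>x. U11 t x * U t x + U1 t x * U1 t x) =
       circ (\<lambda>x. (((U1 t x)\<^sup>2 + (U2 t x)\<^sup>2) - P t * (\<Sum>i\<in>I. \<nu> i * (F i t x * U t x)))
        - (U22 t x * U t x + U2 t x * U2 t x))" by simp
    also have "\<dots> = (axial_energy t + angular_energy t - P t * circ (\<lambda>x. \<Sum>i\<in>I. \<nu> i * (F i t x * U t x)))
       - circ (\<lambda>x. U22 t x * U t x + U2 t x * U2 t x)"
      unfolding axial_energy_def angular_energy_def circ_cmult[symmetric]
      by (subst circ_diff circ_add, (intro continuous_intros continuous_on_sum U_slice cont_slice; assumption?)+)+ (rule refl)
    finally show ?thesis by (simp add: z s)
  qed
  ultimately show ?thesis by simp
qed

text \<open>
  Here \<open>mass t - (zero_mode t)\<^sup>2 / (2 \<pi>)\<close> is the mass of the part with mean zero.  The third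
  inequality is \<open>\<integral> X\<^sup>2 \<ge> (\<integral> X)\<^sup>2 / (2 \<pi>)\<close> for \<open>X = U1 - q U\<close>: it separates the axial energy into
  the part of the mean and that of the fluctuation and completes the square in the latter.
\<close>

lemma fluctuation:
  assumes \<beta>: "0 < \<beta>" "\<beta> < 1"
  shows "0 \<le> mass t - (zero_mode t)\<^sup>2 / (2 * pi)" "\<beta>\<^sup>2 * (mass t - (zero_mode t)\<^sup>2 / (2 * pi)) \<le> angular_energy t" (is ?A1)
    "(zero_mode' t)\<^sup>2 / (2 * pi) - q\<^sup>2 * (mass t - (zero_mode t)\<^sup>2 / (2 * pi)) \<le> axial_energy t - 2 * q * mass_flux t + q * zero_mode t * zero_mode' t / pi" (is ?A2)
proof -
  show "0 \<le> mass t - (zero_mode t)\<^sup>2 / (2 * pi)"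
    using variance_nonneg(1)[of "U t"] unfolding mass_def zero_mode_def circ_def by (simp add: U_slice)
  show ?A1
    unfolding mass_def zero_mode_def angular_energy_def circ_def
    by (rule wirtinger_nonsharp[OF \<beta>]) (auto intro!: U_derivatives U_slice simp: U_periodic)
  have "circ (\<lambda>x. U1 t x - q * U t x) = zero_mode' t - q * zero_mode t"
    unfolding zero_mode_def zero_mode'_def by (subst circ_diff) (auto intro!: continuous_intros U_slice simp: circ_cmult)
  moreover have "circ (\<lambda>x. (U1 t x - q * U t x)\<^sup>2) = axial_energy t - (2 * q) * mass_flux t + q\<^sup>2 * mass t"
  proof -
    have "(\<lambda>x. (U1 t x - q * U t x)\<^sup>2) = (\<lambda>x. ((U1 t x)\<^sup>2 - (2 * q) * (U1 t x * U t x)) + q\<^sup>2 * (U t x)\<^sup>2)"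
      by (auto simp: power2_eq_square algebra_simps)
    then show ?thesis unfolding axial_energy_def mass_flux_def mass_def circ_cmult[symmetric]
      by (simp only:) ((subst circ_add circ_diff, (intro continuous_intros U_slice)+)+, rule refl)
  qed
  ultimately have *: "(zero_mode' t - q * zero_mode t)\<^sup>2 / (2 * pi) \<le> axial_energy t - (2 * q) * mass_flux t + q\<^sup>2 * mass t"
    using variance_nonneg(1)[of "\<lambda>x. U1 t x - q * U t x", folded circ_def]
    by (simp add: continuous_on_diff continuous_on_mult continuous_on_const U_slice)
  show ?A2
  proof -
    have "(zero_mode' t - q * zero_mode t)\<^sup>2 / (2 * pi) = (zero_mode' t)\<^sup>2 / (2 * pi) - q * zero_mode t * zero_mode' t / pi + q\<^sup>2 * ((zero_mode t)\<^sup>2 / (2 * pi))"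
      by (simp add: field_simps power2_eq_square)
    with * show ?thesis by (simp add: algebra_simps)
  qed
qed

lemma circ_decay:
  "\<bar>mass_flux t\<bar> \<le> (2 * pi * U_sup * U_sup) * exp (- \<bar>t\<bar>)" (is ?A1) "\<bar>angular_energy t\<bar> \<le> (2 * pi * U_sup * U_sup) * exp (- \<bar>t\<bar>)" (is ?A2) "\<bar>zero_mode t\<bar> \<le> U_sup * (2 * pi)"
proof -
  show "\<bar>zero_mode t\<bar> \<le> U_sup * (2 * pi)" unfolding zero_mode_def by (rule circ_abs_le) (auto intro: U_slice U_bound)
  have "\<bar>mass_flux t\<bar> \<le> (U_sup * exp (- \<bar>t\<bar>) * U_sup) * (2 * pi)"
    unfolding mass_flux_def using U_sup_nonneg
    by (intro circ_abs_le) (auto intro!: U_slice U_bound mult_mono continuous_intros simp: abs_mult)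
  then show ?A1 by (simp add: mult_ac)
  have "\<bar>U2 t x\<bar> \<le> U_sup" for x
    by (rule order_trans[OF U_bound(3)]) (use U_sup_nonneg in \<open>auto intro: mult_left_le\<close>)
  then have "\<bar>U2 t x * U2 t x\<bar> \<le> U_sup * exp (- \<bar>t\<bar>) * U_sup" for x
    unfolding abs_mult using U_sup_nonneg by (intro mult_mono U_bound) auto
  then have "\<bar>angular_energy t\<bar> \<le> (U_sup * exp (- \<bar>t\<bar>) * U_sup) * (2 * pi)"
    unfolding angular_energy_def power2_eq_square by (intro circ_abs_le continuous_intros U_slice)
  then show ?A2 by (simp add: mult_ac)
qed

text \<open>
  The function \<open>q\<close> is the multiplier for the fluctuation and \<open>r\<close> the one for the mean, which
  vanishes on \<open>Z\<close>; there \<open>r\<close> may jump.  Both turn \<open>L\<close> into a lower bound for the energy, whereas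
  the eigenvalues lie strictly below \<open>L\<close>.
\<close>

theorem eigenfunctions_vanish:
  fixes L :: real
  assumes inj: "inj_on \<nu> I" and below: "\<And>i. i \<in> I \<Longrightarrow> \<nu> i < L" and P: "\<And>t. 0 < P t"
    and \<beta>: "0 < \<beta>" "\<beta> < 1"
    and q: "\<And>t. (q has_real_derivative q' t) (at t)" "\<And>t. \<bar>q t\<bar> \<le> M"
      "\<And>t. L * P t \<le> \<beta>\<^sup>2 - (q t)\<^sup>2 - q' t"
    and Z: "finite Z" "\<And>t. t \<in> Z \<Longrightarrow> circ (\<lambda>x. \<Sum>i\<in>I. F i t x) = 0"
    and r: "\<And>t. t \<notin> Z \<Longrightarrow> (r has_real_derivative r' t) (at t)" "\<And>t. \<bar>r t\<bar> \<le> M"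
      "\<And>t. t \<notin> Z \<Longrightarrow> L * P t \<le> - (r t)\<^sup>2 - r' t"
      "(r \<longlongrightarrow> 0) at_top" "(r \<longlongrightarrow> 0) at_bot"
    and i: "i \<in> I" and x: "x \<in> {0..2*pi}"
  shows "F i t x = 0"
proof -
  define V where "V t = mass t - (zero_mode t)\<^sup>2 / (2 * pi)" for t
  \<comment> \<open>For \<open>i = j\<close> the quotient is zero by convention, as is the Wronskian.\<close>
  define c where "c i j = (\<nu> i - L) / (\<nu> j - \<nu> i)" for i j
  define \<Psi> where "\<Psi> t = mass_flux t + (\<Sum>i\<in>I. \<Sum>j\<in>I. c i j * flux i j t) - q t * V t - r t * (zero_mode t)\<^sup>2 / (2 * pi)" for t
  \<comment> \<open>The coefficients \<open>c i j\<close> are chosen so that only the diagonal overlaps survive in \<open>D\<close>, the derivative of \<open>\<Psi>\<close>, once the energy is bounded below.\<close>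
  define W where "W t = (\<Sum>i\<in>I. (L - \<nu> i) * P t * overlap i i t)" for t
  define D where "D t = axial_energy t + angular_energy t - P t * (\<Sum>i\<in>I. \<nu> i * (\<Sum>j\<in>I. overlap i j t))
      + (\<Sum>i\<in>I. \<Sum>j\<in>I. c i j * ((\<nu> j - \<nu> i) * P t * overlap i j t))
      - (q' t * V t + q t * (2 * mass_flux t - zero_mode t * zero_mode' t / pi))
      - (r' t * (zero_mode t)\<^sup>2 + 2 * r t * zero_mode t * zero_mode' t) / (2 * pi)" for t
  have A0: "zero_mode t = 0" if "t \<in> Z" for t using Z(2)[OF that] by (simp add: zero_mode_def U_def[abs_def])
  have Vd: "(V has_real_derivative 2 * mass_flux t - zero_mode t * zero_mode' t / pi) (at t)" for t
    unfolding V_def[abs_def]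
    by (rule DERIV_cong[OF DERIV_diff[OF mass_derivative DERIV_cdivide[OF DERIV_power[OF zero_mode_derivative, of 2]]]])
       (simp add: field_simps)
  have fluxes: "((\<lambda>t. \<Sum>i\<in>I. \<Sum>j\<in>I. c i j * flux i j t) has_real_derivative
      (\<Sum>i\<in>I. \<Sum>j\<in>I. c i j * ((\<nu> j - \<nu> i) * P t * overlap i j t))) (at t)" for t
    by (intro DERIV_sum DERIV_cmult flux_derivative)
  have der: "(\<Psi> has_real_derivative D t) (at t)" if t: "t \<notin> Z" for t
    unfolding \<Psi>_def[abs_def] D_def
    by (rule DERIV_cong[OF DERIV_diff[OF DERIV_diff[OF DERIV_add[OF mass_flux_derivative fluxes] DERIV_mult[OF q(1) Vd]]
         DERIV_cdivide[OF DERIV_mult[OF r(1)[OF t] DERIV_power[OF zero_mode_derivative, of 2]]]]])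
       (simp add: field_simps power2_eq_square)
  have W0: "0 \<le> (L - \<nu> i) * P t * overlap i i t" if "i \<in> I" for i t
    using below[OF that] P[of t] overlap_nonneg[OF that] by (intro mult_nonneg_nonneg) auto
  have DW: "W t \<le> D t" if t: "t \<notin> Z" for t
  proof -
    have "- P t * (\<Sum>i\<in>I. \<nu> i * (\<Sum>j\<in>I. overlap i j t)) = (\<Sum>i\<in>I. \<Sum>j\<in>I. - \<nu> i * P t * overlap i j t)"
      unfolding sum_distrib_left by (intro sum.cong refl) simp
    then have "- P t * (\<Sum>i\<in>I. \<nu> i * (\<Sum>j\<in>I. overlap i j t))
      + (\<Sum>i\<in>I. \<Sum>j\<in>I. c i j * ((\<nu> j - \<nu> i) * P t * overlap i j t)) =
      (\<Sum>i\<in>I. \<Sum>j\<in>I. - \<nu> i * P t * overlap i j t + c i j * ((\<nu> j - \<nu> i) * P t * overlap i j t))"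
      by (simp only: sum.distrib)
    also have "\<dots> = (\<Sum>i\<in>I. \<Sum>j\<in>I. - (L * P t) * overlap i j t + (if i = j then (L - \<nu> i) * P t * overlap i j t else 0))"
    proof (intro sum.cong refl)
      fix i j assume "i \<in> I" "j \<in> I"
      then have "c i j * (\<nu> j - \<nu> i) = (if i = j then 0 else \<nu> i - L)"
        using inj by (auto simp: c_def inj_on_def)
      then have "c i j * ((\<nu> j - \<nu> i) * P t * overlap i j t) = (if i = j then 0 else \<nu> i - L) * (P t * overlap i j t)"
        by (simp only: mult.assoc[symmetric])
      then show "- \<nu> i * P t * overlap i j t + c i j * ((\<nu> j - \<nu> i) * P t * overlap i j t) =
         - (L * P t) * overlap i j t + (if i = j then (L - \<nu> i) * P t * overlap i j t else 0)"
        by (simp add: algebra_simps)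
    qed
    also have "\<dots> = - (L * P t) * mass t + W t"
      unfolding mass_overlap W_def sum.distrib sum_distrib_left[symmetric] by (simp add: sum.delta fin)
    finally have "D t - W t = axial_energy t + angular_energy t - L * P t * mass t - (q' t * V t + q t * (2 * mass_flux t - zero_mode t * zero_mode' t / pi))
       - (r' t * (zero_mode t)\<^sup>2 + 2 * r t * zero_mode t * zero_mode' t) / (2 * pi)"
      unfolding D_def by simp
    moreover have mass: "mass t = V t + (zero_mode t)\<^sup>2 / (2 * pi)" by (simp add: V_def)
    moreover have "\<beta>\<^sup>2 * V t \<le> angular_energy t" and V0: "0 \<le> V t"
      and "(zero_mode' t)\<^sup>2 / (2 * pi) - (q t)\<^sup>2 * V t \<le> axial_energy t - 2 * q t * mass_flux t + q t * zero_mode t * zero_mode' t / pi"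
      using fluctuation[OF \<beta>, of t] unfolding V_def by auto
    moreover have "L * P t * V t \<le> (\<beta>\<^sup>2 - (q t)\<^sup>2 - q' t) * V t"
      using q(3)[of t] V0 by (rule mult_right_mono)
    moreover have "0 \<le> (zero_mode' t)\<^sup>2 / (2 * pi) - L * P t * ((zero_mode t)\<^sup>2 / (2 * pi)) - (r' t * (zero_mode t)\<^sup>2 + 2 * r t * zero_mode t * zero_mode' t) / (2 * pi)"
    proof -
      have "0 \<le> (zero_mode' t - r t * zero_mode t)\<^sup>2 + (- (r t)\<^sup>2 - r' t - L * P t) * (zero_mode t)\<^sup>2"
        using r(3)[OF t] by (intro add_nonneg_nonneg mult_nonneg_nonneg) auto
      then have "0 \<le> ((zero_mode' t - r t * zero_mode t)\<^sup>2 + (- (r t)\<^sup>2 - r' t - L * P t) * (zero_mode t)\<^sup>2) / (2 * pi)" by simp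
      also have "\<dots> = (zero_mode' t)\<^sup>2 / (2 * pi) - L * P t * ((zero_mode t)\<^sup>2 / (2 * pi)) - (r' t * (zero_mode t)\<^sup>2 + 2 * r t * zero_mode t * zero_mode' t) / (2 * pi)"
        by (simp add: field_simps power2_eq_square)
      finally show ?thesis .
    qed
    ultimately show ?thesis by (simp add: algebra_simps)
  qed
  have Ac: "isCont zero_mode t" for t using zero_mode_derivative by (rule DERIV_isCont)
  have cont: "isCont \<Psi> t" for t
  proof (cases "t \<in> Z")
    case False
    then show ?thesis using der DERIV_isCont by blast
  next
    case True
    have "((\<lambda>s. r s * (zero_mode s)\<^sup>2) \<longlongrightarrow> 0) (at t)"
    proof (rule Lim_null_comparison[where g = "\<lambda>s. M * (zero_mode s)\<^sup>2"])
      show "\<forall>\<^sub>F s in at t. norm (r s * (zero_mode s)\<^sup>2) \<le> M * (zero_mode s)\<^sup>2"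
        using r(2) by (intro always_eventually) (auto simp: abs_mult intro: mult_right_mono)
      have "((\<lambda>s. M * (zero_mode s)\<^sup>2) \<longlongrightarrow> M * (zero_mode t)\<^sup>2) (at t)"
        using Ac[of t] by (intro tendsto_intros) (simp add: isCont_def)
      then show "((\<lambda>s. M * (zero_mode s)\<^sup>2) \<longlongrightarrow> 0) (at t)" using A0[OF True] by simp
    qed
    then have rA: "isCont (\<lambda>s. r s * (zero_mode s)\<^sup>2) t" using A0[OF True] by (simp add: isCont_def)
    show ?thesis unfolding \<Psi>_def[abs_def]
      by (rule continuous_diff[OF continuous_diff[OF continuous_add[OF DERIV_isCont[OF mass_flux_derivative] DERIV_isCont[OF fluxes]]
           continuous_mult[OF DERIV_isCont[OF q(1)] DERIV_isCont[OF Vd]]] continuous_divide[OF rA continuous_const]]) simp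
  qed
  have lim: "(\<Psi> \<longlongrightarrow> 0) Fl" if Fl: "Fl \<in> {at_top, at_bot}" for Fl
  proof -
    have l1: "(mass_flux \<longlongrightarrow> 0) Fl" by (rule exp_decay_tendsto[OF circ_decay(1) Fl])
    have l2: "((\<lambda>t. \<Sum>i\<in>I. \<Sum>j\<in>I. c i j * flux i j t) \<longlongrightarrow> 0) Fl"
      by (intro tendsto_null_sum tendsto_mult_right_zero exp_decay_tendsto[OF flux_decay Fl])
    have l3: "((\<lambda>t. q t * V t) \<longlongrightarrow> 0) Fl"
    proof (rule exp_decay_tendsto[OF _ Fl])
      fix t
      have "\<beta>\<^sup>2 * V t \<le> (2 * pi * U_sup * U_sup) * exp (- \<bar>t\<bar>)"
        using fluctuation(2)[OF \<beta>, of t] circ_decay(2)[of t] unfolding V_def by linarith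
      then have "V t \<le> (2 * pi * U_sup * U_sup / \<beta>\<^sup>2) * exp (- \<bar>t\<bar>)" using \<beta> by (simp add: field_simps)
      moreover have "0 \<le> V t" using fluctuation(1)[OF \<beta>] unfolding V_def .
      moreover have "0 \<le> M" using q(2)[of 0] by linarith
      ultimately have "\<bar>q t\<bar> * V t \<le> M * ((2 * pi * U_sup * U_sup / \<beta>\<^sup>2) * exp (- \<bar>t\<bar>))"
        using q(2)[of t] by (intro mult_mono) auto
      then show "\<bar>q t * V t\<bar> \<le> (M * (2 * pi * U_sup * U_sup / \<beta>\<^sup>2)) * exp (- \<bar>t\<bar>)"
        using \<open>0 \<le> V t\<close> by (simp add: abs_mult mult_ac)
    qed
    have l4: "((\<lambda>t. r t * (zero_mode t)\<^sup>2 / (2 * pi)) \<longlongrightarrow> 0) Fl"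
    proof (rule Lim_null_comparison[where g = "\<lambda>t. \<bar>r t\<bar> * ((U_sup * (2 * pi))\<^sup>2 / (2 * pi))"])
      have "(zero_mode t)\<^sup>2 \<le> (U_sup * (2 * pi))\<^sup>2" for t using circ_decay(3)[of t] by (metis abs_ge_zero power2_abs power_mono)
      then have "\<bar>r t\<bar> * (zero_mode t)\<^sup>2 / (2 * pi) \<le> \<bar>r t\<bar> * (U_sup * (2 * pi))\<^sup>2 / (2 * pi)" for t
        by (intro divide_right_mono mult_left_mono) auto
      then show "\<forall>\<^sub>F t in Fl. norm (r t * (zero_mode t)\<^sup>2 / (2 * pi)) \<le> \<bar>r t\<bar> * ((U_sup * (2 * pi))\<^sup>2 / (2 * pi))"
        by (intro always_eventually) (simp add: abs_mult)
      have "(r \<longlongrightarrow> 0) Fl" using r(4,5) Fl by auto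
      then show "((\<lambda>t. \<bar>r t\<bar> * ((U_sup * (2 * pi))\<^sup>2 / (2 * pi))) \<longlongrightarrow> 0) Fl"
        by (intro tendsto_mult_left_zero tendsto_rabs_zero)
    qed
    show ?thesis
      using tendsto_diff[OF tendsto_diff[OF tendsto_add[OF l1 l2] l3] l4] unfolding \<Psi>_def[abs_def] by simp
  qed
  have overlap0: "overlap i i t = 0" if t: "t \<notin> Z" for t
  proof -
    have "D t = 0"
    proof (rule nondecreasing_between_zero_limits[OF Z(1) _ der _ lim lim t])
      show "continuous_on UNIV \<Psi>" using cont by (simp add: continuous_at_imp_continuous_on)
      show "0 \<le> D t" if "t \<notin> Z" for t
        using DW[OF that] W0 by (rule_tac order_trans[of _ "W t"]) (auto simp: W_def intro!: sum_nonneg)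
    qed auto
    then have "W t \<le> 0" using DW[OF t] by simp
    moreover have "W t \<ge> (L - \<nu> i) * P t * overlap i i t"
      unfolding W_def by (rule member_le_sum[OF i]) (use W0 fin in auto)
    ultimately have "(L - \<nu> i) * P t * overlap i i t = 0" using W0[OF i, of t] by linarith
    then show ?thesis using below[OF i] P[of t] by simp
  qed
  have off: "F i t x = 0" if t: "t \<notin> Z" for t
    by (rule circ_square_zero[OF _ _ x])
       (use overlap0[OF t] in \<open>auto intro!: cont_slice i simp: overlap_def power2_eq_square\<close>)
  show ?thesis
  proof (cases "t \<in> Z")
    case True
    have "((\<lambda>t. F i t x) \<longlongrightarrow> F i t x) (at t)" using DERIV_isCont[OF F_t[OF i]] by (simp add: isCont_def)
    moreover have "((\<lambda>t. F i t x) \<longlongrightarrow> 0) (at t)"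
    proof (rule Lim_transform_eventually[OF tendsto_const])
      have "eventually (\<lambda>s. s \<notin> Z) (at t)"
        using islimpt_finite[OF Z(1)] by (auto simp: islimpt_iff_eventually)
      then show "\<forall>\<^sub>F s in at t. 0 = F i s x" by eventually_elim (simp add: off)
    qed
    ultimately show ?thesis using tendsto_unique[OF trivial_limit_at] by blast
  qed (rule off)
qed

end

section \<open>Multipliers for a chain of bubbles\<close>

definition sech2 :: "real \<Rightarrow> real" where "sech2 x = 1 / (cosh x)\<^sup>2"

lemma sech2_pos: "0 < sech2 x" and sech2_le_1: "sech2 x \<le> 1"
  by (simp_all add: sech2_def cosh_real_ge_1)

lemma sech2_decay: "sech2 x \<le> 4 * exp (- \<bar>x\<bar>)"
proof -
  have "exp \<bar>x\<bar> / 2 \<le> cosh \<bar>x\<bar>" by (simp add: cosh_def)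
  then have "exp \<bar>x\<bar> / 2 \<le> cosh x" by simp
  then have "(exp \<bar>x\<bar> / 2)\<^sup>2 \<le> (cosh x)\<^sup>2" by (intro power_mono) auto
  then have "sech2 x \<le> 1 / (exp \<bar>x\<bar> / 2)\<^sup>2" unfolding sech2_def by (intro divide_left_mono) auto
  also have "\<dots> = 4 * (exp (- \<bar>x\<bar>) * exp (- \<bar>x\<bar>))" by (simp add: power2_eq_square exp_minus field_simps)
  also have "\<dots> \<le> 4 * (exp (- \<bar>x\<bar>) * 1)" by (intro mult_left_mono) auto
  finally show ?thesis by simp
qed

text \<open>
  Two distant bubbles have a uniformly small product, whatever the position \<open>t\<close>.
\<close>

lemma sech_product_le: "1 / (cosh x * cosh y) \<le> 2 / cosh (x - y :: real)"
proof -
  have "2 * (cosh x * cosh y) = cosh (x + y) + cosh (x - y)"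
    by (simp add: cosh_add cosh_diff)
  then have "cosh (x - y) \<le> 2 * (cosh x * cosh y)" using cosh_real_pos[of "x + y"] by linarith
  then show ?thesis by (simp add: field_simps)
qed

text \<open>
  A power of the eigenfunction \<open>sech\<close> of a single bubble.  With \<open>\<alpha> = 9/10\<close> it satisfies
  \<open>w'' = \<alpha>\<^sup>2 w - \<alpha> (\<alpha> + 1) sech\<^sup>2 w\<close>.  An exponent below one is needed so that \<open>\<beta>\<^sup>2 - \<alpha>\<^sup>2\<close> remains
  positive in the necks, while \<open>\<alpha> (\<alpha> + 1) = 171/100\<close> must stay above \<open>17/10\<close>.
\<close>

definition soft :: "real \<Rightarrow> real" where "soft x = cosh x powr (- 9/10)"

lemma soft_pos: "0 < soft x" by (simp add: soft_def)

lemma soft_derivatives: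
  "(soft has_real_derivative - (9/10) * soft x * tanh x) (at x)"
  "((\<lambda>x. soft x * tanh x) has_real_derivative soft x * (19/10 * sech2 x - 9/10)) (at x)"
proof -
  have "(soft has_real_derivative (- 9/10) * cosh x powr (- 9/10 - of_nat 1) * sinh x) (at x)"
    unfolding soft_def[abs_def] by (rule DERIV_fun_powr) (auto intro!: derivative_eq_intros)
  also have "(- 9/10) * cosh x powr (- 9/10 - of_nat 1) * sinh x = - (9/10) * soft x * tanh x"
    unfolding soft_def powr_diff of_nat_1 by (simp add: tanh_def)
  finally show d: "(soft has_real_derivative - (9/10) * soft x * tanh x) (at x)" .
  have t: "1 - (tanh x)\<^sup>2 = sech2 x"
    by (simp add: sech2_def tanh_def cosh_square_eq field_simps add_pos_nonneg less_imp_neq[THEN not_sym])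
  have "((\<lambda>x. soft x * tanh x) has_real_derivative (- (9/10) * soft x * tanh x) * tanh x + (1 - (tanh x)\<^sup>2) * soft x) (at x)"
    by (rule DERIV_mult[OF d has_field_derivative_tanh[OF _ DERIV_ident, unfolded mult_1_right]]) simp
  also have "(- (9/10) * soft x * tanh x) * tanh x + (1 - (tanh x)\<^sup>2) * soft x = soft x * ((1 - (tanh x)\<^sup>2) - 9/10 * (tanh x)\<^sup>2)"
    by (simp add: algebra_simps power2_eq_square)
  also have "\<dots> = soft x * (19/10 * sech2 x - 9/10)"
  proof -
    have "(tanh x)\<^sup>2 = 1 - sech2 x" using t by simp
    then show ?thesis by (simp only:) (simp add: field_simps)
  qed
  finally show "((\<lambda>x. soft x * tanh x) has_real_derivative soft x * (19/10 * sech2 x - 9/10)) (at x)" .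
qed

lemma soft_sech2_le: "soft x * sech2 y \<le> (2 / cosh (x - y)) powr (9/10) * soft y"
proof -
  have "soft x * sech2 y = (1 / (cosh x * cosh y)) powr (9/10) * (1 / cosh y) powr (1/5) * soft y"
  proof -
    have "(1 / cosh y) powr (9/10) * (1 / cosh y) powr (1/5) * (1 / cosh y) powr (9/10) = (1 / cosh y) powr (9/10 + 1/5 + 9/10)"
      by (simp only: powr_add)
    also have "\<dots> = (1 / cosh y) powr 2" by simp
    also have "\<dots> = sech2 y" by (simp add: sech2_def powr_numeral power_divide)
    finally have "sech2 y = (1 / cosh y) powr (9/10) * (1 / cosh y) powr (1/5) * (1 / cosh y) powr (9/10)" by simp
    moreover have s: "soft z = (1 / cosh z) powr (9/10)" for z
      by (simp add: soft_def powr_divide powr_minus_divide)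
    moreover have "(1 / (cosh x * cosh y)) powr (9/10) = (1 / cosh x) powr (9/10) * (1 / cosh y) powr (9/10)"
      by (simp add: powr_divide powr_mult)
    ultimately show ?thesis by simp
  qed
  also have "\<dots> \<le> ((2 / cosh (x - y)) powr (9/10) * 1) * soft y"
  proof (intro mult_right_mono mult_mono)
    show "(1 / (cosh x * cosh y)) powr (9/10) \<le> (2 / cosh (x - y)) powr (9/10)"
      using sech_product_le[of x y] by (intro powr_mono2) auto
    have "(1 / cosh y) powr (1/5) \<le> 1 powr (1/5)" by (intro powr_mono2) (auto simp: cosh_real_ge_1)
    then show "(1 / cosh y) powr (1/5) \<le> 1" by simp
  qed (use soft_pos[of y] in auto)
  finally show ?thesis by simp
qed

lemma DERIV_translate:
  "(f has_real_derivative d) (at (t - c)) \<Longrightarrow> ((\<lambda>t. f (t - c)) has_real_derivative d) (at (t::real))"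
  using DERIV_shift[of f d t "- c"] by simp

text \<open>
  Take \<open>q = w' / w\<close> for \<open>w = \<Sum>\<^sub>j soft (t - \<tau>\<^sub>j)\<close>.  A sum of supersolutions need not be one for the
  sum of the potentials: the mixed terms \<open>soft (t - \<tau>\<^sub>j) sech\<^sup>2 (t - \<tau>\<^sub>i)\<close> have the wrong sign.
  For distant centres they are small multiples of \<open>soft (t - \<tau>\<^sub>i)\<close>, and the positive term
  \<open>(\<beta>\<^sup>2 - \<alpha>\<^sup>2) w\<close> with \<open>\<beta> = 19/20\<close> absorbs them.
\<close>

lemma fluctuation_multiplier:
  fixes \<tau> :: "nat \<Rightarrow> real" and k :: nat
  assumes k: "0 < k" and far: "\<And>i j. i < k \<Longrightarrow> j < k \<Longrightarrow> i \<noteq> j \<Longrightarrow> (2 / cosh (\<tau> i - \<tau> j)) powr (9/10) \<le> 1 / (20 * k)"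
  obtains q q' :: "real \<Rightarrow> real" where "\<And>t. (q has_real_derivative q' t) (at t)" "\<And>t. \<bar>q t\<bar> \<le> 1"
    "\<And>t. 17/10 * (\<Sum>j<k. sech2 (t - \<tau> j)) \<le> (19/20)\<^sup>2 - (q t)\<^sup>2 - q' t"
proof -
  define w where "w t = (\<Sum>j<k. soft (t - \<tau> j))" for t
  define n where "n t = (\<Sum>j<k. soft (t - \<tau> j) * tanh (t - \<tau> j))" for t
  define m where "m t = (\<Sum>j<k. soft (t - \<tau> j) * (19/10 * sech2 (t - \<tau> j) - 9/10))" for t
  define q where "q t = - (9/10) * (n t / w t)" for t
  define q' where "q' t = - (9/10) * (m t / w t) - (q t)\<^sup>2" for t
  have w: "0 < w t" for t unfolding w_def using k by (intro sum_pos) (auto simp: soft_pos)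
  have wd: "(w has_real_derivative - (9/10) * n t) (at t)" for t
  proof -
    have "(w has_real_derivative (\<Sum>j<k. - (9/10) * soft (t - \<tau> j) * tanh (t - \<tau> j))) (at t)"
      unfolding w_def[abs_def]
      by (intro DERIV_sum DERIV_translate soft_derivatives)
    then show ?thesis by (simp add: n_def sum_distrib_left mult.assoc)
  qed
  have nd: "(n has_real_derivative m t) (at t)" for t
    unfolding n_def[abs_def] m_def
    by (intro DERIV_sum DERIV_translate[where f = "\<lambda>x. soft x * tanh x"] soft_derivatives)
  have qd: "(q has_real_derivative q' t) (at t)" for t
    unfolding q_def[abs_def]
    by (rule DERIV_cong[OF DERIV_cmult[OF DERIV_divide[OF nd wd]]])
       (use w[of t] in \<open>auto simp: q'_def q_def field_simps power2_eq_square\<close>)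
  have "\<bar>tanh x\<bar> \<le> 1" for x :: real
    using tanh_real_lt_1[of x] tanh_real_gt_neg1[of x] by linarith
  then have "\<bar>n t\<bar> \<le> w t" for t
    unfolding n_def w_def
    by (intro order_trans[OF sum_abs sum_mono]) (auto simp: abs_mult soft_pos less_imp_le intro!: mult_left_le)
  then have qb: "\<bar>q t\<bar> \<le> 1" for t
    using w[of t] unfolding q_def abs_mult abs_divide by (simp add: field_simps) (smt (verit))
  have main: "17/10 * (\<Sum>j<k. sech2 (t - \<tau> j)) \<le> (19/20)\<^sup>2 - (q t)\<^sup>2 - q' t" for t
  proof -
    define s where "s j = sech2 (t - \<tau> j)" for j
    define v where "v j = soft (t - \<tau> j)" for j
    have s0: "0 < s j" for j by (simp add: s_def sech2_pos)
    have v0: "0 < v j" for j by (simp add: v_def soft_pos)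
    have cross: "v j * s i \<le> 1 / (20 * k) * v i" if "i < k" "j < k" "i \<noteq> j" for i j
    proof -
      have "v j * s i \<le> (2 / cosh (\<tau> i - \<tau> j)) powr (9/10) * v i"
        using soft_sech2_le[of "t - \<tau> j" "t - \<tau> i"] by (simp add: v_def s_def)
      also have "\<dots> \<le> 1 / (20 * k) * v i" using far[OF that] v0[of i] by (intro mult_right_mono) auto
      finally show ?thesis .
    qed
    have "(\<Sum>j<k. \<Sum>i<k. v j * s i) \<le> (\<Sum>j<k. \<Sum>i<k. (if i = j then v j * s j else 0) + 1 / (20 * k) * v i)"
      using cross v0 by (intro sum_mono) (auto simp: less_imp_le)
    also have "\<dots> = (\<Sum>j<k. v j * s j) + (\<Sum>j<k. 1 / (20 * k) * w t)"
      by (simp add: sum.distrib w_def v_def sum_distrib_left)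
    also have "\<dots> = (\<Sum>j<k. v j * s j) + w t / 20" using k by simp
    finally have sums: "w t * (\<Sum>i<k. s i) \<le> (\<Sum>j<k. v j * s j) + w t / 20"
      by (simp add: w_def v_def[symmetric] sum_product)
    have "m t = 19/10 * (\<Sum>j<k. v j * s j) - 9/10 * w t"
      by (simp add: m_def w_def v_def s_def sum_subtractf sum_distrib_left algebra_simps)
    moreover have "0 \<le> (\<Sum>j<k. v j * s j)" using s0 v0 by (intro sum_nonneg) (auto simp: less_imp_le)
    ultimately have "17/10 * (w t * (\<Sum>i<k. s i)) \<le> (19/20)\<^sup>2 * w t + 9/10 * m t"
    proof -
      assume m: "m t = 19/10 * (\<Sum>j<k. v j * s j) - 9/10 * w t" and v: "0 \<le> (\<Sum>j<k. v j * s j)"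
      have e: "(19/20)\<^sup>2 = (361/400 :: real)" by (simp add: power2_eq_square)
      have "17/10 * X \<le> 361/400 * W + 9/10 * (19/10 * V - 9/10 * W)" if "X \<le> V + W / 20" "0 < W" "0 \<le> V" for X V W :: real
        using that by (simp add: algebra_simps)
      then show ?thesis unfolding m e using sums w[of t] v by blast
    qed
    then have "(17/10 * (\<Sum>i<k. s i)) * w t \<le> ((19/20)\<^sup>2 + 9/10 * (m t / w t)) * w t"
    proof -
      have "((19/20)\<^sup>2 + 9/10 * (m t / w t)) * w t = (19/20)\<^sup>2 * w t + 9/10 * m t"
        using w[of t] by (simp add: distrib_right)
      moreover assume "17/10 * (w t * (\<Sum>i<k. s i)) \<le> (19/20)\<^sup>2 * w t + 9/10 * m t"
      ultimately show ?thesis by (simp only: mult_ac)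
    qed
    then have "17/10 * (\<Sum>i<k. s i) \<le> (19/20)\<^sup>2 + 9/10 * (m t / w t)"
      using w[of t] mult_le_cancel_right_pos by blast
    then show ?thesis by (simp add: q'_def s_def)
  qed
  show thesis by (rule that[OF qd qb main])
qed

text \<open>
  Away from zero this is the logarithmic derivative of \<open>tanh (|x| + 1/40)\<close>.  The positive
  solution \<open>tanh |x|\<close> of the single-bubble equation with eigenvalue two would give the exact
  constant but a pole at zero; the shift turns the pole into an upward jump.
\<close>

definition spike :: "real \<Rightarrow> real" where "spike x = sgn x * (2 / sinh (2 * \<bar>x\<bar> + 1/20))"

definition spike' :: "real \<Rightarrow> real" where
  "spike' x = - 4 * cosh (2 * \<bar>x\<bar> + 1/20) / (sinh (2 * \<bar>x\<bar> + 1/20))\<^sup>2"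

lemma sinh_arg_pos: "0 < sinh (2 * \<bar>x\<bar> + 1/20 :: real)"
  by (simp add: add_nonneg_pos)

lemma spike_derivative:
  assumes "x \<noteq> 0"
  shows "(spike has_real_derivative spike' x) (at x)"
proof -
  have d: "((\<lambda>x. sgn c * (2 / sinh (2 * (sgn c * x) + 1/20))) has_real_derivative spike' x) (at x)"
    if c: "sgn c = sgn x" for c :: real
  proof -
    have a: "sgn c * x = \<bar>x\<bar>" using c by (simp add: sgn_if abs_if split: if_splits)
    have "sgn c * sgn c = 1" using c assms by (simp add: sgn_if split: if_splits)
    moreover have i: "((\<lambda>x. sinh (2 * (sgn c * x) + 1/20)) has_real_derivative cosh (2 * \<bar>x\<bar> + 1/20) * (2 * sgn c)) (at x)"
      unfolding a[symmetric] by (auto intro!: derivative_eq_intros)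
    have nz: "sinh (2 * (sgn c * x) + 1/20) \<noteq> 0" unfolding a using sinh_arg_pos[of x] by simp
    have alg: "u * ((0 * S - 2 * (C * (2 * u))) / (S * S)) = (u * u) * (- 4 * C / S\<^sup>2)" for u C S :: real
      by (simp add: power2_eq_square)
    ultimately show ?thesis
      by (intro DERIV_cong[OF DERIV_cmult[OF DERIV_divide[OF DERIV_const i nz]]])
         (simp only: a alg spike'_def mult_1)
  qed
  have "eventually (\<lambda>y. sgn y = sgn x) (nhds x)"
  proof (cases "0 < x")
    case True
    then show ?thesis using eventually_nhds_in_open[of "{0<..}" x] by (auto elim!: eventually_mono)
  next
    case False
    then show ?thesis using assms eventually_nhds_in_open[of "{..<0}" x] by (auto elim!: eventually_mono simp: sgn_if)
  qed
  then have "eventually (\<lambda>y. spike y = sgn x * (2 / sinh (2 * (sgn x * y) + 1/20))) (nhds x)"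
    by eventually_elim (auto simp: spike_def sgn_if abs_if split: if_splits)
  then show ?thesis by (rule DERIV_cong_ev[OF refl _ refl, THEN iffD2, OF _ d[OF refl]])
qed

lemma cosh_double_sech2: "2 / (cosh (2 * x) + 1) = sech2 x"
  unfolding cosh_double_cosh sech2_def by simp

lemma spike_bound: "\<bar>spike x\<bar> \<le> 40 * sech2 x"
proof -
  have "1/20 \<le> sinh (1/20 :: real)" using real_le_x_sinh[of "1/20"] by (simp add: sinh_def exp_minus)
  moreover have "(cosh (2 * x) + 1) / 2 * sinh (1/20) \<le> sinh (2 * \<bar>x\<bar> + 1/20)"
  proof -
    have "(cosh (2 * x) + 1) / 2 \<le> cosh (2 * x)" using cosh_real_ge_1[of "2 * x"] by simp
    then have "(cosh (2 * x) + 1) / 2 * sinh (1/20) \<le> cosh (2 * \<bar>x\<bar>) * sinh (1/20)"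
      by (intro mult_right_mono) (auto simp: abs_if)
    also have "\<dots> \<le> sinh (2 * \<bar>x\<bar> + 1/20)" by (simp add: sinh_add)
    finally show ?thesis .
  qed
  ultimately have "(cosh (2 * x) + 1) / 2 * (1/20) \<le> sinh (2 * \<bar>x\<bar> + 1/20)"
    by (smt (verit) cosh_real_pos mult_left_mono divide_nonneg_pos)
  then have "2 / sinh (2 * \<bar>x\<bar> + 1/20) \<le> 2 / ((cosh (2 * x) + 1) / 2 * (1/20))"
    by (intro divide_left_mono) (auto intro!: mult_pos_pos add_pos_pos sinh_arg_pos)
  also have "\<dots> = 40 * sech2 x" unfolding cosh_double_sech2[symmetric] by simp
  finally have b: "2 / sinh (2 * \<bar>x\<bar> + 1/20) \<le> 40 * sech2 x" .
  have "\<bar>spike x\<bar> \<le> 2 / sinh (2 * \<bar>x\<bar> + 1/20)"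
    using sinh_arg_pos[of x] by (auto simp: spike_def abs_mult sgn_if)
  with b show ?thesis by linarith
qed

text \<open>
  With \<open>y = 2 |x| + 1/20\<close> the right-hand side is \<open>4 / (cosh y + 1)\<close> for \<open>x \<noteq> 0\<close>, and larger at the jump.  The shift by \<open>1/20\<close> costs at
  most a factor \<open>e\<^sup>1\<^sup>/\<^sup>2\<^sup>0\<close> against \<open>4 / (cosh (2 x) + 1) = 2 sech\<^sup>2 x\<close>.
\<close>

lemma spike_riccati: "19/10 * sech2 x \<le> - spike' x - (spike x)\<^sup>2"
proof -
  define y where "y = 2 * \<bar>x\<bar> + 1/20"
  have y: "0 < sinh y" unfolding y_def by (rule sinh_arg_pos)
  have c: "1 \<le> cosh y" by (rule cosh_real_ge_1)
  have "(sinh y)\<^sup>2 = (cosh y - 1) * (cosh y + 1)"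
    using sinh_square_eq[of y] by (simp add: algebra_simps power2_eq_square)
  moreover have "cosh y \<noteq> 1" using y calculation by auto
  ultimately have e: "4 * cosh y / (sinh y)\<^sup>2 - 4 / (sinh y)\<^sup>2 = 4 / (cosh y + 1)"
    using c by (simp add: divide_simps)
  have "(spike x)\<^sup>2 \<le> 4 / (sinh y)\<^sup>2"
    using y by (auto simp: spike_def y_def power_mult_distrib power_divide sgn_if)
  then have 1: "4 / (cosh y + 1) \<le> - spike' x - (spike x)\<^sup>2"
    using e by (simp add: spike'_def y_def)
  have "cosh y \<le> exp (1/20) * cosh (2 * x)"
  proof -
    have "sinh (2 * \<bar>x\<bar>) * sinh (1/20) \<le> cosh (2 * \<bar>x\<bar>) * sinh (1/20)"
      by (intro mult_right_mono) (auto simp: sinh_le_cosh_real)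
    then have "cosh y \<le> cosh (2 * \<bar>x\<bar>) * (cosh (1/20) + sinh (1/20))"
      unfolding y_def cosh_add by (simp add: algebra_simps)
    also have "\<dots> = exp (1/20) * cosh (2 * x)" by (simp add: cosh_plus_sinh abs_if)
    finally show ?thesis .
  qed
  moreover have "1 \<le> exp (1/20 :: real)" by simp
  ultimately have "cosh y + 1 \<le> exp (1/20) * (cosh (2 * x) + 1)" unfolding distrib_left by linarith
  moreover have "19/20 * exp (1/20 :: real) \<le> 1"
  proof -
    have "1 - 1/20 \<le> exp (- (1/20 :: real))" using exp_ge_add_one_self[of "- (1/20)"] by simp
    then show ?thesis by (simp add: exp_minus field_simps)
  qed
  ultimately have "19/20 * (cosh y + 1) \<le> cosh (2 * x) + 1"
  proof -
    assume a: "cosh y + 1 \<le> exp (1/20) * (cosh (2 * x) + 1)" and b: "19/20 * exp (1/20 :: real) \<le> 1"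
    have "19/20 * (cosh y + 1) \<le> (19/20 * exp (1/20)) * (cosh (2 * x) + 1)"
      using a by (simp only: mult.assoc mult_left_mono)
    also have "\<dots> \<le> 1 * (cosh (2 * x) + 1)"
      using b cosh_real_pos[of "2 * x"] by (intro mult_right_mono) auto
    finally show ?thesis by simp
  qed
  then have "19/20 * (2 / (cosh (2 * x) + 1)) \<le> 2 / (cosh y + 1)"
    using cosh_real_pos[of "2 * x"] c by (simp add: field_simps)
  with 1 show ?thesis unfolding cosh_double_sech2 by simp
qed

text \<open>
  Take the sum of the spikes at all centres.  In its square the product of two spikes is positive
  only at points to the same side of both centres.  One of the centres is then at distance at
  least \<open>D\<close>, so that the product is a small multiple of \<open>sech\<^sup>2\<close> of the other.
\<close>

lemma mean_multiplier:
  fixes \<tau> :: "nat \<Rightarrow> real" and k :: nat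
  assumes far: "\<And>i j. i < k \<Longrightarrow> j < k \<Longrightarrow> i \<noteq> j \<Longrightarrow> D \<le> \<bar>\<tau> i - \<tau> j\<bar>"
    and D: "0 \<le> D" "16000 * k \<le> (cosh D)\<^sup>2"
  obtains r r' :: "real \<Rightarrow> real" where "\<And>t. t \<notin> \<tau> ` {..<k} \<Longrightarrow> (r has_real_derivative r' t) (at t)" "\<And>t. \<bar>r t\<bar> \<le> 40 * k"
    "\<And>t. 17/10 * (\<Sum>j<k. sech2 (t - \<tau> j)) \<le> - (r t)\<^sup>2 - r' t"
    "(r \<longlongrightarrow> 0) at_top" "(r \<longlongrightarrow> 0) at_bot"
proof -
  define r where "r t = (\<Sum>j<k. spike (t - \<tau> j))" for t
  define r' where "r' t = (\<Sum>j<k. spike' (t - \<tau> j))" for t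
  have rd: "(r has_real_derivative r' t) (at t)" if "t \<notin> \<tau> ` {..<k}" for t
    unfolding r_def[abs_def] r'_def
  proof (rule DERIV_sum)
    fix j assume "j \<in> {..<k}"
    then have "t - \<tau> j \<noteq> 0" using that by auto
    from spike_derivative[OF this]
    show "((\<lambda>t. spike (t - \<tau> j)) has_real_derivative spike' (t - \<tau> j)) (at t)"
      using DERIV_shift[of spike "spike' (t - \<tau> j)" t "- \<tau> j"] by simp
  qed
  have rb: "\<bar>r t\<bar> \<le> 40 * k" for t
  proof -
    have "\<bar>spike x\<bar> \<le> 40" for x using spike_bound[of x] sech2_le_1[of x] by linarith
    then have "\<bar>r t\<bar> \<le> (\<Sum>j<k. 40)" unfolding r_def by (intro order_trans[OF sum_abs sum_mono])
    then show ?thesis by simp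
  qed
  have lim: "(r \<longlongrightarrow> 0) Fl" if Fl: "Fl \<in> {at_top, at_bot}" for Fl
    unfolding r_def[abs_def]
  proof (rule tendsto_null_sum)
    fix j
    show "((\<lambda>t. spike (t - \<tau> j)) \<longlongrightarrow> 0) Fl"
    proof (rule exp_decay_tendsto[OF _ Fl])
      fix t
      have "\<bar>spike (t - \<tau> j)\<bar> \<le> 160 * exp (- \<bar>t - \<tau> j\<bar>)"
        using spike_bound[of "t - \<tau> j"] sech2_decay[of "t - \<tau> j"] by linarith
      also have "\<dots> \<le> 160 * exp (\<bar>\<tau> j\<bar> + - \<bar>t\<bar>)" by simp
      also have "\<dots> = (160 * exp \<bar>\<tau> j\<bar>) * exp (- \<bar>t\<bar>)" by (simp only: exp_add mult.assoc)
      finally show "\<bar>spike (t - \<tau> j)\<bar> \<le> (160 * exp \<bar>\<tau> j\<bar>) * exp (- \<bar>t\<bar>)" .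
    qed
  qed
  have main: "17/10 * (\<Sum>j<k. sech2 (t - \<tau> j)) \<le> - (r t)\<^sup>2 - r' t" for t
  proof -
    define s where "s j = sech2 (t - \<tau> j)" for j
    define f where "f j = spike (t - \<tau> j)" for j
    define \<epsilon> where "\<epsilon> = 1600 * sech2 D"
    have \<epsilon>: "0 \<le> \<epsilon>" "2 * k * \<epsilon> \<le> 1/5"
      using D(2) sech2_pos[of D] by (auto simp: \<epsilon>_def sech2_def field_simps)
    have s0: "0 < s j" for j by (simp add: s_def sech2_pos)
    have cross: "f i * f j \<le> \<epsilon> * (s i + s j)" if ij: "i < k" "j < k" "i \<noteq> j" for i j
    proof (cases "0 < f i * f j")
      case True
      have small: "\<bar>f i\<bar> \<le> 40 * sech2 D" if "D \<le> \<bar>t - \<tau> i\<bar>" for i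
      proof -
        have "cosh D \<le> cosh \<bar>t - \<tau> i\<bar>" using that D(1) by (subst cosh_real_nonneg_le_iff) auto
        then have "(cosh D)\<^sup>2 \<le> (cosh (t - \<tau> i))\<^sup>2" by (intro power_mono) auto
        then have "sech2 (t - \<tau> i) \<le> sech2 D" unfolding sech2_def by (intro divide_left_mono) auto
        with spike_bound[of "t - \<tau> i"] show ?thesis unfolding f_def by linarith
      qed
      have big: "\<bar>f i\<bar> \<le> 40 * s i" for i unfolding f_def s_def by (rule spike_bound)
      have sg: "f l = 0 \<or> sgn (f l) = sgn (t - \<tau> l)" for l
        using sinh_arg_pos[of "t - \<tau> l"] by (auto simp: f_def spike_def sgn_mult sgn_if)
      have "sgn (t - \<tau> i) = sgn (t - \<tau> j)"
        using True sg[of i] sg[of j] by (auto simp: zero_less_mult_iff sgn_if split: if_splits)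
      then have "D \<le> \<bar>t - \<tau> i\<bar> \<or> D \<le> \<bar>t - \<tau> j\<bar>"
        using far[OF ij] by (auto simp: sgn_if abs_if split: if_splits)
      then have "\<bar>f i\<bar> * \<bar>f j\<bar> \<le> (40 * sech2 D) * (40 * s j) \<or> \<bar>f i\<bar> * \<bar>f j\<bar> \<le> (40 * s i) * (40 * sech2 D)"
        using small big s0 sech2_pos[of D] by (metis abs_ge_zero mult_mono less_imp_le mult_nonneg_nonneg zero_le_numeral)
      moreover have "f i * f j \<le> \<bar>f i\<bar> * \<bar>f j\<bar>" by (metis abs_ge_self abs_mult)
      moreover have "0 \<le> \<epsilon> * s i" "0 \<le> \<epsilon> * s j" using \<epsilon>(1) s0 by (auto simp: less_imp_le)
      ultimately show ?thesis by (auto simp: \<epsilon>_def algebra_simps)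
    next
      case False
      moreover have "0 \<le> \<epsilon> * (s i + s j)" using \<epsilon>(1) s0[of i] s0[of j] by (intro mult_nonneg_nonneg) auto
      ultimately show ?thesis by linarith
    qed
    have "(r t)\<^sup>2 = (\<Sum>i<k. \<Sum>j<k. f i * f j)" unfolding r_def f_def power2_eq_square sum_product ..
    also have "\<dots> \<le> (\<Sum>i<k. \<Sum>j<k. (if i = j then (f i)\<^sup>2 else 0) + \<epsilon> * (s i + s j))"
      using cross \<epsilon>(1) s0 by (intro sum_mono) (auto simp: power2_eq_square less_imp_le)
    also have "\<dots> = (\<Sum>i<k. (f i)\<^sup>2) + 2 * k * \<epsilon> * (\<Sum>i<k. s i)"
      by (simp add: sum.distrib distrib_left sum_distrib_left[symmetric])
    also have "\<dots> \<le> (\<Sum>i<k. (f i)\<^sup>2) + 1/5 * (\<Sum>i<k. s i)"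
      using \<epsilon>(2) s0 by (intro add_left_mono mult_right_mono sum_nonneg) (auto simp: less_imp_le)
    finally have 1: "(r t)\<^sup>2 \<le> (\<Sum>i<k. (f i)\<^sup>2) + 1/5 * (\<Sum>i<k. s i)" .
    have "19/10 * (\<Sum>i<k. s i) \<le> (\<Sum>i<k. - spike' (t - \<tau> i) - (f i)\<^sup>2)"
      unfolding sum_distrib_left f_def s_def by (intro sum_mono spike_riccati)
    then show ?thesis using 1 by (simp add: r'_def s_def[symmetric] sum_subtractf sum_negf)
  qed
  show thesis by (rule that[of r r', OF _ rb main]) (use rd lim in auto)
qed

lemma bubble_positions:
  fixes k :: nat
  assumes "0 < k"
  obtains D :: real where "0 \<le> D" "16000 * k \<le> (cosh D)\<^sup>2"
    "\<And>x. D \<le> \<bar>x\<bar> \<Longrightarrow> (2 / cosh x) powr (9/10) \<le> 1 / (20 * k)"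
proof -
  \<comment> \<open>The summands serve the two requirements on the distance; the exponent \<open>10/9\<close> undoes \<open>9/10\<close>.\<close>
  define K where "K = 16000 * k + 2 * (20 * real k) powr (10/9)"
  have K: "1 \<le> K" "16000 * k \<le> K" "2 * (20 * real k) powr (10/9) \<le> K"
    using assms by (auto simp: K_def add_increasing2)
  define D where "D = 2 * K"
  have "K \<le> exp D / 2" using exp_ge_add_one_self[of D] unfolding D_def by linarith
  also have "\<dots> \<le> cosh D" by (simp add: cosh_def)
  finally have c: "K \<le> cosh D" .
  show thesis
  proof (rule that)
    show D0: "0 \<le> D" using K by (simp add: D_def)
    have "cosh D * 1 \<le> cosh D * cosh D" using cosh_real_ge_1[of D] by (intro mult_left_mono) auto
    then show "16000 * k \<le> (cosh D)\<^sup>2" using c K unfolding power2_eq_square by linarith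
    fix x :: real assume x: "D \<le> \<bar>x\<bar>"
    have "cosh D \<le> cosh \<bar>x\<bar>" using x D0 by (subst cosh_real_nonneg_le_iff) auto
    then have "2 * (20 * real k) powr (10/9) \<le> cosh x" using c K by simp
    then have "2 / cosh x \<le> 2 / (2 * (20 * real k) powr (10/9))"
      using assms by (intro divide_left_mono) auto
    then have "(2 / cosh x) powr (9/10) \<le> (1 / (20 * real k) powr (10/9)) powr (9/10)"
      by (intro powr_mono2) auto
    also have "\<dots> = 1 / (20 * k)" using assms by (simp add: powr_divide powr_powr)
    finally show "(2 / cosh x) powr (9/10) \<le> 1 / (20 * k)" .
  qed
qed

section \<open>From the sphere to the cylinder\<close>

definition polar :: "real \<Rightarrow> real \<Rightarrow> real^2" where
  "polar t \<theta> = vector [exp t * cos \<theta>, exp t * sin \<theta>]"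

lemma polar_nth: "polar t \<theta> $ 1 = exp t * cos \<theta>" "polar t \<theta> $ 2 = exp t * sin \<theta>"
  by (simp_all add: polar_def)

lemma norm_polar: "(norm (polar t \<theta>))\<^sup>2 = (exp t)\<^sup>2" "norm (polar t \<theta>) = exp t"
proof -
  show *: "(norm (polar t \<theta>))\<^sup>2 = (exp t)\<^sup>2"
    by (simp add: norm_sq_2 polar_nth power_mult_distrib flip: distrib_left)
  then show "norm (polar t \<theta>) = exp t" by simp
qed

lemma polar_periodic: "polar t (2 * pi) = polar t 0"
  by (simp add: polar_def)

lemma polar_continuous:
  fixes A :: "'c::t2_space set"
  assumes "continuous_on A f" "continuous_on A g"
  shows "continuous_on A (\<lambda>x. polar (f x) (g x))"
proof -
  have "polar t \<theta> = (exp t * cos \<theta>) *\<^sub>R axis 1 1 + (exp t * sin \<theta>) *\<^sub>R axis 2 1" for t \<theta>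
    by (simp add: vec_eq_iff forall_2 polar_nth axis_def)
  then show ?thesis using assms by (auto intro!: continuous_intros)
qed

lemma polar_vector_derivatives:
  "((\<lambda>t. polar t \<theta>) has_vector_derivative polar t \<theta>) (at t)" (is ?A1)
  "(polar t has_vector_derivative vector [- exp t * sin \<theta>, exp t * cos \<theta>]) (at \<theta>)" (is ?A2)
proof -
  have p: "polar t \<theta> = (exp t * cos \<theta>) *\<^sub>R axis 1 1 + (exp t * sin \<theta>) *\<^sub>R axis 2 1" for t \<theta>
    by (simp add: vec_eq_iff forall_2 polar_nth axis_def)
  have q: "vector [- exp t * sin \<theta>, exp t * cos \<theta>] = (- exp t * sin \<theta>) *\<^sub>R axis 1 1 + (exp t * cos \<theta>) *\<^sub>R (axis 2 1 :: real^2)"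
    by (simp add: vec_eq_iff forall_2 axis_def)
  show ?A1
    unfolding p by (auto intro!: derivative_eq_intros)
  show ?A2
    unfolding p[abs_def] q by (auto intro!: derivative_eq_intros simp: mult.commute)
qed

lemma chain_partial:
  fixes g :: "real^2 \<Rightarrow> real"
  assumes \<gamma>: "(\<gamma> has_vector_derivative v) (at t)" and g: "g differentiable (at (\<gamma> t))"
  shows "((\<lambda>t. g (\<gamma> t)) has_real_derivative v$1 * partial 1 g (\<gamma> t) + v$2 * partial 2 g (\<gamma> t)) (at t)"
proof -
  let ?g' = "frechet_derivative g (at (\<gamma> t))"
  have d: "(g has_derivative ?g') (at (\<gamma> t))" using g by (rule has_derivative_frechet)
  then have lin: "linear ?g'" by (rule has_derivative_linear)
  have "((\<lambda>t. g (\<gamma> t)) has_derivative (\<lambda>s. ?g' (s *\<^sub>R v))) (at t)"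
    using has_derivative_compose[OF \<gamma>[unfolded has_vector_derivative_def] d] .
  moreover have "?g' (s *\<^sub>R v) = (v$1 * partial 1 g (\<gamma> t) + v$2 * partial 2 g (\<gamma> t)) * s" for s
  proof -
    have "s *\<^sub>R v = (s * v$1) *\<^sub>R axis 1 1 + (s * v$2) *\<^sub>R axis 2 1"
      by (simp add: vec_eq_iff forall_2 axis_def)
    then show ?thesis unfolding partial_def by (simp add: linear_add[OF lin] linear_scale[OF lin] algebra_simps)
  qed
  ultimately show ?thesis by (simp add: has_field_derivative_def)
qed

text \<open>
  The pullback of a function on the plane to the cylinder, and its derivatives, expressed by
  partial derivatives on the plane.
\<close>

definition "pull h t \<theta> = h (polar t \<theta>)" for h :: "real^2 \<Rightarrow> real"

definition "pull_t h t \<theta> = exp t * cos \<theta> * pull (partial 1 h) t \<theta> + exp t * sin \<theta> * pull (partial 2 h) t \<theta>"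
  for h :: "real^2 \<Rightarrow> real"

definition "pull_\<theta> h t \<theta> = - exp t * sin \<theta> * pull (partial 1 h) t \<theta> + exp t * cos \<theta> * pull (partial 2 h) t \<theta>"
  for h :: "real^2 \<Rightarrow> real"

definition "pull_tt h t \<theta> = pull_t h t \<theta> + exp t * cos \<theta> * pull_t (partial 1 h) t \<theta> + exp t * sin \<theta> * pull_t (partial 2 h) t \<theta>"
  for h :: "real^2 \<Rightarrow> real"

definition "pull_\<theta>\<theta> h t \<theta> = - pull_t h t \<theta> - exp t * sin \<theta> * pull_\<theta> (partial 1 h) t \<theta> + exp t * cos \<theta> * pull_\<theta> (partial 2 h) t \<theta>"
  for h :: "real^2 \<Rightarrow> real"

lemma pull_derivatives:
  assumes h: "smooth h"
  shows "((\<lambda>t. pull h t \<theta>) has_real_derivative pull_t h t \<theta>) (at t)"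
    "(pull h t has_real_derivative pull_\<theta> h t \<theta>) (at \<theta>)"
  using chain_partial[OF polar_vector_derivatives(1) smooth_differentiable[OF h]]
    chain_partial[OF polar_vector_derivatives(2) smooth_differentiable[OF h]]
  by (simp_all add: pull_def[abs_def] pull_t_def pull_\<theta>_def polar_nth)

lemma pull_second_derivatives:
  assumes h: "smooth h"
  shows "((\<lambda>t. pull_t h t \<theta>) has_real_derivative pull_tt h t \<theta>) (at t)" (is ?A1)
    "(pull_\<theta> h t has_real_derivative pull_\<theta>\<theta> h t \<theta>) (at \<theta>)" (is ?A2)
proof -
  note d = pull_derivatives[OF smooth_partial[OF h]]
  show ?A1
    unfolding pull_t_def[of h, abs_def] pull_tt_def
    by (auto intro!: derivative_eq_intros d simp: pull_t_def[of h] algebra_simps)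
  show ?A2
    unfolding pull_\<theta>_def[of h, abs_def] pull_\<theta>\<theta>_def
    by (auto intro!: derivative_eq_intros d simp: pull_t_def[of h] algebra_simps)
qed

lemma pull_laplacian:
  "pull_tt h t \<theta> + pull_\<theta>\<theta> h t \<theta> =
     (exp t)\<^sup>2 * (partial 1 (partial 1 h) (polar t \<theta>) + partial 2 (partial 2 h) (polar t \<theta>))"
proof -
  define s c where "s = sin \<theta>" and "c = cos \<theta>"
  have "pull_tt h t \<theta> + pull_\<theta>\<theta> h t \<theta> =
     (exp t)\<^sup>2 * (s\<^sup>2 + c\<^sup>2) * (pull (partial 1 (partial 1 h)) t \<theta> + pull (partial 2 (partial 2 h)) t \<theta>)"
    unfolding pull_tt_def pull_\<theta>\<theta>_def pull_t_def[of "partial _ h"] pull_\<theta>_def s_def[symmetric] c_def[symmetric]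
    by (simp add: algebra_simps power2_eq_square)
  then show ?thesis by (simp add: pull_def s_def c_def)
qed

lemma pull_continuous:
  fixes A :: "'c::t2_space set"
  assumes h: "smooth h" and "continuous_on A f" "continuous_on A g"
  shows "continuous_on A (\<lambda>x. pull h (f x) (g x))"
  unfolding pull_def
proof (rule continuous_on_compose2[OF _ polar_continuous[OF assms(2,3)]])
  show "continuous_on UNIV h"
    using smooth_differentiable[OF h] differentiable_imp_continuous_within
    by (auto simp: continuous_on_eq_continuous_within)
qed auto

lemma pull_parts_continuous:
  fixes A :: "'c::t2_space set"
  assumes h: "smooth h" and fg: "continuous_on A f" "continuous_on A g"
  shows "continuous_on A (\<lambda>x. pull_t h (f x) (g x))" (is ?A1) "continuous_on A (\<lambda>x. pull_\<theta> h (f x) (g x))" (is ?A2)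
    "continuous_on A (\<lambda>x. pull_tt h (f x) (g x))" (is ?A3) "continuous_on A (\<lambda>x. pull_\<theta>\<theta> h (f x) (g x))" (is ?A4)
proof -
  have t: "continuous_on A (\<lambda>x. pull_t h (f x) (g x))" if "smooth h" for h
    unfolding pull_t_def by (intro continuous_intros pull_continuous smooth_partial fg that)
  have \<theta>: "continuous_on A (\<lambda>x. pull_\<theta> h (f x) (g x))" if "smooth h" for h
    unfolding pull_\<theta>_def by (intro continuous_intros pull_continuous smooth_partial fg that)
  show ?A1 ?A2
    using t \<theta> h by blast+
  show ?A3 ?A4
    unfolding pull_tt_def pull_\<theta>\<theta>_def by (intro continuous_intros t \<theta> smooth_partial fg h)+
qed

lemma pull_bounded_inside:
  assumes h: "smooth h"
  obtains C where "\<And>t \<theta>. t \<le> 0 \<Longrightarrow> \<bar>pull h t \<theta>\<bar> \<le> C" "0 \<le> C"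
proof -
  have "continuous_on (cball 0 1) h"
    using smooth_differentiable[OF h] differentiable_imp_continuous_within continuous_at_imp_continuous_on by blast
  then have "bounded (h ` cball 0 1)"
    using compact_continuous_image compact_cball compact_imp_bounded by blast
  then obtain C where "\<forall>x\<in>h ` cball 0 1. norm x \<le> C" by (auto simp only: bounded_iff)
  then have C: "\<bar>h y\<bar> \<le> C" if "y \<in> cball 0 1" for y using that by auto
  show thesis
  proof
    show "\<bar>pull h t \<theta>\<bar> \<le> C" if "t \<le> 0" for t \<theta> unfolding pull_def by (rule C) (simp add: norm_polar that)
    show "0 \<le> C" using C[of 0] by simp
  qed
qed

lemma pull_gradient_bounded_inside:
  assumes h: "smooth h"
  obtains C where "\<And>t \<theta>. t \<le> 0 \<Longrightarrow> \<bar>pull_t h t \<theta>\<bar> \<le> C * exp t"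
    "\<And>t \<theta>. t \<le> 0 \<Longrightarrow> \<bar>pull_\<theta> h t \<theta>\<bar> \<le> C * exp t" "0 \<le> C"
proof -
  obtain C1 where C1: "\<And>t \<theta>. t \<le> 0 \<Longrightarrow> \<bar>pull (partial 1 h) t \<theta>\<bar> \<le> C1" "0 \<le> C1"
    using pull_bounded_inside[OF smooth_partial[OF h]] by blast
  obtain C2 where C2: "\<And>t \<theta>. t \<le> 0 \<Longrightarrow> \<bar>pull (partial 2 h) t \<theta>\<bar> \<le> C2" "0 \<le> C2"
    using pull_bounded_inside[OF smooth_partial[OF h]] by blast
  have e: "\<bar>exp t * a * x + exp t * b * y\<bar> \<le> (C1 + C2) * exp t"
    if "\<bar>a\<bar> \<le> 1" "\<bar>b\<bar> \<le> 1" "\<bar>x\<bar> \<le> C1" "\<bar>y\<bar> \<le> C2" for t a b x y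
  proof -
    have "\<bar>a * x\<bar> \<le> 1 * C1" "\<bar>b * y\<bar> \<le> 1 * C2" unfolding abs_mult
      using mult_mono[of "\<bar>a\<bar>" 1 "\<bar>x\<bar>" C1] mult_mono[of "\<bar>b\<bar>" 1 "\<bar>y\<bar>" C2] that by auto
    then have "\<bar>a * x + b * y\<bar> \<le> C1 + C2" by linarith
    then have "exp t * \<bar>a * x + b * y\<bar> \<le> exp t * (C1 + C2)" by (intro mult_left_mono) auto
    moreover have "exp t * a * x + exp t * b * y = exp t * (a * x + b * y)" by (simp add: algebra_simps)
    ultimately show ?thesis by (simp add: abs_mult mult.commute)
  qed
  show thesis
  proof
    show "0 \<le> C1 + C2" using C1 C2 by simp
    show "\<bar>pull_t h t \<theta>\<bar> \<le> (C1 + C2) * exp t" if "t \<le> 0" for t \<theta>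
      unfolding pull_t_def by (rule e) (auto simp: C1 C2 that)
    show "\<bar>pull_\<theta> h t \<theta>\<bar> \<le> (C1 + C2) * exp t" if "t \<le> 0" for t \<theta>
      using e[of "- sin \<theta>" "cos \<theta>" "pull (partial 1 h) t \<theta>" "pull (partial 2 h) t \<theta>" t] C1 C2 that
      unfolding pull_\<theta>_def by simp
  qed
qed

lemma stereo_inversion: "stereo 1 (polar t \<theta>) = stereo (- 1) (polar (- t) \<theta>)"
proof -
  have e: "exp (- t) = 1 / exp t" by (simp add: exp_minus field_simps)
  have p: "(exp t)\<^sup>2 + 1 > 0" by (simp add: add_nonneg_pos)
  have q: "(exp (- t))\<^sup>2 + 1 = ((exp t)\<^sup>2 + 1) / (exp t)\<^sup>2" "(exp (- t))\<^sup>2 - 1 = (1 - (exp t)\<^sup>2) / (exp t)\<^sup>2"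
    unfolding e by (simp_all add: field_simps)
  have "stereo 1 (polar t \<theta>) $ i = stereo (- 1) (polar (- t) \<theta>) $ i" if "i = 1 \<or> i = 2 \<or> i = 3" for i
    using that p by (auto simp: stereo_nth norm_polar polar_nth q) (simp_all add: e power2_eq_square field_simps)
  then show ?thesis by (simp add: vec_eq_iff forall_3)
qed

lemma pull_other_chart:
  assumes f: "smooth_on_sphere f"
  defines "h \<equiv> \<lambda>y. f (stereo 1 y)" and "h' \<equiv> \<lambda>y. f (stereo (- 1) y)"
  shows "pull h t \<theta> = pull h' (- t) \<theta>" "pull_t h t \<theta> = - pull_t h' (- t) \<theta>" "pull_\<theta> h t \<theta> = pull_\<theta> h' (- t) \<theta>" (is ?A1)
proof -
  have s: "smooth h" "smooth h'" using f unfolding smooth_on_sphere_def h_def h'_def by auto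
  show eq: "pull h t \<theta> = pull h' (- t) \<theta>" for t \<theta>
    unfolding pull_def h_def h'_def stereo_inversion ..
  have "((\<lambda>t. pull h' (- t) \<theta>) has_real_derivative - pull_t h' (- t) \<theta>) (at t)"
    using DERIV_mirror[of "\<lambda>t. pull h' t \<theta>" _ t] pull_derivatives(1)[OF s(2), of \<theta> "- t"] by simp
  then show "pull_t h t \<theta> = - pull_t h' (- t) \<theta>"
    using pull_derivatives(1)[OF s(1), of \<theta> t] DERIV_unique unfolding eq by blast
  have "pull h t = pull h' (- t)" using eq by blast
  then show ?A1
    using pull_derivatives(2)[OF s(1), of t \<theta>] pull_derivatives(2)[OF s(2), of "- t" \<theta>] DERIV_unique by metis
qed

text \<open>
  Near the end \<open>t \<rightarrow> - \<infinity>\<close> the factor \<open>e\<^sup>t\<close> comes from the polar coordinates.  The other end is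
  treated in the other chart, where inversion in the unit circle becomes \<open>t \<mapsto> - t\<close>.
\<close>

lemma pull_bounds:
  assumes f: "smooth_on_sphere f"
  defines "h \<equiv> \<lambda>y. f (stereo 1 y)"
  obtains C where "0 \<le> C" "\<And>t \<theta>. \<bar>pull h t \<theta>\<bar> \<le> C" "\<And>t \<theta>. \<bar>pull_t h t \<theta>\<bar> \<le> C * exp (- \<bar>t\<bar>)"
    "\<And>t \<theta>. \<bar>pull_\<theta> h t \<theta>\<bar> \<le> C * exp (- \<bar>t\<bar>)"
proof -
  define h' where "h' = (\<lambda>y. f (stereo (- 1) y))"
  have s: "smooth h" "smooth h'" using f unfolding smooth_on_sphere_def h_def h'_def by auto
  note other = pull_other_chart[OF f, folded h_def h'_def]
  obtain C1 where C1: "\<And>t \<theta>. t \<le> 0 \<Longrightarrow> \<bar>pull h t \<theta>\<bar> \<le> C1" "0 \<le> C1" using pull_bounded_inside[OF s(1)] by blast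
  obtain C2 where C2: "\<And>t \<theta>. t \<le> 0 \<Longrightarrow> \<bar>pull h' t \<theta>\<bar> \<le> C2" "0 \<le> C2" using pull_bounded_inside[OF s(2)] by blast
  obtain C3 where C3: "\<And>t \<theta>. t \<le> 0 \<Longrightarrow> \<bar>pull_t h t \<theta>\<bar> \<le> C3 * exp t"
    "\<And>t \<theta>. t \<le> 0 \<Longrightarrow> \<bar>pull_\<theta> h t \<theta>\<bar> \<le> C3 * exp t" "0 \<le> C3" using pull_gradient_bounded_inside[OF s(1)] by blast
  obtain C4 where C4: "\<And>t \<theta>. t \<le> 0 \<Longrightarrow> \<bar>pull_t h' t \<theta>\<bar> \<le> C4 * exp t"
    "\<And>t \<theta>. t \<le> 0 \<Longrightarrow> \<bar>pull_\<theta> h' t \<theta>\<bar> \<le> C4 * exp t" "0 \<le> C4" using pull_gradient_bounded_inside[OF s(2)] by blast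
  define C where "C = C1 + C2 + C3 + C4"
  have C: "C1 \<le> C" "C2 \<le> C" "C3 \<le> C" "C4 \<le> C" using C1(2) C2(2) C3(3) C4(3) by (auto simp: C_def)
  have up: "x \<le> C * exp s" if "x \<le> c * exp s" "c \<le> C" for x c s
    using that by (meson exp_ge_zero mult_right_mono order_trans)
  show thesis
  proof
    show "0 \<le> C" using C C1(2) by linarith
    fix t \<theta>
    show "\<bar>pull h t \<theta>\<bar> \<le> C"
      using C1(1)[of t \<theta>] C2(1)[of "- t" \<theta>] other(1)[of t \<theta>] C by (cases "t \<le> 0") auto
    show "\<bar>pull_t h t \<theta>\<bar> \<le> C * exp (- \<bar>t\<bar>)"
      using up[OF C3(1)[of t \<theta>] C(3)] up[OF C4(1)[of "- t" \<theta>] C(4)] other(2)[of t \<theta>] by (cases "t \<le> 0") auto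
    show "\<bar>pull_\<theta> h t \<theta>\<bar> \<le> C * exp (- \<bar>t\<bar>)"
      using up[OF C3(2)[of t \<theta>] C(3)] up[OF C4(2)[of "- t" \<theta>] C(4)] other(3)[of t \<theta>] by (cases "t \<le> 0") auto
  qed
qed

lemma polar_surj:
  assumes "y \<noteq> 0"
  obtains t \<theta> where "y = polar t \<theta>" "\<theta> \<in> {0..2*pi}"
proof -
  define r where "r = norm y"
  have r: "0 < r" "r\<^sup>2 = (y$1)\<^sup>2 + (y$2)\<^sup>2" using assms by (auto simp: r_def norm_sq_2)
  have "(y$1 / r)\<^sup>2 + (y$2 / r)\<^sup>2 = 1" unfolding power_divide add_divide_distrib[symmetric] r(2)[symmetric] using r(1) by simp
  then obtain \<theta> where \<theta>: "0 \<le> \<theta>" "\<theta> < 2 * pi" "y$1 / r = cos \<theta>" "y$2 / r = sin \<theta>"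
    by (rule sincos_total_2pi)
  have "y = polar (ln r) \<theta>"
    using r(1) by (simp add: vec_eq_iff forall_2 polar_nth \<theta>(3,4)[symmetric])
  then show thesis using that \<theta> by auto
qed

lemma vanish_on_sphere:
  assumes f: "smooth_on_sphere f"
    and zero: "\<And>t \<theta>. \<theta> \<in> {0..2*pi} \<Longrightarrow> pull (\<lambda>y. f (stereo 1 y)) t \<theta> = 0"
    and p: "p \<in> sphere 0 1"
  shows "f p = 0"
proof -
  have chart: "f (stereo e y) = 0" if e: "e \<in> {1, -1}" for e y
  proof -
    have off: "f (stereo e y) = 0" if "y \<noteq> 0" for y
    proof -
      obtain t \<theta> where "y = polar t \<theta>" "\<theta> \<in> {0..2*pi}" using polar_surj[OF \<open>y \<noteq> 0\<close>] .
      then show ?thesis using e zero[of \<theta> t] zero[of \<theta> "- t"] stereo_inversion[of "- t" \<theta>] by (auto simp: pull_def)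
    qed
    show ?thesis
    proof (cases "y = 0")
      case True
      have "isCont (\<lambda>y. f (stereo e y)) 0"
        using f e smooth_differentiable differentiable_imp_continuous_within unfolding smooth_on_sphere_def by blast
      then have "((\<lambda>y. f (stereo e y)) \<longlongrightarrow> f (stereo e 0)) (at 0)" by (simp add: isCont_def)
      moreover have "((\<lambda>y. f (stereo e y)) \<longlongrightarrow> 0) (at 0)"
        by (rule Lim_transform_eventually[OF tendsto_const]) (auto simp: eventually_at_filter off)
      ultimately show ?thesis using True tendsto_unique[OF trivial_limit_at] by blast
    qed (rule off)
  qed
  show ?thesis
  proof (cases "p $ 3 = 1")
    case True
    then have "p $ 3 \<noteq> - 1" by simp
    then show ?thesis using chart[of "- 1"] stereo_stereo_coord[OF _ p, of "- 1"] by (metis insertCI)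
  next
    case False
    then show ?thesis using chart[of 1] stereo_stereo_coord[OF _ p, of 1] by (metis insertCI)
  qed
qed

section \<open>Bubble metrics\<close>

text \<open>
  The conformal factor of the pullback of the round metric under the dilation \<open>y \<mapsto> \<surd>c y\<close> of the
  stereographic plane, as a function of the height.
\<close>

definition bubble :: "real \<Rightarrow> real^3 \<Rightarrow> real" where
  "bubble c p = 4 * c / ((1 + c) - (1 - c) * p$3)\<^sup>2"

text \<open>
  Division by \<open>4 \<pi> k\<close> makes the total area one.
\<close>

definition bubble_factor :: "nat \<Rightarrow> (nat \<Rightarrow> real) \<Rightarrow> real^3 \<Rightarrow> real" where
  "bubble_factor k \<tau> p = (\<Sum>j<k. bubble (exp (- 2 * \<tau> j)) p) / (4 * pi * k)"

lemma bubble_pos: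
  assumes c: "0 < c" and p: "p \<in> sphere 0 1"
  shows "0 < bubble c p"
proof -
  have "\<bar>p $ 3\<bar> \<le> 1" using component_le_norm_cart[of p 3] p by simp
  then have "\<bar>(1 - c) * p$3\<bar> \<le> \<bar>1 - c\<bar>" by (simp add: abs_mult mult_left_le)
  then have "(1 + c) - (1 - c) * p$3 > 0" using c by linarith
  then show ?thesis unfolding bubble_def using c by simp
qed

lemma bubble_factor_pos: "0 < k \<Longrightarrow> p \<in> sphere 0 1 \<Longrightarrow> 0 < bubble_factor k \<tau> p"
  unfolding bubble_factor_def by (intro divide_pos_pos sum_pos bubble_pos) auto

text \<open>
  A dilation by \<open>\<surd>c\<close> in one chart is a dilation by \<open>1 / \<surd>c\<close> in the other; either formula is smooth
  at the origin, hence the factor is smooth at both poles.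
\<close>

lemma bubble_stereo:
  assumes c: "0 < c"
  shows "bubble c (stereo 1 y) * 4 / ((norm y)\<^sup>2 + 1)\<^sup>2 = 4 * c / (1 + c * (norm y)\<^sup>2)\<^sup>2" (is ?A1)
    "bubble c (stereo (- 1) y) * 4 / ((norm y)\<^sup>2 + 1)\<^sup>2 = 4 * c / (c + (norm y)\<^sup>2)\<^sup>2" (is ?A2)
proof -
  define R where "R = (norm y)\<^sup>2"
  have R: "0 \<le> R" by (simp add: R_def)
  have a: "(1 + c) - (1 - c) * ((R - 1) / (R + 1)) = 2 * (1 + c * R) / (R + 1)"
    "(1 + c) - (1 - c) * (- 1 * (R - 1) / (R + 1)) = 2 * (c + R) / (R + 1)"
    using R by (simp_all add: field_simps)
  have "1 + c * R \<noteq> 0" "c + R \<noteq> 0" "R + 1 \<noteq> 0" using R c by (auto simp: add_pos_nonneg less_imp_neq[THEN not_sym])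
  moreover have "4 * c / (2 * z / w)\<^sup>2 * 4 / w\<^sup>2 = 4 * c / z\<^sup>2" if "z \<noteq> 0" "w \<noteq> 0" for z w :: real
    using that by (simp add: power_divide power_mult_distrib)
  ultimately have "4 * c / (2 * (1 + c * R) / (R + 1))\<^sup>2 * 4 / (R + 1)\<^sup>2 = 4 * c / (1 + c * R)\<^sup>2"
    "4 * c / (2 * (c + R) / (R + 1))\<^sup>2 * 4 / (R + 1)\<^sup>2 = 4 * c / (c + R)\<^sup>2"
    by blast+
  then show ?A1
    ?A2
    unfolding bubble_def stereo_nth R_def[symmetric] mult_1 a by auto
qed

lemma area_density_bubble:
  "area_density (bubble_factor k \<tau>) 1 y = (\<Sum>j<k. 4 * exp (- 2 * \<tau> j) / (1 + exp (- 2 * \<tau> j) * (norm y)\<^sup>2)\<^sup>2) / (4 * pi * k)" (is ?A1)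
  "area_density (bubble_factor k \<tau>) (- 1) y = (\<Sum>j<k. 4 * exp (- 2 * \<tau> j) / (exp (- 2 * \<tau> j) + (norm y)\<^sup>2)\<^sup>2) / (4 * pi * k)" (is ?A2)
proof -
  have "area_density (bubble_factor k \<tau>) e y = (\<Sum>j<k. bubble (exp (- 2 * \<tau> j)) (stereo e y) * 4 / ((norm y)\<^sup>2 + 1)\<^sup>2) / (4 * pi * k)" for e
    unfolding area_density_def bubble_factor_def
    by (simp only: sum_divide_distrib[symmetric] sum_distrib_right[symmetric]) simp
  then show
    ?A1
    ?A2
    by (simp_all only: bubble_stereo exp_gt_zero)
qed

lemma smooth_area_density_bubble:
  assumes "e \<in> {1, -1}"
  shows "smooth (area_density (bubble_factor k \<tau>) e)"
proof -
  have n: "smooth (\<lambda>y::real^2. (norm y)\<^sup>2)" unfolding norm_sq_2 by (intro smooth_intros)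
  have "(c + (norm y)\<^sup>2)\<^sup>2 \<noteq> 0" "(1 + c * (norm y)\<^sup>2)\<^sup>2 \<noteq> 0" if "0 < c" for c and y :: "real^2"
    using that by (auto simp: add_pos_nonneg less_imp_neq[THEN not_sym])
  then have nz: "(exp x + (norm y)\<^sup>2)\<^sup>2 \<noteq> 0" "(1 + exp x * (norm y)\<^sup>2)\<^sup>2 \<noteq> 0" for x and y :: "real^2"
    using exp_gt_zero by blast+
  have d: "smooth (\<lambda>y. h y / c)" if "smooth h" for h :: "real^2 \<Rightarrow> real" and c
    using smooth_mult[OF that smooth_const[of "1 / c"]] by simp
  have "smooth (\<lambda>y. area_density (bubble_factor k \<tau>) 1 y)" "smooth (\<lambda>y. area_density (bubble_factor k \<tau>) (- 1) y)"
    unfolding area_density_bubble by (intro d smooth_sum smooth_divide smooth_power smooth_add smooth_mult smooth_const n nz)+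
  then show ?thesis using assms by auto
qed

lemma riemannian_metric_bubble:
  assumes k: "0 < k"
  shows "riemannian_metric (conformal (bubble_factor k \<tau>))"
  unfolding riemannian_metric_def
proof (intro conjI ballI allI impI)
  fix p :: "real^3" and u v w a b
  assume p: "p \<in> sphere 0 1"
  show "conformal (bubble_factor k \<tau>) p u v = conformal (bubble_factor k \<tau>) p v u"
    by (simp add: conformal_def inner_commute)
  show "conformal (bubble_factor k \<tau>) p (a *\<^sub>R u + b *\<^sub>R v) w =
     a * conformal (bubble_factor k \<tau>) p u w + b * conformal (bubble_factor k \<tau>) p v w"
    by (simp add: conformal_def inner_add_left algebra_simps)
  show "0 < conformal (bubble_factor k \<tau>) p v v" if "v \<noteq> 0"
    using that bubble_factor_pos[OF k p] by (simp add: conformal_def)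
next
  fix e :: real and i j :: 2 assume e: "e \<in> {1, -1}"
  show "smooth (\<lambda>y. coord_metric (conformal (bubble_factor k \<tau>)) (stereo e) y $ i $ j)"
    unfolding coord_metric_conformal[OF e] using smooth_area_density_bubble[OF e] smooth_const[of "0::real"]
    by (cases "i = j") (simp_all add: mat_def)
qed

text \<open>
  Layer-cake integration: the integrand is an integral over \<open>s \<ge> |y|\<^sup>2\<close>; exchanging the order
  leaves the areas \<open>\<pi> s\<close> of discs.
\<close>

lemma bubble_area:
  assumes c: "0 < c"
  shows "has_bochner_integral lborel (\<lambda>y::real^2. 4 * c / (1 + c * (norm y)\<^sup>2)\<^sup>2) (4 * pi)"
proof -
  define g where "g = (\<lambda>s. 8 * c\<^sup>2 * (1 / (1 + c * s))^3)"
  have pos: "0 < 1 + c * s" if "0 \<le> s" for s using c that by (simp add: add_pos_nonneg)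
  have w: "((\<lambda>s. 1 / (1 + c * s)) has_real_derivative - c * (1 / (1 + c * s))\<^sup>2) (at s)" if "0 \<le> s" for s
    using pos[OF that] by (auto intro!: derivative_eq_intros simp: power2_eq_square)
  have top: "filterlim (\<lambda>s. 1 + c * s) at_top at_top"
    using c by (intro filterlim_tendsto_add_at_top[OF tendsto_const] filterlim_tendsto_pos_mult_at_top[OF tendsto_const c filterlim_ident])
  have inv: "((\<lambda>s. 1 / (1 + c * s)) \<longlongrightarrow> 0) at_top"
    using filterlim_compose[OF tendsto_inverse_0_at_top[OF filterlim_ident] top] by (simp add: inverse_eq_divide)
  have tail: "(\<integral>\<^sup>+ s. ennreal (g s) * indicator {a..} s \<partial>lborel) = ennreal (4 * c / (1 + c * a)\<^sup>2)" if a: "0 \<le> a" for a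
  proof -
    have "(\<integral>\<^sup>+ s. ennreal (g s) * indicator {a..} s \<partial>lborel) = ennreal (0 - (- 4 * c * (1 / (1 + c * a))\<^sup>2))"
    proof (rule nn_integral_FTC_atLeast[where F = "\<lambda>s. - 4 * c * (1 / (1 + c * s))\<^sup>2"])
      show "g \<in> borel_measurable borel" unfolding g_def by measurable
      show "0 \<le> g s" if "a \<le> s" for s using pos[of s] a that by (simp add: g_def)
      show "((\<lambda>s. - 4 * c * (1 / (1 + c * s))\<^sup>2) has_real_derivative g s) (at s)" if "a \<le> s" for s
        by (rule DERIV_cong[OF DERIV_cmult[OF DERIV_power[OF w, of _ 2]]])
           (use a that in \<open>auto simp: g_def power2_eq_square power3_eq_cube\<close>)
      show "((\<lambda>s. - 4 * c * (1 / (1 + c * s))\<^sup>2) \<longlongrightarrow> 0) at_top"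
        using tendsto_mult_right_zero[OF tendsto_null_power[OF inv, of 2], of "- 4 * c"] by simp
    qed
    then show ?thesis by (simp add: power_divide)
  qed
  have disc: "emeasure lborel {y::real^2. (norm y)\<^sup>2 \<le> s} = ennreal (pi * s)" if s: "0 \<le> s" for s
  proof -
    have "(norm y)\<^sup>2 \<le> s \<longleftrightarrow> norm y \<le> sqrt s" for y :: "real^2"
      using real_sqrt_le_iff[of "(norm y)\<^sup>2" s] by simp
    then have "{y::real^2. (norm y)\<^sup>2 \<le> s} = cball 0 (sqrt s)" by (simp only: cball_def dist_0_norm)
    then show ?thesis using emeasure_cball[of "sqrt s" "0::real^2"] s by (simp add: unit_ball_vol_2)
  qed
  have "(\<integral>\<^sup>+ y. ennreal (4 * c / (1 + c * (norm y)\<^sup>2)\<^sup>2) \<partial>(lborel::(real^2) measure))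
    = (\<integral>\<^sup>+ y. (\<integral>\<^sup>+ s. ennreal (g s) * indicator {(norm y)\<^sup>2..} s \<partial>lborel) \<partial>(lborel::(real^2) measure))"
    by (simp add: tail)
  also have "\<dots> = (\<integral>\<^sup>+ s. (\<integral>\<^sup>+ y. ennreal (g s) * indicator {(norm y)\<^sup>2..} s \<partial>(lborel::(real^2) measure)) \<partial>lborel)"
  proof (rule lborel_pair.Fubini')
    have "(\<lambda>z::real \<times> (real^2). ennreal (g (fst z)) * indicator {z. (norm (snd z))\<^sup>2 \<le> fst z} z) \<in> borel_measurable (lborel \<Otimes>\<^sub>M lborel)"
      unfolding g_def by measurable
    then show "(\<lambda>(s, y). ennreal (g s) * indicator {(norm (y::real^2))\<^sup>2..} s) \<in> borel_measurable (lborel \<Otimes>\<^sub>M lborel)"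
      by (simp add: case_prod_beta indicator_def)
  qed
  also have "\<dots> = (\<integral>\<^sup>+ s. ennreal (g s * (pi * s)) * indicator {0..} s \<partial>lborel)"
  proof (rule nn_integral_cong)
    fix s :: real
    have "(\<integral>\<^sup>+ y. ennreal (g s) * indicator {(norm y)\<^sup>2..} s \<partial>(lborel::(real^2) measure))
       = (\<integral>\<^sup>+ y. ennreal (g s) * indicator {y. (norm y)\<^sup>2 \<le> s} y \<partial>(lborel::(real^2) measure))"
      by (intro nn_integral_cong) (auto simp: indicator_def)
    also have "\<dots> = ennreal (g s) * emeasure lborel {y::real^2. (norm y)\<^sup>2 \<le> s}"
      by (rule nn_integral_cmult_indicator) measurable
    also have "\<dots> = ennreal (g s * (pi * s)) * indicator {0..} s"
    proof (cases "0 \<le> s")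
      case True
      then show ?thesis using pos[of s] by (simp add: disc g_def ennreal_mult)
    next
      case False
      then have "{y::real^2. (norm y)\<^sup>2 \<le> s} = {}" by (auto simp: not_le intro: less_le_trans)
      then show ?thesis using False by simp
    qed
    finally show "(\<integral>\<^sup>+ y. ennreal (g s) * indicator {(norm y)\<^sup>2..} s \<partial>(lborel::(real^2) measure)) = ennreal (g s * (pi * s)) * indicator {0..} s" .
  qed
  also have "\<dots> = ennreal (4 * pi - 4 * pi * (1 - 1 / (1 + c * 0))\<^sup>2)"
  proof (rule nn_integral_FTC_atLeast[where F = "\<lambda>s. 4 * pi * (1 - 1 / (1 + c * s))\<^sup>2"])
    show "(\<lambda>s. g s * (pi * s)) \<in> borel_measurable borel" unfolding g_def by measurable
    show "0 \<le> g s * (pi * s)" if "0 \<le> s" for s using pos[OF that] that by (simp add: g_def)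
    show "((\<lambda>s. 4 * pi * (1 - 1 / (1 + c * s))\<^sup>2) has_real_derivative g s * (pi * s)) (at s)" if "0 \<le> s" for s
    proof -
      have e: "c * (1 / (1 + c * s)) * s = 1 - 1 / (1 + c * s)" using pos[OF that] by (simp add: field_simps)
      have eq: "g s * (pi * s) = 8 * pi * c * (1 / (1 + c * s))\<^sup>2 * (1 - 1 / (1 + c * s))"
        unfolding g_def e[symmetric] by (simp only: power2_eq_square power3_eq_cube mult_ac)
      show ?thesis
        unfolding eq by (rule DERIV_cong[OF DERIV_cmult[OF DERIV_power[OF DERIV_diff[OF DERIV_const w[OF that]], where n = 2]]]) simp
    qed
    have "((\<lambda>s. 4 * pi * (1 - 1 / (1 + c * s))\<^sup>2) \<longlongrightarrow> 4 * pi * (1 - 0)\<^sup>2) at_top"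
      by (intro tendsto_intros inv)
    then show "((\<lambda>s. 4 * pi * (1 - 1 / (1 + c * s))\<^sup>2) \<longlongrightarrow> 4 * pi) at_top" by simp
  qed
  finally show ?thesis
    using c by (intro has_bochner_integral_nn_integral) auto
qed

lemma area_bubble:
  assumes k: "0 < k"
  shows "area (conformal (bubble_factor k \<tau>)) = 1"
proof -
  have "sqrt (det (coord_metric (conformal (bubble_factor k \<tau>)) (stereo 1) y)) = area_density (bubble_factor k \<tau>) 1 y" for y
    using area_density_pos[of 1 "bubble_factor k \<tau>" y, OF _ bubble_factor_pos[OF k]]
    by (simp add: coord_metric_conformal det_mat_2)
  then have "area (conformal (bubble_factor k \<tau>)) = (\<integral>y. area_density (bubble_factor k \<tau>) 1 y \<partial>lborel)"
    by (simp add: area_def)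
  also have "\<dots> = (\<Sum>j<k. 4 * pi) / (4 * pi * k)"
    unfolding area_density_bubble
    by (intro has_bochner_integral_integral_eq has_bochner_integral_divide_zero has_bochner_integral_sum bubble_area) simp
  finally show ?thesis using k by simp
qed

section \<open>Counting eigenvalues\<close>

lemma underdetermined_system:
  fixes a :: "nat \<Rightarrow> 'x \<Rightarrow> real"
  assumes "finite J" "k < card J"
  shows "\<exists>c. (\<exists>x\<in>J. c x \<noteq> 0) \<and> (\<forall>j<k. (\<Sum>x\<in>J. c x * a j x) = 0)"
  using assms
proof (induction k arbitrary: J a)
  case 0
  then obtain x where "x \<in> J" by fastforce
  then show ?case by (intro exI[of _ "\<lambda>_. 1"]) auto
next
  case (Suc k)
  show ?case
  proof (cases "\<forall>x\<in>J. a k x = 0")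
    case True
    from Suc.IH[of J a] Suc.prems obtain c where c: "\<exists>x\<in>J. c x \<noteq> 0" "\<forall>j<k. (\<Sum>x\<in>J. c x * a j x) = 0" by auto
    moreover have "(\<Sum>x\<in>J. c x * a k x) = 0" using True by simp
    ultimately show ?thesis by (auto simp: less_Suc_eq)
  next
    case False
    then obtain z where z: "z \<in> J" "a k z \<noteq> 0" by blast
    \<comment> \<open>Gaussian elimination: solve the last equation for the unknown at \<open>z\<close>.\<close>
  define b where "b j x = a j x - a j z * (a k x / a k z)" for j x
    have "card (J - {z}) = card J - 1" using z Suc.prems by simp
    then have "k < card (J - {z})" "finite (J - {z})" using Suc.prems by auto
    then obtain c where c: "\<exists>x\<in>J - {z}. c x \<noteq> 0" "\<forall>j<k. (\<Sum>x\<in>J - {z}. c x * b j x) = 0"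
      using Suc.IH[of "J - {z}" b] by blast
    define m where "m = (\<Sum>x\<in>J - {z}. c x * (a k x / a k z))"
    define c' where "c' = c(z := - m)"
    have sum: "(\<Sum>x\<in>J. c' x * a j x) = (\<Sum>x\<in>J - {z}. c x * b j x)" for j
    proof -
      have "(\<Sum>x\<in>J. c' x * a j x) = - m * a j z + (\<Sum>x\<in>J - {z}. c x * a j x)"
        using Suc.prems z by (subst sum.remove[of J z]) (auto simp: c'_def intro!: sum.cong)
      also have "\<dots> = (\<Sum>x\<in>J - {z}. c x * b j x)"
      proof -
        have "m * a j z = (\<Sum>x\<in>J - {z}. c x * (a j z * (a k x / a k z)))"
          unfolding m_def sum_distrib_right by (intro sum.cong refl) simp
        then show ?thesis by (simp add: b_def sum_subtractf right_diff_distrib)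
      qed
      finally show ?thesis .
    qed
    have "b k x = 0" for x using z by (simp add: b_def)
    then have "(\<Sum>x\<in>J. c' x * a j x) = 0" if "j < Suc k" for j
      using c(2) that by (auto simp: sum less_Suc_eq)
    moreover have "\<exists>x\<in>J. c' x \<noteq> 0" using c(1) by (auto simp: c'_def)
    ultimately show ?thesis by blast
  qed
qed

text \<open>
  A supremum of cardinalities that is at least \<open>n\<close> need not be attained, as it may be infinite,
  but some cardinality is at least \<open>n\<close>.
\<close>

lemma enat_le_SUP_card:
  assumes "enat n \<le> (SUP B\<in>\<B>. enat (card B))" "\<B> \<noteq> {}"
  shows "\<exists>B\<in>\<B>. n \<le> card B"
proof (rule ccontr)
  assume "\<not> ?thesis"
  then have lt: "card B < n" if "B \<in> \<B>" for B using that by auto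
  then have "0 < n" using assms(2) by fastforce
  have "(SUP B\<in>\<B>. enat (card B)) \<le> enat (n - 1)" using lt by (intro SUP_least) fastforce
  with assms(1) have "enat n \<le> enat (n - 1)" by (rule order_trans)
  with \<open>0 < n\<close> show False by simp
qed

lemma many_eigenfunctions:
  assumes "enat (Suc k) \<le> eigenvalue_count g x"
  obtains A B where "finite A" "A \<subseteq> {..x}" "\<And>\<mu>. \<mu> \<in> A \<Longrightarrow> finite (B \<mu>)"
    "\<And>\<mu>. \<mu> \<in> A \<Longrightarrow> B \<mu> \<subseteq> eigenspace g \<mu>" "\<And>\<mu>. \<mu> \<in> A \<Longrightarrow> independent_on_sphere (B \<mu>)"
    "k < (\<Sum>\<mu>\<in>A. card (B \<mu>))"
proof -
  have "enat k < eigenvalue_count g x" using assms by (metis Suc_ile_eq)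
  then obtain A where A: "finite A" "A \<subseteq> {..x}" "enat k < (\<Sum>\<mu>\<in>A. multiplicity g \<mu>)"
    unfolding eigenvalue_count_def less_SUP_iff by auto
  \<comment> \<open>Infinite multiplicities are truncated, since \<open>Suc k\<close> functions are enough.\<close>
  define n where "n \<mu> = (case multiplicity g \<mu> of enat m \<Rightarrow> m | \<infinity> \<Rightarrow> Suc k)" for \<mu>
  define \<B> where "\<B> \<mu> = {B. finite B \<and> B \<subseteq> eigenspace g \<mu> \<and> independent_on_sphere B}" for \<mu>
  have "enat (n \<mu>) \<le> multiplicity g \<mu>" for \<mu> by (simp add: n_def split: enat.split)
  moreover have "{} \<in> \<B> \<mu>" for \<mu> by (auto simp: \<B>_def independent_on_sphere_def)
  ultimately have "\<exists>B\<in>\<B> \<mu>. n \<mu> \<le> card B" for \<mu>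
    unfolding multiplicity_def \<B>_def[symmetric] by (intro enat_le_SUP_card) auto
  then obtain B where B: "\<And>\<mu>. B \<mu> \<in> \<B> \<mu>" "\<And>\<mu>. n \<mu> \<le> card (B \<mu>)" by metis
  have "k < (\<Sum>\<mu>\<in>A. n \<mu>)"
  proof (cases "\<exists>\<mu>\<in>A. multiplicity g \<mu> = \<infinity>")
    case True
    then obtain \<mu> where "\<mu> \<in> A" "n \<mu> = Suc k" by (auto simp: n_def)
    then show ?thesis using member_le_sum[of \<mu> A n] A(1) by simp
  next
    case False
    then have "multiplicity g \<mu> = enat (n \<mu>)" if "\<mu> \<in> A" for \<mu> using that by (auto simp: n_def split: enat.split)
    then have "(\<Sum>\<mu>\<in>A. multiplicity g \<mu>) = (\<Sum>\<mu>\<in>A. enat (n \<mu>))" by simp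
    also have "\<dots> = enat (\<Sum>\<mu>\<in>A. n \<mu>)" using A(1) by (induction A rule: finite_induct) (auto simp: zero_enat_def)
    finally show ?thesis using A(3) by simp
  qed
  also have "\<dots> \<le> (\<Sum>\<mu>\<in>A. card (B \<mu>))" by (intro sum_mono B)
  finally show thesis using that[of A B] A B(1) unfolding \<B>_def by auto
qed

text \<open>
  On the cylinder the dilation becomes a translation along the axis, so that every bubble
  contributes a translate of the same profile.
\<close>

lemma bubble_density_cylinder:
  "(exp t)\<^sup>2 * area_density (bubble_factor k \<tau>) 1 (polar t \<theta>) = (\<Sum>j<k. sech2 (t - \<tau> j)) / (4 * pi * k)"
proof -
  have "(exp t)\<^sup>2 * (4 * exp (- 2 * s) / (1 + exp (- 2 * s) * (exp t)\<^sup>2)\<^sup>2) = sech2 (t - s)" for s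
  proof -
    define x where "x = exp (t - s)"
    have x: "0 < x" by (simp add: x_def)
    have e: "exp (- 2 * s) * (exp t)\<^sup>2 = x\<^sup>2"
      by (simp add: x_def power2_eq_square flip: exp_add)
    have "(exp t)\<^sup>2 * (4 * exp (- 2 * s) / (1 + exp (- 2 * s) * (exp t)\<^sup>2)\<^sup>2) = 4 * x\<^sup>2 / (1 + x\<^sup>2)\<^sup>2"
      unfolding e[symmetric] by simp
    also have "\<dots> = 1 / ((x + 1 / x) / 2)\<^sup>2"
      using x by (simp add: field_simps power2_eq_square)
    also have "(x + 1 / x) / 2 = cosh (t - s)"
      unfolding cosh_field_def x_def exp_minus[of "t - s"] inverse_eq_divide ..
    finally show ?thesis by (simp add: sech2_def)
  qed
  then show ?thesis
    unfolding area_density_bubble norm_polar by (simp add: sum_distrib_left)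
qed

text \<open>
  The part of being an eigenfunction that the upper bound on the number of eigenvalues uses.  In
  this form closure under linear combinations is immediate.
\<close>

definition chart_eigenfunction :: "(real^3 \<Rightarrow> real) \<Rightarrow> real \<Rightarrow> (real^3 \<Rightarrow> real) \<Rightarrow> bool" where
  "chart_eigenfunction G \<mu> f \<longleftrightarrow> smooth_on_sphere f \<and>
    (\<forall>y. partial 1 (partial 1 (\<lambda>y. f (stereo 1 y))) y + partial 2 (partial 2 (\<lambda>y. f (stereo 1 y))) y
       = - \<mu> * area_density G 1 y * f (stereo 1 y))"

lemma chart_eigenfunction_eigenspace:
  "(\<And>p. p \<in> sphere 0 1 \<Longrightarrow> G p > 0) \<Longrightarrow> f \<in> eigenspace (conformal G) \<mu> \<Longrightarrow> chart_eigenfunction G \<mu> f"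
  unfolding chart_eigenfunction_def using eigenspace_conformalD[of G f \<mu>] by (auto simp: eigenspace_def)

lemma chart_eigenfunction_sum:
  assumes "finite B" "\<And>f. f \<in> B \<Longrightarrow> chart_eigenfunction G \<mu> f"
  shows "chart_eigenfunction G \<mu> (\<lambda>p. \<Sum>f\<in>B. c f * f p)"
  using assms
proof (induction B rule: finite_induct)
  case empty
  then show ?case by (simp add: chart_eigenfunction_def smooth_on_sphere_def smooth_const partial_const)
next
  case (insert g B)
  define u v where "u = (\<lambda>y. g (stereo 1 y))" and "v = (\<lambda>y. \<Sum>f\<in>B. c f * f (stereo 1 y))"
  have gB: "chart_eigenfunction G \<mu> g" "chart_eigenfunction G \<mu> (\<lambda>p. \<Sum>f\<in>B. c f * f p)" using insert by auto
  then have s: "smooth u" "smooth v" unfolding u_def v_def chart_eigenfunction_def smooth_on_sphere_def by auto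
  have p: "partial i (\<lambda>y. c g * u y + v y) y = c g * partial i u y + partial i v y"
    if "smooth u" "smooth v" for i u v and y :: "real^2"
  proof -
    have "(\<lambda>y. c g * u y) differentiable (at y)"
      using that smooth_differentiable smooth_mult smooth_const by blast
    moreover have "partial i (\<lambda>y. c g * u y) y = c g * partial i u y"
      using that smooth_differentiable by (intro partial_bounded_linear[OF bounded_linear_mult_right])
    ultimately show ?thesis using that smooth_differentiable by (subst partial_add) auto
  qed
  have pp: "partial i (partial i (\<lambda>y. c g * u y + v y)) y = c g * partial i (partial i u) y + partial i (partial i v) y" for i y
  proof -
    have "partial i (\<lambda>y. c g * u y + v y) = (\<lambda>y. c g * partial i u y + partial i v y)" using p[OF s] by blast
    then show ?thesis using p[OF smooth_partial[OF s(1)] smooth_partial[OF s(2)]] by simp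
  qed
  have "smooth_on_sphere (\<lambda>p. c g * g p + (\<Sum>f\<in>B. c f * f p))"
    using gB unfolding chart_eigenfunction_def smooth_on_sphere_def by (auto intro!: smooth_add smooth_mult smooth_const)
  moreover have "partial 1 (partial 1 (\<lambda>y. c g * u y + v y)) y + partial 2 (partial 2 (\<lambda>y. c g * u y + v y)) y
     = - \<mu> * area_density G 1 y * (c g * u y + v y)" for y
  proof -
    have "partial 1 (partial 1 u) y + partial 2 (partial 2 u) y = - \<mu> * area_density G 1 y * u y"
      "partial 1 (partial 1 v) y + partial 2 (partial 2 v) y = - \<mu> * area_density G 1 y * v y"
      using gB unfolding chart_eigenfunction_def u_def v_def by auto
    then show ?thesis unfolding pp by algebra
  qed
  ultimately show ?case using insert unfolding chart_eigenfunction_def u_def v_def by simp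
qed

text \<open>
  The eigenfunctions are grouped by eigenvalue: the coefficients are chosen for all of them
  together, and the members of the cylinder family are the partial sums over the groups.
  These vanish, and then the independence within each group gives the contradiction.
\<close>

lemma eigenvalue_count_bubble:
  fixes k :: nat and \<tau> :: "nat \<Rightarrow> real"
  assumes k: "0 < k" and x: "x < 4 * pi * k * (17/10)"
    and q: "\<And>t. (q has_real_derivative q' t) (at t)" "\<And>t. \<bar>q t\<bar> \<le> 1"
      "\<And>t. 17/10 * (\<Sum>j<k. sech2 (t - \<tau> j)) \<le> (19/20)\<^sup>2 - (q t)\<^sup>2 - q' t"
    and r: "\<And>t. t \<notin> \<tau> ` {..<k} \<Longrightarrow> (r has_real_derivative r' t) (at t)" "\<And>t. \<bar>r t\<bar> \<le> 40 * k"
    "\<And>t. 17/10 * (\<Sum>j<k. sech2 (t - \<tau> j)) \<le> - (r t)\<^sup>2 - r' t"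
    "(r \<longlongrightarrow> 0) at_top" "(r \<longlongrightarrow> 0) at_bot"
  shows "\<not> enat (Suc k) \<le> eigenvalue_count (conformal (bubble_factor k \<tau>)) x"
proof
  define G where "G = bubble_factor k \<tau>"
  define P where "P t = (\<Sum>j<k. sech2 (t - \<tau> j))" for t
  have Gpos: "G p > 0" if "p \<in> sphere 0 1" for p unfolding G_def using k that by (rule bubble_factor_pos)
  assume "enat (Suc k) \<le> eigenvalue_count (conformal (bubble_factor k \<tau>)) x"
  then obtain A B where A: "finite A" "A \<subseteq> {..x}" and B: "\<And>\<mu>. \<mu> \<in> A \<Longrightarrow> finite (B \<mu>)"
    "\<And>\<mu>. \<mu> \<in> A \<Longrightarrow> B \<mu> \<subseteq> eigenspace (conformal G) \<mu>" "\<And>\<mu>. \<mu> \<in> A \<Longrightarrow> independent_on_sphere (B \<mu>)"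
    "k < (\<Sum>\<mu>\<in>A. card (B \<mu>))"
    unfolding G_def[symmetric] by (rule many_eigenfunctions) blast
  define J where "J = Sigma A B"
  have J: "finite J" "k < card J" unfolding J_def using A B by (auto simp: card_SigmaI)
  define a where "a j z = circ (\<lambda>\<theta>. pull (\<lambda>y. snd z (stereo 1 y)) (\<tau> j) \<theta>)" for j and z :: "real \<times> (real^3 \<Rightarrow> real)"
  obtain c where c: "\<exists>z\<in>J. c z \<noteq> 0" "\<And>j. j < k \<Longrightarrow> (\<Sum>z\<in>J. c z * a j z) = 0"
    using underdetermined_system[OF J, of a] by blast
  define u where "u \<mu> p = (\<Sum>f\<in>B \<mu>. c (\<mu>, f) * f p)" for \<mu> p
  have u: "chart_eigenfunction G \<mu> (u \<mu>)" if "\<mu> \<in> A" for \<mu>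
    unfolding u_def[abs_def] using B that Gpos
    by (intro chart_eigenfunction_sum chart_eigenfunction_eigenspace) auto
  define h where "h \<mu> y = u \<mu> (stereo 1 y)" for \<mu> y
  have us: "smooth_on_sphere (u \<mu>)" if "\<mu> \<in> A" for \<mu> using u[OF that] by (simp add: chart_eigenfunction_def)
  have hs: "smooth (h \<mu>)" if "\<mu> \<in> A" for \<mu>
    using us[OF that] unfolding smooth_on_sphere_def h_def[abs_def] by auto
  have "\<exists>C\<ge>0. (\<forall>t \<theta>. \<bar>pull (h \<mu>) t \<theta>\<bar> \<le> C) \<and> (\<forall>t \<theta>. \<bar>pull_t (h \<mu>) t \<theta>\<bar> \<le> C * exp (- \<bar>t\<bar>))
     \<and> (\<forall>t \<theta>. \<bar>pull_\<theta> (h \<mu>) t \<theta>\<bar> \<le> C * exp (- \<bar>t\<bar>))" if "\<mu> \<in> A" for \<mu>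
    using pull_bounds[OF us[OF that]] unfolding h_def[abs_def] by metis
  then obtain C where C: "\<And>\<mu>. \<mu> \<in> A \<Longrightarrow> 0 \<le> C \<mu>" "\<And>\<mu> t \<theta>. \<mu> \<in> A \<Longrightarrow> \<bar>pull (h \<mu>) t \<theta>\<bar> \<le> C \<mu>"
    "\<And>\<mu> t \<theta>. \<mu> \<in> A \<Longrightarrow> \<bar>pull_t (h \<mu>) t \<theta>\<bar> \<le> C \<mu> * exp (- \<bar>t\<bar>)"
    "\<And>\<mu> t \<theta>. \<mu> \<in> A \<Longrightarrow> \<bar>pull_\<theta> (h \<mu>) t \<theta>\<bar> \<le> C \<mu> * exp (- \<bar>t\<bar>)" by metis
  define K where "K = sum C A"
  have K: "C \<mu> \<le> K" if "\<mu> \<in> A" for \<mu> unfolding K_def using A(1) C(1) that by (intro member_le_sum) auto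
  have up: "v \<le> K * exp s" if "v \<le> C \<mu> * exp s" "\<mu> \<in> A" for v s \<mu>
    using that K[OF that(2)] by (meson exp_ge_zero mult_right_mono order_trans)
  define \<nu> where "\<nu> \<mu> = \<mu> / (4 * pi * k)" for \<mu> :: real
  have kpos: "0 < 4 * pi * k" using k by simp
  interpret cylinder_eigenfunctions A \<nu> P "\<lambda>\<mu>. pull (h \<mu>)" "\<lambda>\<mu>. pull_t (h \<mu>)" "\<lambda>\<mu>. pull_\<theta> (h \<mu>)"
    "\<lambda>\<mu>. pull_tt (h \<mu>)" "\<lambda>\<mu>. pull_\<theta>\<theta> (h \<mu>)" K
  proof
    fix \<mu> t \<theta> assume \<mu>: "\<mu> \<in> A"
    show "pull_tt (h \<mu>) t \<theta> + pull_\<theta>\<theta> (h \<mu>) t \<theta> = - \<nu> \<mu> * P t * pull (h \<mu>) t \<theta>"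
    proof -
      have "pull_tt (h \<mu>) t \<theta> + pull_\<theta>\<theta> (h \<mu>) t \<theta> = (exp t)\<^sup>2 * (- \<mu> * area_density G 1 (polar t \<theta>) * h \<mu> (polar t \<theta>))"
        using u[OF \<mu>] unfolding pull_laplacian chart_eigenfunction_def h_def[abs_def] by auto
      also have "\<dots> = - \<mu> * ((exp t)\<^sup>2 * area_density G 1 (polar t \<theta>)) * pull (h \<mu>) t \<theta>"
        by (simp add: pull_def)
      also have "\<dots> = - \<nu> \<mu> * P t * pull (h \<mu>) t \<theta>"
        unfolding G_def bubble_density_cylinder P_def \<nu>_def by simp
      finally show ?thesis .
    qed
    show "\<bar>pull (h \<mu>) t \<theta>\<bar> \<le> K" using C(2)[OF \<mu>, of t \<theta>] K[OF \<mu>] by linarith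
    show "\<bar>pull_t (h \<mu>) t \<theta>\<bar> \<le> K * exp (- \<bar>t\<bar>)" "\<bar>pull_\<theta> (h \<mu>) t \<theta>\<bar> \<le> K * exp (- \<bar>t\<bar>)"
      using up[OF C(3)[OF \<mu>] \<mu>] up[OF C(4)[OF \<mu>] \<mu>] by auto
    show "pull (h \<mu>) t (2 * pi) = pull (h \<mu>) t 0" "pull_\<theta> (h \<mu>) t (2 * pi) = pull_\<theta> (h \<mu>) t 0"
      by (simp_all add: pull_def pull_\<theta>_def polar_periodic)
  qed (use A(1) hs in \<open>auto intro!: pull_derivatives pull_second_derivatives pull_continuous pull_parts_continuous continuous_intros\<close>)
  have zero: "pull (h \<mu>) t \<theta> = 0" if \<mu>: "\<mu> \<in> A" and \<theta>: "\<theta> \<in> {0..2*pi}" for \<mu> t \<theta>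
  proof (rule eigenfunctions_vanish[where L = "17/10" and \<beta> = "19/20" and q = q and q' = q' and r = r and r' = r' and M = "40 * k" and Z = "\<tau> ` {..<k}"])
    show "inj_on \<nu> A" using kpos by (auto simp: inj_on_def \<nu>_def)
    show "\<nu> i < 17/10" if "i \<in> A" for i
    proof -
      have "i < 4 * pi * k * (17/10)" using that A(2) x by auto
      then show ?thesis unfolding \<nu>_def using kpos by (simp add: divide_less_eq mult.commute)
    qed
    show "0 < P t" for t unfolding P_def using k by (intro sum_pos) (auto simp: sech2_pos)
    have "1 \<le> 40 * real k" using k by simp
    then show "\<bar>q t\<bar> \<le> 40 * k" for t using q(2)[of t] by simp
    show "circ (\<lambda>\<theta>. \<Sum>\<mu>\<in>A. pull (h \<mu>) s \<theta>) = 0" if s: "s \<in> \<tau> ` {..<k}" for s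
    proof -
      obtain j where j: "j < k" "s = \<tau> j" using s by auto
      have sm: "smooth (\<lambda>y. f (stereo 1 y))" if "\<mu> \<in> A" "f \<in> B \<mu>" for \<mu> f
        using B(2)[OF that(1)] that(2) unfolding eigenspace_def smooth_on_sphere_def by auto
      have "circ (\<lambda>\<theta>. \<Sum>\<mu>\<in>A. pull (h \<mu>) s \<theta>) = (\<Sum>\<mu>\<in>A. circ (pull (h \<mu>) s))"
        by (rule circ_sum[OF A(1)]) (intro pull_continuous hs continuous_intros)
      also have "\<dots> = (\<Sum>\<mu>\<in>A. \<Sum>f\<in>B \<mu>. c (\<mu>, f) * a j (\<mu>, f))"
      proof (rule sum.cong[OF refl])
        fix \<mu> assume \<mu>: "\<mu> \<in> A"
        have "circ (pull (h \<mu>) s) = circ (\<lambda>\<theta>. \<Sum>f\<in>B \<mu>. c (\<mu>, f) * pull (\<lambda>y. f (stereo 1 y)) s \<theta>)"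
          by (simp add: pull_def[abs_def] h_def u_def)
        also have "\<dots> = (\<Sum>f\<in>B \<mu>. circ (\<lambda>\<theta>. c (\<mu>, f) * pull (\<lambda>y. f (stereo 1 y)) s \<theta>))"
          by (rule circ_sum[OF B(1)[OF \<mu>]]) (intro continuous_intros pull_continuous sm[OF \<mu>])
        finally show "circ (pull (h \<mu>) s) = (\<Sum>f\<in>B \<mu>. c (\<mu>, f) * a j (\<mu>, f))"
          by (simp add: circ_cmult a_def j)
      qed
      also have "\<dots> = (\<Sum>z\<in>J. c z * a j z)" unfolding J_def using A B by (subst sum.Sigma) (auto simp: case_prod_beta)
      finally show ?thesis using c(2)[OF j(1)] by simp
    qed
  qed (use q r \<mu> \<theta> in \<open>auto simp: P_def\<close>)
  have "c (\<mu>, f) = 0" if \<mu>: "\<mu> \<in> A" and f: "f \<in> B \<mu>" for \<mu> f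
  proof -
    have "u \<mu> p = 0" if "p \<in> sphere 0 1" for p
      by (rule vanish_on_sphere[OF us[OF \<mu>] _ that]) (use zero[OF \<mu>] in \<open>simp add: h_def[abs_def]\<close>)
    then have "\<forall>p\<in>sphere 0 1. (\<Sum>f\<in>B \<mu>. c (\<mu>, f) * f p) = 0" by (simp add: u_def)
    moreover have "(\<forall>p\<in>sphere 0 1. (\<Sum>f\<in>B \<mu>. c (\<mu>, f) * f p) = 0) \<longrightarrow> (\<forall>f\<in>B \<mu>. c (\<mu>, f) = 0)"
      using spec[OF B(3)[OF \<mu>, unfolded independent_on_sphere_def], of "\<lambda>f. c (\<mu>, f)"] .
    ultimately show ?thesis using f by blast
  qed
  then show False using c(1) by (auto simp: J_def)
qed

lemma bubble_metric_exists:
  fixes k :: nat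
  assumes k: "0 < k"
  obtains g where "riemannian_metric g" "area g = 1" "ereal (4 * pi * k * (8/5)) \<le> eigenvalue k g"
proof -
  obtain D :: real where D: "0 \<le> D" "16000 * k \<le> (cosh D)\<^sup>2"
    "\<And>x. D \<le> \<bar>x\<bar> \<Longrightarrow> (2 / cosh x) powr (9/10) \<le> 1 / (20 * k)"
    using bubble_positions[OF k] by blast
  define \<tau> where "\<tau> j = D * real j" for j
  have far: "D \<le> \<bar>\<tau> i - \<tau> j\<bar>" if "i \<noteq> j" for i j
  proof -
    have "1 \<le> \<bar>real i - real j\<bar>" using that by linarith
    then have "D * 1 \<le> D * \<bar>real i - real j\<bar>" using D(1) by (intro mult_left_mono)
    also have "\<dots> = \<bar>D * (real i - real j)\<bar>" using D(1) by (simp add: abs_mult)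
    finally show ?thesis by (simp add: \<tau>_def right_diff_distrib)
  qed
  obtain q q' where q: "\<And>t. (q has_real_derivative q' t) (at t)" "\<And>t. \<bar>q t\<bar> \<le> 1"
    "\<And>t. 17/10 * (\<Sum>j<k. sech2 (t - \<tau> j)) \<le> (19/20)\<^sup>2 - (q t)\<^sup>2 - q' t"
    using fluctuation_multiplier[OF k, of \<tau>] D(3)[OF far] by blast
  obtain r r' where r: "\<And>t. t \<notin> \<tau> ` {..<k} \<Longrightarrow> (r has_real_derivative r' t) (at t)" "\<And>t. \<bar>r t\<bar> \<le> 40 * k"
    "\<And>t. 17/10 * (\<Sum>j<k. sech2 (t - \<tau> j)) \<le> - (r t)\<^sup>2 - r' t"
    "(r \<longlongrightarrow> 0) at_top" "(r \<longlongrightarrow> 0) at_bot"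
    using mean_multiplier[of k D \<tau>] far D by blast
  have pk: "0 < 4 * pi * k" using k by simp
  have "ereal (4 * pi * k * (8/5)) \<le> eigenvalue k (conformal (bubble_factor k \<tau>))"
    unfolding eigenvalue_def
  proof (rule Inf_greatest)
    fix z assume "z \<in> {ereal x |x. enat (Suc k) \<le> eigenvalue_count (conformal (bubble_factor k \<tau>)) x}"
    then obtain x where x: "z = ereal x" "enat (Suc k) \<le> eigenvalue_count (conformal (bubble_factor k \<tau>)) x" by blast
    have "4 * pi * k * (17/10) \<le> x"
      using eigenvalue_count_bubble[OF k _ q r, of x] x(2) by (meson not_le)
    then have "4 * pi * k * (8/5) \<le> x" using pk by linarith
    then show "ereal (4 * pi * k * (8/5)) \<le> z" by (simp add: x)
  qed
  then show thesis using that riemannian_metric_bubble[OF k] area_bubble[OF k] by blast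
qed

theorem corollary2:
  fixes k :: nat
  assumes "k \<ge> 2"
  shows "\<exists>g. riemannian_metric g \<and> area g = 1 \<and> eigenvalue k g > eigenvalue k round_metric"
proof -
  obtain g where g: "riemannian_metric g" "area g = 1" "ereal (4 * pi * k * (8/5)) \<le> eigenvalue k g"
    using bubble_metric_exists[of k] assms by auto
  define l where "l = floor_sqrt k"
  have l: "l\<^sup>2 \<le> k" "k < (l + 1)\<^sup>2"
    using floor_sqrt_power2_le[of k] Suc_floor_sqrt_power2_gt[of k] by (auto simp: l_def)
  have "2 * (l * (l + 1)) \<le> 3 * k"
  proof (cases "2 \<le> l")
    case True
    then have "2 * l \<le> l\<^sup>2" by (simp add: power2_eq_square)
    moreover have "2 * (l * (l + 1)) = 2 * l\<^sup>2 + 2 * l" by (simp add: power2_eq_square)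
    ultimately show ?thesis using l(1) by linarith
  next
    case False
    then have "l * (l + 1) \<le> 1 * (1 + 1)" by (intro mult_le_mono) auto
    then show ?thesis using assms by simp
  qed
  then have "real (2 * (l * (l + 1))) \<le> real (3 * k)" by (rule of_nat_mono)
  moreover have "0 < real k" using assms by simp
  ultimately have "real l * (real l + 1) < k * (8/5)" by (simp add: algebra_simps)
  then have "4 * pi * (real l * (real l + 1)) < 4 * pi * k * (8/5)"
    using mult_strict_left_mono[of "real l * (real l + 1)" "k * (8/5)" "4 * pi"] by simp
  then have "eigenvalue k round_metric < eigenvalue k g"
    using eigenvalue_round_le[OF l(2)] g(3) by (meson ereal_less_eq(3) le_less_trans less_le_trans less_ereal.simps(1))
  with g show ?thesis by blast
qed

end
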